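(* Let $\mathfrak g$ be a simple finite-dimensional complex Lie algebra. The (irreducible) unitary highest weight representations of the $\mathfrak g$-supersymmetric algebra $\widehat{\mathfrak g}=\widehat{\mathfrak g}_+\ltimes\widehat{\mathfrak g}_-$ are the representations $H=L(V_\lambda,\ell)\otimes\mathcal F_{NS}^{\mathfrak g}$, with $\ell\in\mathbb N$ and $V_\lambda$ an irreducible representation of $\mathfrak g$ with $(\lambda,\theta)\le\ell$.
   Context: Lie algebra data. $\mathfrak g$ has a basis $(X_a)_{1\le a\le\dim\mathfrak g}$ with $[X_a,X_b]=i\sum_c\Gamma_{ab}^cX_c$, $\Gamma_{ab}^c\in\mathbb R$ totally antisymmetric, normalized so that $\sum_aX_a^2$ is exactly the Casimir (highest root $\theta$ of squared length 2); $g$ is the dual Coxeter number, $\sum_{a,c}\Gamma_{ac}^b\Gamma_{ac}^d=2g\,\delta_{bd}$. $\widehat{\mathfrak g}_+$ is spanned by $X^a_n$ ($n\in\mathbb Z$) and a central $\mathcal L$, with $[X_m^a,X_n^b]=i\sum_c\Gamma_{ab}^cX^c_{m+n}+m\,\delta_{ab}\delta_{m+n,0}\mathcal L$, $(X_n^a)^\star=X_{-n}^a$. $L(V_\lambda,\ell)$ is its irreducible unitary highest weight representation with $\mathcal L=\ell$ and lowest energy subspace $V_\lambda$ (highest weight $\lambda$). $\widehat{\mathfrak g}_-$ is generated by $\psi^a_m$, $m\in\mathbb Z+\frac12$, with $[\psi^a_m,\psi^b_n]_+=\delta_{ab}\delta_{m+n,0}$, $(\psi^a_m)^\star=\psi^a_{-m}$.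 $\mathcal F_{NS}^{\mathfrak g}$ is its unique irreducible unitary highest weight representation, generated by a unit vector $\Omega$ with $\psi^a_m\Omega=0$ for $m>0$. On $\mathcal F_{NS}^{\mathfrak g}$ there are operators $S^a_n$ ($n\in\mathbb Z$), the modes of the field $\sum_nS^c_nz^{-n-1}=-\frac i2\sum_{a,b}\Gamma_{ab}^c\,{:}\psi^a(z)\psi^b(z){:}$ with $\psi^a(z)=\sum_{n\in\mathbb Z}\psi^a_{n+1/2}z^{-n-1}$ (normal ordering: annihilation operators $\psi_m$, $m>0$, to the right, with sign), satisfying the relations of $\widehat{\mathfrak g}_+$ with $\mathcal L=g$ and $[S^a_m,\psi^b_n]=i\sum_c\Gamma_{ab}^c\psi^c_{m+n}$. $\widehat{\mathfrak g}$ is the semidirect product in which $\widehat{\mathfrak g}_+$ acts on $\widehat{\mathfrak g}_-$ by $[X^a_m,\psi^b_n]=i\sum_c\Gamma_{ab}^c\psi^c_{m+n}$ ($\mathcal L$ central). It acts on $L(V_\lambda,\ell)\otimes\mathcal F_{NS}^{\mathfrak g}$ by letting $\psi^a_m$ act on the second factor and the element $X^a_n\in\widehat{\mathfrak g}_+$ act as $B^a_n=X^a_n\otimes1+1\otimes S^a_n$ (level $\ell+g$). A unitary highest weight representation is an irreducible representation on a prehilbert space respecting $\star$, generated by a cyclic vector annihilated by all $X^a_n$ ($n>0$), $\psi^a_m$ ($m>0$) and of highest weight for the zero modes $X_0^a$; representations are considered up to unitary equivalence. *)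

theory Defs
  imports Complex_Main "HOL-Library.Function_Algebras" "HOL-Library.Groups_Big_Fun"
begin

section \<open>The simple Lie algebra\<close>

text \<open>
  The Lie algebra is the whole type \<open>'g\<close>; its basis \<open>(X_a)\<close> is indexed by the finite type \<open>'a\<close>.
  Elements of the dual of the Cartan subalgebra (roots, weights) are identified with elements of the
  Cartan subalgebra through the invariant bilinear form \<open>form\<close> for which \<open>(X_a)\<close> is orthonormal:
  the element \<open>\<alpha>\<close> stands for the functional \<open>h \<mapsto> form \<alpha> h\<close>.
\<close>

record ('a, 'g) lie_data =
  gscale :: "complex \<Rightarrow> 'g \<Rightarrow> 'g"
  brk :: "'g \<Rightarrow> 'g \<Rightarrow> 'g"
  basis :: "'a \<Rightarrow> 'g"
  Gam :: "'a \<Rightarrow> 'a \<Rightarrow> 'a \<Rightarrow> real"  \<comment> \<open>\<open>Gam a b c\<close> is \<open>\<Gamma>\<close> with lower indices \<open>a b\<close> and upper index \<open>c\<close>\<close>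
  dual_cox :: real
  cartan :: "'g set"
  pos_roots :: "'g set"
  theta :: 'g

definition lie_algebra :: "(complex \<Rightarrow> 'g \<Rightarrow> 'g::ab_group_add) \<Rightarrow> ('g \<Rightarrow> 'g \<Rightarrow> 'g) \<Rightarrow> bool" where
  "lie_algebra s br \<longleftrightarrow> vector_space s
     \<and> (\<forall>x y z. br (x + y) z = br x z + br y z) \<and> (\<forall>c x y. br (s c x) y = s c (br x y))
     \<and> (\<forall>x y z. br x (y + z) = br x y + br x z) \<and> (\<forall>c x y. br x (s c y) = s c (br x y))
     \<and> (\<forall>x. br x x = 0)
     \<and> (\<forall>x y z. br x (br y z) + br y (br z x) + br z (br x y) = 0)"

definition simple_lie_algebra :: "(complex \<Rightarrow> 'g \<Rightarrow> 'g::ab_group_add) \<Rightarrow> ('g \<Rightarrow> 'g \<Rightarrow> 'g) \<Rightarrow> bool" where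
  "simple_lie_algebra s br \<longleftrightarrow> lie_algebra s br \<and> (\<exists>x y. br x y \<noteq> 0)
     \<and> (\<forall>I. module.subspace s I \<and> (\<forall>x. \<forall>y\<in>I. br x y \<in> I) \<longrightarrow> I = {0} \<or> I = UNIV)"

definition coord :: "('a, 'g::ab_group_add) lie_data \<Rightarrow> 'a \<Rightarrow> 'g \<Rightarrow> complex" where
  "coord G a x = module.representation (gscale G) (range (basis G)) x (basis G a)"

definition form :: "('a::finite, 'g::ab_group_add) lie_data \<Rightarrow> 'g \<Rightarrow> 'g \<Rightarrow> complex" where
  "form G x y = (\<Sum>a\<in>UNIV. coord G a x * coord G a y)"

text \<open>The antilinear involution fixing the basis, \<open>X_a\<^sup>\<star> = X_a\<close>.\<close>

definition gstar :: "('a::finite, 'g::ab_group_add) lie_data \<Rightarrow> 'g \<Rightarrow> 'g" where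
  "gstar G x = (\<Sum>a\<in>UNIV. gscale G (cnj (coord G a x)) (basis G a))"

definition cartan_subalgebra :: "(complex \<Rightarrow> 'g \<Rightarrow> 'g::ab_group_add) \<Rightarrow> ('g \<Rightarrow> 'g \<Rightarrow> 'g) \<Rightarrow> 'g set \<Rightarrow> bool" where
  "cartan_subalgebra s br H \<longleftrightarrow> module.subspace s H
     \<and> (\<forall>h\<in>H. \<forall>k\<in>H. br h k = 0)
     \<and> (\<forall>x. (\<forall>h\<in>H. br h x = 0) \<longrightarrow> x \<in> H)
     \<and> (\<forall>h\<in>H. module.span s {x. \<exists>c. br h x = s c x} = UNIV)"

definition root_space :: "('a::finite, 'g::ab_group_add) lie_data \<Rightarrow> 'g \<Rightarrow> 'g set" where
  "root_space G \<alpha> = {x. \<forall>h\<in>cartan G. brk G h x = gscale G (form G \<alpha> h) x}"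

definition roots :: "('a::finite, 'g::ab_group_add) lie_data \<Rightarrow> 'g set" where
  "roots G = {\<alpha>\<in>cartan G. \<alpha> \<noteq> 0 \<and> root_space G \<alpha> \<noteq> {0}}"

locale simple_lie_data =
  fixes G :: "('a::finite, 'g::ab_group_add) lie_data"
  assumes simple: "simple_lie_algebra (gscale G) (brk G)"
    and basis_inj: "inj (basis G)"
    and basis_indep: "\<not> module.dependent (gscale G) (range (basis G))"
    and basis_span: "module.span (gscale G) (range (basis G)) = UNIV"
    and brk_basis: "brk G (basis G a) (basis G b)
                      = gscale G \<i> (\<Sum>c\<in>UNIV. gscale G (complex_of_real (Gam G a b c)) (basis G c))"
    and Gam_antisym: "Gam G b a c = - Gam G a b c" "Gam G a c b = - Gam G a b c"
    and dual_coxeter: "(\<Sum>a\<in>UNIV. \<Sum>c\<in>UNIV. Gam G a c b * Gam G a c d) = (if b = d then 2 * dual_cox G else 0)"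
    and cartan: "cartan_subalgebra (gscale G) (brk G) (cartan G)"
    and cartan_star: "gstar G ` cartan G \<subseteq> cartan G"
    and pos_roots: "pos_roots G \<subseteq> roots G"
      "\<alpha> \<in> roots G \<Longrightarrow> (\<alpha> \<in> pos_roots G) \<noteq> (- \<alpha> \<in> pos_roots G)"
      "\<lbrakk>\<alpha> \<in> pos_roots G; \<beta> \<in> pos_roots G; \<alpha> + \<beta> \<in> roots G\<rbrakk> \<Longrightarrow> \<alpha> + \<beta> \<in> pos_roots G"
    and theta_highest: "theta G \<in> roots G" "\<alpha> \<in> pos_roots G \<Longrightarrow> theta G + \<alpha> \<notin> roots G"
    and theta_norm: "form G (theta G) (theta G) = 2"

section \<open>Representations of generators on vector spaces and prehilbert spaces\<close>

text \<open>
  A representation lives on a subspace \<open>carr\<close> of the type \<open>'v\<close>; \<open>'i\<close> is the type of the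
  generators. Operators and inner products are only relevant on \<open>carr\<close>.
\<close>

record ('i, 'v) rep =
  carr :: "'v set"
  vscale :: "complex \<Rightarrow> 'v \<Rightarrow> 'v"
  act :: "'i \<Rightarrow> 'v \<Rightarrow> 'v"

record ('i, 'v) prehilbert_rep = "('i, 'v) rep" +
  inn :: "'v \<Rightarrow> 'v \<Rightarrow> complex"

definition linear_map_between ::
  "('i, 'v::ab_group_add, 'z) rep_scheme \<Rightarrow> ('j, 'w::ab_group_add, 'y) rep_scheme \<Rightarrow> ('v \<Rightarrow> 'w) \<Rightarrow> bool" where
  "linear_map_between V W T \<longleftrightarrow> (\<forall>u\<in>carr V. T u \<in> carr W)
     \<and> (\<forall>u\<in>carr V. \<forall>v\<in>carr V. T (u + v) = T u + T v)
     \<and> (\<forall>c. \<forall>u\<in>carr V. T (vscale V c u) = vscale W c (T u))"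

definition linear_rep :: "('i, 'v::ab_group_add, 'z) rep_scheme \<Rightarrow> bool" where
  "linear_rep V \<longleftrightarrow> vector_space (vscale V) \<and> module.subspace (vscale V) (carr V)
     \<and> (\<forall>i. linear_map_between V V (act V i))"

definition inner_product :: "('i, 'v::ab_group_add) prehilbert_rep \<Rightarrow> bool" where
  "inner_product V \<longleftrightarrow>
     (\<forall>u\<in>carr V. \<forall>v\<in>carr V. \<forall>w\<in>carr V. inn V u (v + w) = inn V u v + inn V u w)
     \<and> (\<forall>c. \<forall>u\<in>carr V. \<forall>v\<in>carr V. inn V u (vscale V c v) = c * inn V u v)
     \<and> (\<forall>u\<in>carr V. \<forall>v\<in>carr V. inn V v u = cnj (inn V u v))
     \<and> (\<forall>u\<in>carr V. u \<noteq> 0 \<longrightarrow> Re (inn V u u) > 0)"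

definition unitary_rep :: "('i \<Rightarrow> 'i) \<Rightarrow> ('i, 'v::ab_group_add) prehilbert_rep \<Rightarrow> bool" where
  "unitary_rep star V \<longleftrightarrow> linear_rep V \<and> inner_product V
     \<and> (\<forall>i. \<forall>u\<in>carr V. \<forall>v\<in>carr V. inn V (act V i u) v = inn V u (act V (star i) v))"

definition invariant_subspace :: "('i, 'v::ab_group_add, 'z) rep_scheme \<Rightarrow> 'v set \<Rightarrow> bool" where
  "invariant_subspace V W \<longleftrightarrow> module.subspace (vscale V) W \<and> W \<subseteq> carr V \<and> (\<forall>i. \<forall>w\<in>W. act V i w \<in> W)"

definition irreducible_rep :: "('i, 'v::ab_group_add, 'z) rep_scheme \<Rightarrow> bool" where
  "irreducible_rep V \<longleftrightarrow> carr V \<noteq> {0} \<and> (\<forall>W. invariant_subspace V W \<longrightarrow> W = {0} \<or> W = carr V)"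

definition cyclic_vector :: "('i, 'v::ab_group_add, 'z) rep_scheme \<Rightarrow> 'v \<Rightarrow> bool" where
  "cyclic_vector V v \<longleftrightarrow> v \<in> carr V \<and> (\<forall>W. invariant_subspace V W \<and> v \<in> W \<longrightarrow> W = carr V)"

definition equivalent_reps ::
  "('i, 'v::ab_group_add, 'z) rep_scheme \<Rightarrow> ('i, 'w::ab_group_add, 'y) rep_scheme \<Rightarrow> bool" where
  "equivalent_reps V W \<longleftrightarrow> (\<exists>T. linear_map_between V W T \<and> bij_betw T (carr V) (carr W)
     \<and> (\<forall>i. \<forall>v\<in>carr V. T (act V i v) = act W i (T v)))"

definition unitarily_equivalent ::
  "('i, 'v::ab_group_add) prehilbert_rep \<Rightarrow> ('i, 'w::ab_group_add) prehilbert_rep \<Rightarrow> bool" where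
  "unitarily_equivalent V W \<longleftrightarrow> (\<exists>T. linear_map_between V W T \<and> bij_betw T (carr V) (carr W)
     \<and> (\<forall>i. \<forall>v\<in>carr V. T (act V i v) = act W i (T v))
     \<and> (\<forall>u\<in>carr V. \<forall>v\<in>carr V. inn W (T u) (T v) = inn V u v))"

abbreviation commutator :: "('i, 'v::ab_group_add, 'z) rep_scheme \<Rightarrow> 'i \<Rightarrow> 'i \<Rightarrow> 'v \<Rightarrow> 'v" where
  "commutator V i j v \<equiv> act V i (act V j v) - act V j (act V i v)"

section \<open>Highest weight representations of the simple Lie algebra\<close>

definition lie_rep :: "('a::finite, 'g::ab_group_add) lie_data \<Rightarrow> ('g, 'v::ab_group_add) rep \<Rightarrow> bool" where
  "lie_rep G V \<longleftrightarrow> linear_rep V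
     \<and> (\<forall>x y. \<forall>v\<in>carr V. act V (x + y) v = act V x v + act V y v)
     \<and> (\<forall>c x. \<forall>v\<in>carr V. act V (gscale G c x) v = vscale V c (act V x v))
     \<and> (\<forall>x y. \<forall>v\<in>carr V. act V (brk G x y) v = commutator V x y v)"

definition highest_weight_vector ::
  "('a::finite, 'g::ab_group_add) lie_data \<Rightarrow> ('g, 'v::ab_group_add) rep \<Rightarrow> 'g \<Rightarrow> 'v \<Rightarrow> bool" where
  "highest_weight_vector G V lam v \<longleftrightarrow> lam \<in> cartan G \<and> v \<in> carr V \<and> v \<noteq> 0
     \<and> (\<forall>h\<in>cartan G. act V h v = vscale V (form G lam h) v)
     \<and> (\<forall>\<alpha>\<in>pos_roots G. \<forall>x\<in>root_space G \<alpha>. act V x v = 0)"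

definition irreducible_lie_rep ::
  "('a::finite, 'g::ab_group_add) lie_data \<Rightarrow> 'g \<Rightarrow> ('g, 'v::ab_group_add) rep \<Rightarrow> bool" where
  "irreducible_lie_rep G lam V \<longleftrightarrow> lie_rep G V \<and> irreducible_rep V
     \<and> (\<exists>B. finite B \<and> carr V = module.span (vscale V) B)
     \<and> (\<exists>v. highest_weight_vector G V lam v)"

section \<open>The bosonic part and the representations \<open>L(V, lev)\<close>\<close>

datatype 'a affine = Xmode 'a int | Level

primrec affine_star :: "'a affine \<Rightarrow> 'a affine" where
  "affine_star (Xmode a n) = Xmode a (- n)"
| "affine_star Level = Level"

definition affine_relations ::
  "('a::finite, 'g::ab_group_add) lie_data \<Rightarrow> ('a affine, 'v::ab_group_add) prehilbert_rep \<Rightarrow> bool" where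
  "affine_relations G R \<longleftrightarrow>
     (\<forall>a b m n. \<forall>v\<in>carr R. commutator R (Xmode a m) (Xmode b n) v
        = vscale R \<i> (\<Sum>c\<in>UNIV. vscale R (complex_of_real (Gam G a b c)) (act R (Xmode c (m + n)) v))
          + (if a = b \<and> m + n = 0 then vscale R (of_int m) (act R Level v) else 0))
     \<and> (\<forall>a n. \<forall>v\<in>carr R. commutator R Level (Xmode a n) v = 0)"

definition zero_modes ::
  "('a::finite, 'g::ab_group_add) lie_data \<Rightarrow> ('a affine, 'v::ab_group_add) prehilbert_rep \<Rightarrow> ('g, 'v) rep" where
  "zero_modes G R = \<lparr>carr = carr R, vscale = vscale R,
     act = (\<lambda>x v. \<Sum>a\<in>UNIV. vscale R (coord G a x) (act R (Xmode a 0) v))\<rparr>"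

definition unitary_hw_affine_rep ::
  "('a::finite, 'g::ab_group_add) lie_data \<Rightarrow> ('a affine, 'v::ab_group_add) prehilbert_rep \<Rightarrow> bool" where
  "unitary_hw_affine_rep G R \<longleftrightarrow> unitary_rep affine_star R \<and> affine_relations G R \<and> irreducible_rep R
     \<and> (\<exists>v lam. cyclic_vector R v \<and> highest_weight_vector G (zero_modes G R) lam v
          \<and> (\<forall>a n. n > 0 \<longrightarrow> act R (Xmode a n) v = 0))"

text \<open>
  An energy operator is diagonalizable with energies in \<open>\<nat>\<close>, normalized so that the lowest energy
  is \<open>0\<close>, and \<open>Xmode a n\<close> lowers the energy by \<open>n\<close>.
\<close>

definition energy_operator :: "('a affine, 'v::ab_group_add) prehilbert_rep \<Rightarrow> ('v \<Rightarrow> 'v) \<Rightarrow> bool" where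
  "energy_operator R D \<longleftrightarrow> linear_map_between R R D
     \<and> (\<forall>a n. \<forall>v\<in>carr R. D (act R (Xmode a n) v) - act R (Xmode a n) (D v) = vscale R (- of_int n) (act R (Xmode a n) v))
     \<and> module.span (vscale R) (\<Union>k::nat. {v\<in>carr R. D v = vscale R (of_nat k) v}) = carr R
     \<and> (\<exists>v\<in>carr R. v \<noteq> 0 \<and> D v = 0)"

definition lowest_energy_rep ::
  "('a::finite, 'g::ab_group_add) lie_data \<Rightarrow> ('a affine, 'v::ab_group_add) prehilbert_rep \<Rightarrow> ('v \<Rightarrow> 'v)
    \<Rightarrow> ('g, 'v) rep" where
  "lowest_energy_rep G R D = (zero_modes G R)\<lparr>carr := {v\<in>carr R. D v = 0}\<rparr>"

text \<open>\<open>R\<close> is (a model of) \<open>L(V, lev)\<close>.\<close>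

definition is_L ::
  "('a::finite, 'g::ab_group_add) lie_data \<Rightarrow> ('g, 'v::ab_group_add) rep \<Rightarrow> nat
    \<Rightarrow> ('a affine, 'w::ab_group_add) prehilbert_rep \<Rightarrow> bool" where
  "is_L G V lev R \<longleftrightarrow> unitary_hw_affine_rep G R
     \<and> (\<forall>v\<in>carr R. act R Level v = vscale R (of_nat lev) v)
     \<and> (\<exists>D. energy_operator R D \<and> equivalent_reps V (lowest_energy_rep G R D))"

section \<open>The fermionic part\<close>

text \<open>
  Half-integral modes are indexed by integers as in \<open>\<psi>\<^sup>a(z) = \<Sum>\<^sub>n \<psi>\<^sup>a\<^bsub>n+1/2\<^esub> z\<^bsup>-n-1\<^esup>\<close>:
  \<open>Psi a n\<close> is the mode \<open>n + 1/2\<close>. Hence modes \<open>m > 0\<close> are those with \<open>n \<ge> 0\<close>, the mode \<open>-m\<close> has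
  index \<open>-n - 1\<close>, and the modes of indices \<open>m\<close>, \<open>n\<close> add up to \<open>0\<close> iff \<open>m + n + 1 = 0\<close>.
\<close>

datatype 'a fermion = Psi 'a int

primrec fermion_star :: "'a fermion \<Rightarrow> 'a fermion" where
  "fermion_star (Psi a n) = Psi a (- n - 1)"

definition fermion_relations :: "('a fermion, 'v::ab_group_add) prehilbert_rep \<Rightarrow> bool" where
  "fermion_relations F \<longleftrightarrow> (\<forall>a b m n. \<forall>v\<in>carr F.
     act F (Psi a m) (act F (Psi b n) v) + act F (Psi b n) (act F (Psi a m) v)
       = (if a = b \<and> m + n + 1 = 0 then v else 0))"

definition is_fock_NS :: "('a fermion, 'v::ab_group_add) prehilbert_rep \<Rightarrow> bool" where
  "is_fock_NS F \<longleftrightarrow> unitary_rep fermion_star F \<and> fermion_relations F \<and> irreducible_rep F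
     \<and> (\<exists>\<Omega>. cyclic_vector F \<Omega> \<and> inn F \<Omega> \<Omega> = 1 \<and> (\<forall>a n. n \<ge> 0 \<longrightarrow> act F (Psi a n) \<Omega> = 0))"

definition normal_ordered ::
  "('a fermion, 'v::ab_group_add) prehilbert_rep \<Rightarrow> 'a \<Rightarrow> int \<Rightarrow> 'a \<Rightarrow> int \<Rightarrow> 'v \<Rightarrow> 'v" where
  "normal_ordered F a p b q v =
     (if p \<ge> 0 then - act F (Psi b q) (act F (Psi a p) v) else act F (Psi a p) (act F (Psi b q) v))"

text \<open>
  The product \<open>\<psi>\<^sup>a(z) \<psi>\<^sup>b(z)\<close> has coefficient \<open>\<Sum>\<^bsub>p+q+1=n\<^esub> \<psi>\<^sup>a\<^bsub>p+1/2\<^esub> \<psi>\<^sup>b\<^bsub>q+1/2\<^esub>\<close> at \<open>z\<^bsup>-n-1\<^esup>\<close>.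
  On each vector of the Fock space only finitely many normal ordered terms are nonzero, so the sum
  over \<open>p\<close> is a finitely supported one.
\<close>

definition S_mode ::
  "('a::finite, 'g::ab_group_add) lie_data \<Rightarrow> ('a fermion, 'v::ab_group_add) prehilbert_rep
    \<Rightarrow> 'a \<Rightarrow> int \<Rightarrow> 'v \<Rightarrow> 'v" where
  "S_mode G F c n v = vscale F (- \<i> / 2)
     (\<Sum>a\<in>UNIV. \<Sum>b\<in>UNIV. vscale F (complex_of_real (Gam G a b c))
        (Sum_any (\<lambda>p. normal_ordered F a p b (n - 1 - p) v)))"

section \<open>The supersymmetric algebra\<close>

datatype 'a super = Bos "'a affine" | Ferm "'a fermion"

primrec super_star :: "'a super \<Rightarrow> 'a super" where
  "super_star (Bos x) = Bos (affine_star x)"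
| "super_star (Ferm p) = Ferm (fermion_star p)"

definition restrict_rep ::
  "('j \<Rightarrow> 'i) \<Rightarrow> ('i, 'v) prehilbert_rep \<Rightarrow> ('j, 'v) prehilbert_rep" where
  "restrict_rep f H = \<lparr>carr = carr H, vscale = vscale H, act = (\<lambda>j. act H (f j)), inn = inn H\<rparr>"

definition super_relations ::
  "('a::finite, 'g::ab_group_add) lie_data \<Rightarrow> ('a super, 'v::ab_group_add) prehilbert_rep \<Rightarrow> bool" where
  "super_relations G H \<longleftrightarrow>
     affine_relations G (restrict_rep Bos H) \<and> fermion_relations (restrict_rep Ferm H)
     \<and> (\<forall>a b m n. \<forall>v\<in>carr H. commutator H (Bos (Xmode a m)) (Ferm (Psi b n)) v
          = vscale H \<i> (\<Sum>c\<in>UNIV. vscale H (complex_of_real (Gam G a b c)) (act H (Ferm (Psi c (m + n))) v)))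
     \<and> (\<forall>b n. \<forall>v\<in>carr H. commutator H (Bos Level) (Ferm (Psi b n)) v = 0)"

definition unitary_hw_super_rep ::
  "('a::finite, 'g::ab_group_add) lie_data \<Rightarrow> ('a super, 'v::ab_group_add) prehilbert_rep \<Rightarrow> bool" where
  "unitary_hw_super_rep G H \<longleftrightarrow> unitary_rep super_star H \<and> super_relations G H \<and> irreducible_rep H
     \<and> (\<exists>v lam. cyclic_vector H v
          \<and> highest_weight_vector G (zero_modes G (restrict_rep Bos H)) lam v
          \<and> (\<forall>a n. n > 0 \<longrightarrow> act H (Bos (Xmode a n)) v = 0)
          \<and> (\<forall>a n. n \<ge> 0 \<longrightarrow> act H (Ferm (Psi a n)) v = 0))"

section \<open>Tensor products\<close>

text \<open>
  The algebraic tensor product of two prehilbert spaces \<open>P\<close>, \<open>Q\<close> is realized inside the functions on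
  \<open>carr P \<times> carr Q\<close>: the pure tensor of \<open>v\<close> and \<open>w\<close> is the function
  \<open>(x, y) \<mapsto> \<langle>x, v\<rangle> \<langle>y, w\<rangle>\<close> (inner products are linear in the second argument). This is faithful
  because the inner products are definite. With this realization the value of \<open>g\<close> at \<open>(v, w)\<close> is the
  inner product of the pure tensor of \<open>v\<close> and \<open>w\<close> with \<open>g\<close>.
\<close>

definition tensor ::
  "('i, 'p::ab_group_add) prehilbert_rep \<Rightarrow> ('j, 'q::ab_group_add) prehilbert_rep \<Rightarrow> 'p \<Rightarrow> 'q
    \<Rightarrow> ('p \<times> 'q \<Rightarrow> complex)" where
  "tensor P Q v w = (\<lambda>(x, y). if x \<in> carr P \<and> y \<in> carr Q then inn P x v * inn Q y w else 0)"

definition tensor_scale :: "complex \<Rightarrow> ('p \<times> 'q \<Rightarrow> complex) \<Rightarrow> ('p \<times> 'q \<Rightarrow> complex)" where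
  "tensor_scale c f = (\<lambda>z. c * f z)"

definition tensor_carrier ::
  "('i, 'p::ab_group_add) prehilbert_rep \<Rightarrow> ('j, 'q::ab_group_add) prehilbert_rep \<Rightarrow> ('p \<times> 'q \<Rightarrow> complex) set" where
  "tensor_carrier P Q = module.span tensor_scale {tensor P Q v w | v w. v \<in> carr P \<and> w \<in> carr Q}"

text \<open>
  Some expression as a sum of pure tensors. The inner product and the operators \<open>A \<otimes> B\<close> (for linear
  \<open>A\<close>, \<open>B\<close>) below do not depend on the choice.
\<close>

definition tensor_decomp ::
  "('i, 'p::ab_group_add) prehilbert_rep \<Rightarrow> ('j, 'q::ab_group_add) prehilbert_rep \<Rightarrow> ('p \<times> 'q \<Rightarrow> complex)
    \<Rightarrow> ('p \<times> 'q) list" where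
  "tensor_decomp P Q f =
     (SOME ps. set ps \<subseteq> carr P \<times> carr Q \<and> f = (\<Sum>(v, w)\<leftarrow>ps. tensor P Q v w))"

definition tensor_inner ::
  "('i, 'p::ab_group_add) prehilbert_rep \<Rightarrow> ('j, 'q::ab_group_add) prehilbert_rep
    \<Rightarrow> ('p \<times> 'q \<Rightarrow> complex) \<Rightarrow> ('p \<times> 'q \<Rightarrow> complex) \<Rightarrow> complex" where
  "tensor_inner P Q f g = (\<Sum>(v, w)\<leftarrow>tensor_decomp P Q f. g (v, w))"

definition tensor_op ::
  "('i, 'p::ab_group_add) prehilbert_rep \<Rightarrow> ('j, 'q::ab_group_add) prehilbert_rep
    \<Rightarrow> ('p \<Rightarrow> 'p) \<Rightarrow> ('q \<Rightarrow> 'q) \<Rightarrow> ('p \<times> 'q \<Rightarrow> complex) \<Rightarrow> ('p \<times> 'q \<Rightarrow> complex)" where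
  "tensor_op P Q A B f = (\<Sum>(v, w)\<leftarrow>tensor_decomp P Q f. tensor P Q (A v) (B w))"

primrec boson_tensor_act ::
  "('a::finite, 'g::ab_group_add) lie_data \<Rightarrow> ('a affine, 'p::ab_group_add) prehilbert_rep
    \<Rightarrow> ('a fermion, 'q::ab_group_add) prehilbert_rep \<Rightarrow> 'a affine
    \<Rightarrow> ('p \<times> 'q \<Rightarrow> complex) \<Rightarrow> ('p \<times> 'q \<Rightarrow> complex)" where
  "boson_tensor_act G R F (Xmode a n) =
     (\<lambda>f. tensor_op R F (act R (Xmode a n)) id f + tensor_op R F id (S_mode G F a n) f)"
| "boson_tensor_act G R F Level =
     (\<lambda>f. tensor_op R F (act R Level) id f + tensor_scale (complex_of_real (dual_cox G)) f)"

definition super_tensor ::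
  "('a::finite, 'g::ab_group_add) lie_data \<Rightarrow> ('a affine, 'p::ab_group_add) prehilbert_rep
    \<Rightarrow> ('a fermion, 'q::ab_group_add) prehilbert_rep \<Rightarrow> ('a super, 'p \<times> 'q \<Rightarrow> complex) prehilbert_rep" where
  "super_tensor G R F = \<lparr>carr = tensor_carrier R F, vscale = tensor_scale,
     act = (\<lambda>i. case i of Bos x \<Rightarrow> boson_tensor_act G R F x
                        | Ferm p \<Rightarrow> tensor_op R F id (act F p)),
     inn = tensor_inner R F\<rparr>"

end

(*
The tensor product is handled through adjoints: the value of (A \<otimes> B) f at (x, y) is f (A* x, B* y).
The relations of the S-modes at level g hold because the defect of each relation commutes with all
fermions, hence is a scalar on the Fock space, and this scalar is a vacuum expectation.

Conversely, in a unitary highest weight representation H the differences X = B - S commute with the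
fermions. The space H_0 of vectors killed by all annihilation operators carries a representation R of
the affine algebra, and the vacuum expectation values identify H with the tensor product of H_0 and
the Fock space.

It remains to see that an irreducible unitary highest weight representation R of the affine algebra is
some L(V, lev). Its singular vectors form an irreducible representation V of the zero modes, on which
the Casimir element is a scalar. The Casimir element is the sum of the squares of the hermitian
operators X_a, so these are bounded, root vectors are nilpotent and V is finite-dimensional. The level
is a scalar by an algebraic version of Schur's lemma, and it is a natural number bounding (lam, theta)
by the representation theory of sl_2 applied to a real and to an affine root.
*)

theory Submission
  imports Defs "HOL-Computational_Algebra.Fundamental_Theorem_Algebra"
begin

section \<open>Prehilbert spaces\<close>

text \<open>The spaces are incomplete and infinite-dimensional, so neither orthogonal projections
  nor the analytic Schur lemma are at hand. One device replaces both. To show that a subspace A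
  exhausts a space E containing it, every vector w of a space around E is given some a in A with the
  same inner products against E as w; for w in E the difference w - a lies in E, hence is orthogonal
  to itself. The vector a is found by induction over words in the generators, moving adjoints to the
  other side. The device is applied to invariant subspaces of H_0, to modules of singular vectors
  and to the vectors of highest weight. These inductions run over words of bounded length instead of
  a Poincare-Birkhoff-Witt basis: commuting two letters only costs shorter words. The same
  filtration makes long words in the zero modes redundant, which gives finite dimension. The energy
  operator demanded by \<open>is_L\<close> does not come from the Sugawara formula. It is read off
  from the grading of words by their total mode.\<close>

locale prehilbert =
  fixes V :: "('i, 'v::ab_group_add) prehilbert_rep"
  assumes vector_space_scale: "vector_space (vscale V)"
    and subspace_carr: "module.subspace (vscale V) (carr V)"
    and inner_product: "inner_product V"
begin

sublocale vector_space "vscale V"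
  by (rule vector_space_scale)

lemma carr_zero [simp]: "0 \<in> carr V"
  using subspace_carr by (rule subspace_0)

lemma carr_add [simp]: "\<lbrakk>u \<in> carr V; v \<in> carr V\<rbrakk> \<Longrightarrow> u + v \<in> carr V"
  using subspace_carr by (rule subspace_add)

lemma carr_diff [simp]: "\<lbrakk>u \<in> carr V; v \<in> carr V\<rbrakk> \<Longrightarrow> u - v \<in> carr V"
  using subspace_carr by (rule subspace_diff)

lemma carr_neg [simp]: "u \<in> carr V \<Longrightarrow> - u \<in> carr V"
  using subspace_carr by (rule subspace_neg)

lemma carr_scale [simp]: "u \<in> carr V \<Longrightarrow> vscale V c u \<in> carr V"
  using subspace_carr by (rule subspace_scale)

lemma carr_sum [simp]: "(\<And>x. x \<in> A \<Longrightarrow> f x \<in> carr V) \<Longrightarrow> sum f A \<in> carr V"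
  using subspace_carr by (rule subspace_sum)

lemma inn_add_right [simp]:
  "\<lbrakk>u \<in> carr V; v \<in> carr V; w \<in> carr V\<rbrakk> \<Longrightarrow> inn V u (v + w) = inn V u v + inn V u w"
  using inner_product unfolding inner_product_def by blast

lemma inn_scale_right [simp]:
  "\<lbrakk>u \<in> carr V; v \<in> carr V\<rbrakk> \<Longrightarrow> inn V u (vscale V c v) = c * inn V u v"
  using inner_product unfolding inner_product_def by blast

lemma inn_commute: "\<lbrakk>u \<in> carr V; v \<in> carr V\<rbrakk> \<Longrightarrow> inn V v u = cnj (inn V u v)"
  using inner_product unfolding inner_product_def by blast

lemma inn_pos: "\<lbrakk>u \<in> carr V; u \<noteq> 0\<rbrakk> \<Longrightarrow> Re (inn V u u) > 0"
  using inner_product unfolding inner_product_def by blast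

lemma inn_add_left [simp]:
  assumes "u \<in> carr V" "v \<in> carr V" "w \<in> carr V"
  shows "inn V (v + w) u = inn V v u + inn V w u"
  using assms by (simp add: inn_commute[of u])

lemma inn_scale_left [simp]:
  assumes "u \<in> carr V" "v \<in> carr V"
  shows "inn V (vscale V c v) u = cnj c * inn V v u"
  using assms by (simp add: inn_commute[of u])

lemma inn_zero_right [simp]: "u \<in> carr V \<Longrightarrow> inn V u 0 = 0"
  using inn_scale_right[of u 0 0] by simp

lemma inn_zero_left [simp]: "u \<in> carr V \<Longrightarrow> inn V 0 u = 0"
  using inn_scale_left[of u 0 0] by simp

lemma inn_neg_right [simp]:
  assumes "u \<in> carr V" "v \<in> carr V" shows "inn V u (- v) = - inn V u v"
  using inn_scale_right[of u v "- 1"] assms by simp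

lemma inn_neg_left [simp]:
  assumes "u \<in> carr V" "v \<in> carr V" shows "inn V (- v) u = - inn V v u"
  using inn_scale_left[of u v "- 1"] assms by simp

lemma inn_diff_right [simp]:
  assumes "u \<in> carr V" "v \<in> carr V" "w \<in> carr V"
  shows "inn V u (v - w) = inn V u v - inn V u w"
  using inn_add_right[of u v "- w"] assms by simp

lemma inn_diff_left [simp]:
  assumes "u \<in> carr V" "v \<in> carr V" "w \<in> carr V"
  shows "inn V (v - w) u = inn V v u - inn V w u"
  using inn_add_left[of u v "- w"] assms by simp

lemma inn_sum_right:
  "\<lbrakk>u \<in> carr V; \<And>x. x \<in> A \<Longrightarrow> f x \<in> carr V\<rbrakk> \<Longrightarrow> inn V u (sum f A) = (\<Sum>x\<in>A. inn V u (f x))"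
  by (induction A rule: infinite_finite_induct) auto

lemma inn_sum_left:
  "\<lbrakk>u \<in> carr V; \<And>x. x \<in> A \<Longrightarrow> f x \<in> carr V\<rbrakk> \<Longrightarrow> inn V (sum f A) u = (\<Sum>x\<in>A. inn V (f x) u)"
  by (induction A rule: infinite_finite_induct) auto

lemma inn_self_real: "u \<in> carr V \<Longrightarrow> inn V u u = complex_of_real (Re (inn V u u))"
  using inn_commute[of u u] by (simp add: complex_eq_iff)

lemma inn_self_nonneg: "u \<in> carr V \<Longrightarrow> Re (inn V u u) \<ge> 0"
  by (cases "u = 0") (auto dest: inn_pos)

lemma inn_self_eq_0: "\<lbrakk>u \<in> carr V; inn V u u = 0\<rbrakk> \<Longrightarrow> u = 0"
  using inn_pos[of u] by fastforce

section \<open>Linear operators on the carrier\<close>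

abbreviation lin :: "('v \<Rightarrow> 'v) \<Rightarrow> bool" where
  "lin T \<equiv> linear_map_between V V T"

lemma lin_carr [simp]: "\<lbrakk>lin T; u \<in> carr V\<rbrakk> \<Longrightarrow> T u \<in> carr V"
  by (simp add: linear_map_between_def)

lemma lin_add: "\<lbrakk>lin T; u \<in> carr V; v \<in> carr V\<rbrakk> \<Longrightarrow> T (u + v) = T u + T v"
  by (simp add: linear_map_between_def)

lemma lin_scale: "\<lbrakk>lin T; u \<in> carr V\<rbrakk> \<Longrightarrow> T (vscale V c u) = vscale V c (T u)"
  by (simp add: linear_map_between_def)

lemma lin_zero: "lin T \<Longrightarrow> T 0 = 0"
  using lin_scale[of T 0 0] by simp

lemma lin_neg: "\<lbrakk>lin T; u \<in> carr V\<rbrakk> \<Longrightarrow> T (- u) = - T u"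
  using lin_scale[of T u "- 1"] by simp

lemma lin_diff: "\<lbrakk>lin T; u \<in> carr V; v \<in> carr V\<rbrakk> \<Longrightarrow> T (u - v) = T u - T v"
  using lin_add[of T u "- v"] by (simp add: lin_neg)

lemma lin_sum:
  "\<lbrakk>lin T; \<And>x. x \<in> A \<Longrightarrow> f x \<in> carr V\<rbrakk> \<Longrightarrow> T (sum f A) = (\<Sum>x\<in>A. T (f x))"
  by (induction A rule: infinite_finite_induct) (auto simp: lin_add lin_zero)

lemmas lin_simps = lin_add lin_scale lin_zero lin_neg lin_diff lin_sum

lemma linI:
  assumes "\<And>u. u \<in> carr V \<Longrightarrow> T u \<in> carr V"
    and "\<And>u v. \<lbrakk>u \<in> carr V; v \<in> carr V\<rbrakk> \<Longrightarrow> T (u + v) = T u + T v"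
    and "\<And>c u. u \<in> carr V \<Longrightarrow> T (vscale V c u) = vscale V c (T u)"
  shows "lin T"
  using assms by (simp add: linear_map_between_def)

lemma lin_sumI: "(\<And>a. a \<in> A \<Longrightarrow> lin (f a)) \<Longrightarrow> lin (\<lambda>v. \<Sum>a\<in>A. f a v)"
  by (intro linI) (simp_all add: lin_add lin_scale sum.distrib scale_sum_right)

lemma lin_diffI: "\<lbrakk>lin S; lin T\<rbrakk> \<Longrightarrow> lin (\<lambda>v. S v - T v)"
  by (intro linI) (simp_all add: lin_add lin_scale scale_right_diff_distrib)

lemma lin_scaleI: "lin T \<Longrightarrow> lin (\<lambda>v. vscale V c (T v))"
  by (intro linI) (simp_all add: lin_add lin_scale scale_right_distrib scale_left_commute)

lemma lin_compI: "\<lbrakk>lin S; lin T\<rbrakk> \<Longrightarrow> lin (\<lambda>v. S (T v))"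
  by (intro linI) (simp_all add: lin_add lin_scale)

lemma lin_idI: "lin (\<lambda>v. v)"
  by (intro linI) simp_all

lemma span_subset_carr: "A \<subseteq> carr V \<Longrightarrow> span A \<subseteq> carr V"
  using subspace_carr by (rule span_minimal[rotated])

lemma subspace_lin_eq: "\<lbrakk>lin S; lin T\<rbrakk> \<Longrightarrow> subspace {v \<in> carr V. S v = T v}"
  by (rule subspaceI) (auto simp: lin_simps)

end

locale star_rep = 
  fixes star :: "'i \<Rightarrow> 'i" and V :: "('i, 'v::ab_group_add) prehilbert_rep"
  assumes unitary: "unitary_rep star V"
begin

sublocale prehilbert V
  using unitary by (intro prehilbert.intro) (simp_all add: unitary_rep_def linear_rep_def)

lemma lin_act [simp]: "lin (act V i)"
  using unitary by (simp add: unitary_rep_def linear_rep_def)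

lemma act_carr: "u \<in> carr V \<Longrightarrow> act V i u \<in> carr V"
  by simp

lemma adjoint: "\<lbrakk>u \<in> carr V; v \<in> carr V\<rbrakk> \<Longrightarrow> inn V (act V i u) v = inn V u (act V (star i) v)"
  using unitary by (simp add: unitary_rep_def)

end

section \<open>Coordinates in the Lie algebra\<close>

context simple_lie_data
begin

lemma lie_algebra: "lie_algebra (gscale G) (brk G)"
  using simple by (simp add: simple_lie_algebra_def)

sublocale g: vector_space "gscale G"
  using lie_algebra by (simp add: lie_algebra_def)

lemma brk_add_left: "brk G (x + y) z = brk G x z + brk G y z"
  and brk_scale_left: "brk G (gscale G c x) y = gscale G c (brk G x y)"
  and brk_add_right: "brk G x (y + z) = brk G x y + brk G x z"
  and brk_scale_right: "brk G x (gscale G c y) = gscale G c (brk G x y)"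
  and brk_self: "brk G x x = 0"
  and jacobi: "brk G x (brk G y z) + brk G y (brk G z x) + brk G z (brk G x y) = 0"
  using lie_algebra by (simp_all add: lie_algebra_def)

lemma brk_zero_left [simp]: "brk G 0 y = 0"
  using brk_scale_left[of 0 0 y] by simp

lemma brk_zero_right [simp]: "brk G x 0 = 0"
  using brk_scale_right[of x 0 0] by simp

lemma brk_neg_left: "brk G (- x) y = - brk G x y"
  using brk_scale_left[of "- 1" x y] by simp

lemma brk_neg_right: "brk G x (- y) = - brk G x y"
  using brk_scale_right[of x "- 1" y] by simp

lemma brk_sum_left: "brk G (sum f A) y = (\<Sum>a\<in>A. brk G (f a) y)"
  by (induction A rule: infinite_finite_induct) (auto simp: brk_add_left)

lemma brk_sum_right: "brk G x (sum f A) = (\<Sum>a\<in>A. brk G x (f a))"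
  by (induction A rule: infinite_finite_induct) (auto simp: brk_add_right)

lemma brk_swap: "brk G y x = - brk G x y"
proof -
  have "brk G (x + y) (x + y) = brk G x y + brk G y x"
    unfolding brk_add_left brk_add_right by (simp add: brk_self)
  then show ?thesis
    by (simp add: brk_self eq_neg_iff_add_eq_0 add.commute)
qed

lemma jacobi_derivation: "brk G x (brk G y z) = brk G (brk G x y) z + brk G y (brk G x z)"
proof -
  have "brk G y (brk G z x) = - brk G y (brk G x z)" "brk G z (brk G x y) = - brk G (brk G x y) z"
    by (simp_all only: brk_swap[of z x] brk_swap[of z "brk G x y"] brk_neg_right)
  then show ?thesis
    using jacobi[of x y z] by (simp add: algebra_simps)
qed

lemma coord_add: "coord G a (x + y) = coord G a x + coord G a y"
  and coord_scale: "coord G a (gscale G c x) = c * coord G a x"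
  and coord_basis: "coord G a (basis G b) = (if a = b then 1 else 0)"
  unfolding coord_def
  by (simp_all add: g.representation_add[OF basis_indep] g.representation_scale[OF basis_indep] basis_span
      g.representation_basis[OF basis_indep] inj_eq[OF basis_inj])

lemma coord_zero [simp]: "coord G a 0 = 0"
  using coord_scale[of a 0 0] by simp

lemma coord_neg: "coord G a (- x) = - coord G a x"
  using coord_scale[of a "- 1" x] by simp

lemma coord_sum: "coord G a (sum f A) = (\<Sum>x\<in>A. coord G a (f x))"
  by (induction A rule: infinite_finite_induct) (auto simp: coord_add)

lemma coord_expand: "(\<Sum>a\<in>UNIV. gscale G (coord G a x) (basis G a)) = x"
proof -
  have "x \<in> g.span (range (basis G))"
    by (simp add: basis_span)
  then have "(\<Sum>b\<in>range (basis G). gscale G (g.representation (range (basis G)) x b) b) = x"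
    by (rule g.sum_representation_eq[OF basis_indep _ finite_imageI[OF finite] order_refl])
  then show ?thesis
    unfolding sum.reindex[OF basis_inj] o_def coord_def .
qed

lemma coord_ext:
  assumes "\<And>a. coord G a x = coord G a y"
  shows "x = y"
proof -
  have "x = (\<Sum>a\<in>UNIV. gscale G (coord G a x) (basis G a))"
    by (rule coord_expand[symmetric])
  also have "\<dots> = (\<Sum>a\<in>UNIV. gscale G (coord G a y) (basis G a))"
    by (simp only: assms)
  finally show ?thesis
    by (simp only: coord_expand)
qed

lemma coord_lincomb: "coord G a (\<Sum>b\<in>UNIV. gscale G (f b) (basis G b)) = f a"
  by (simp add: coord_sum coord_scale coord_basis if_distrib cong: if_cong)

lemma coord_brk_basis: "coord G c (brk G (basis G a) (basis G b)) = \<i> * complex_of_real (Gam G a b c)"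
  by (simp add: brk_basis coord_scale coord_lincomb)

lemma coord_brk:
  "coord G c (brk G x y)
     = \<i> * (\<Sum>a\<in>UNIV. \<Sum>b\<in>UNIV. coord G a x * coord G b y * complex_of_real (Gam G a b c))"
proof -
  have "brk G x y = (\<Sum>a\<in>UNIV. \<Sum>b\<in>UNIV. gscale G (coord G a x * coord G b y) (brk G (basis G a) (basis G b)))"
    by (subst (1) coord_expand[of x, symmetric], subst (1) coord_expand[of y, symmetric])
      (simp add: brk_sum_left brk_sum_right brk_scale_left brk_scale_right g.scale_sum_right,
        subst sum.swap, simp add: mult.commute)
  then show ?thesis
    by (simp add: coord_sum coord_scale coord_brk_basis sum_distrib_left mult_ac)
qed

lemma Gam_swap_outer: "Gam G c b a = - Gam G a b c"
  using Gam_antisym by (metis minus_minus)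

lemma Gam_cyclic: "Gam G b c a = Gam G a b c"
  using Gam_antisym by (metis minus_minus)

lemma Gam_diag [simp]: "Gam G a a c = 0" "Gam G a b b = 0" "Gam G a b a = 0"
  using Gam_antisym(1)[of a a c] Gam_antisym(2)[of a b b] Gam_swap_outer[of a b a] by simp_all

text \<open>A component of the derivation form of the Jacobi identity for three basis vectors; each
  double bracket carries a sign from two factors \<open>\<i>\<close>. In this shape the structure
  constants are the matrices of the adjoint representation, as needed to move two currents past a
  fermion.\<close>

lemma Gam_jacobi:
  "(\<Sum>e\<in>UNIV. Gam G b d e * Gam G a e f) - (\<Sum>e\<in>UNIV. Gam G a d e * Gam G b e f)
     = (\<Sum>c\<in>UNIV. Gam G a b c * Gam G c d f)"
proof -
  have left: "coord G f (brk G (basis G u) y) = \<i> * (\<Sum>e\<in>UNIV. coord G e y * complex_of_real (Gam G u e f))" for u y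
    by (subst coord_brk, subst sum.swap) (simp add: coord_basis if_distrib[of "\<lambda>x. x * _"] cong: if_cong)
  have right: "coord G f (brk G x (basis G w)) = \<i> * (\<Sum>e\<in>UNIV. coord G e x * complex_of_real (Gam G e w f))" for w x
    by (simp add: coord_brk coord_basis if_distrib[of "\<lambda>x. x * _"] if_distrib[of "\<lambda>x. _ * x"] cong: if_cong)
  have ii: "\<i> * (\<Sum>e\<in>UNIV. \<i> * p e * q e) = - (\<Sum>e\<in>UNIV. p e * q e)" for p q :: "'a \<Rightarrow> complex"
    by (simp add: sum_distrib_left sum_negf flip: mult.assoc)
  have nest: "coord G f (brk G (basis G u) (brk G (basis G v) (basis G w)))
      = - complex_of_real (\<Sum>e\<in>UNIV. Gam G v w e * Gam G u e f)" for u v w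
    by (simp add: left coord_brk_basis ii)
  have nest': "coord G f (brk G (brk G (basis G u) (basis G v)) (basis G w))
      = - complex_of_real (\<Sum>e\<in>UNIV. Gam G u v e * Gam G e w f)" for u v w
    by (simp add: right coord_brk_basis ii)
  have "coord G f (brk G (basis G a) (brk G (basis G b) (basis G d)))
      = coord G f (brk G (brk G (basis G a) (basis G b)) (basis G d))
        + coord G f (brk G (basis G b) (brk G (basis G a) (basis G d)))"
    by (subst jacobi_derivation) (simp add: coord_add)
  then have "complex_of_real (\<Sum>e\<in>UNIV. Gam G b d e * Gam G a e f)
      = complex_of_real ((\<Sum>c\<in>UNIV. Gam G a b c * Gam G c d f) + (\<Sum>e\<in>UNIV. Gam G a d e * Gam G b e f))"
    unfolding nest nest' of_real_add by (simp only: neg_equal_iff_equal minus_add_distrib[symmetric])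
  then show ?thesis
    by (simp only: of_real_eq_iff)
qed

section \<open>The involution and the invariant form\<close>

lemma coord_gstar: "coord G a (gstar G x) = cnj (coord G a x)"
  by (simp add: gstar_def coord_lincomb)

lemma gstar_gstar [simp]: "gstar G (gstar G x) = x"
  by (rule coord_ext) (simp add: coord_gstar)

text \<open>The sign arises because the involution fixes the basis while the structure constants
  \<open>\<i> * Gam\<close> are imaginary.\<close>

lemma gstar_brk: "gstar G (brk G x y) = - brk G (gstar G x) (gstar G y)"
  by (rule coord_ext) (simp add: coord_gstar coord_neg coord_brk)

lemma gstar_scale: "gstar G (gscale G c x) = gscale G (cnj c) (gstar G x)"
  by (rule coord_ext) (simp add: coord_gstar coord_scale)

lemma form_commute: "form G x y = form G y x"
  by (simp add: form_def mult.commute)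

lemma form_scale_right: "form G x (gscale G c y) = c * form G x y"
  by (simp add: form_def coord_scale sum_distrib_left mult_ac)

lemma form_neg_right: "form G x (- y) = - form G x y"
  by (simp add: form_def coord_neg sum_negf)

lemma form_add_left: "form G (x + y) z = form G x z + form G y z"
  by (simp add: form_def coord_add algebra_simps sum.distrib)

lemma form_scale_left: "form G (gscale G c x) y = c * form G x y"
  by (simp add: form_def coord_scale sum_distrib_left mult_ac)

lemma form_neg_left: "form G (- x) y = - form G x y"
  by (simp add: form_def coord_neg sum_negf)

lemma form_diff_left: "form G (x - y) z = form G x z - form G y z"
  using form_add_left[of x "- y" z] by (simp add: form_neg_left)

text \<open>Invariance of the form is the cyclic symmetry of \<open>Gam\<close>.\<close>

lemma form_brk: "form G (brk G x y) z = form G x (brk G y z)"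
proof -
  let ?t = "\<lambda>a b c. coord G a x * coord G b y * coord G c z * complex_of_real (Gam G a b c)"
  have "form G (brk G x y) z = \<i> * (\<Sum>c\<in>UNIV. \<Sum>a\<in>UNIV. \<Sum>b\<in>UNIV. ?t a b c)"
    by (simp add: form_def coord_brk sum_distrib_left sum_distrib_right mult_ac)
  also have "(\<Sum>c\<in>UNIV. \<Sum>a\<in>UNIV. \<Sum>b\<in>UNIV. ?t a b c) = (\<Sum>a\<in>UNIV. \<Sum>c\<in>UNIV. \<Sum>b\<in>UNIV. ?t a b c)"
    by (rule sum.swap)
  also have "\<dots> = (\<Sum>a\<in>UNIV. \<Sum>b\<in>UNIV. \<Sum>c\<in>UNIV. ?t a b c)"
    by (intro sum.cong refl sum.swap)
  also have "\<i> * \<dots> = form G x (brk G y z)"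
    by (simp add: form_def coord_brk Gam_cyclic sum_distrib_left mult_ac)
  finally show ?thesis .
qed

lemma form_gstar_self: "form G x (gstar G x) = complex_of_real (\<Sum>a\<in>UNIV. (cmod (coord G a x))\<^sup>2)"
  by (simp only: form_def coord_gstar complex_norm_square[symmetric] of_real_sum)

text \<open>With \<open>gstar\<close> in one argument the bilinear form becomes a definite hermitian
  one. All nondegeneracy used in the root decomposition comes from here.\<close>

lemma form_gstar_pos: "x \<noteq> 0 \<Longrightarrow> Re (form G x (gstar G x)) > 0"
proof -
  assume "x \<noteq> 0"
  then obtain a where "coord G a x \<noteq> 0"
    using coord_ext[of x 0] by auto
  then have "(\<Sum>a\<in>UNIV. (cmod (coord G a x))\<^sup>2) > 0"
    by (intro sum_pos2[of _ a]) auto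
  then show ?thesis
    unfolding form_gstar_self by simp
qed

end

section \<open>Fermionic representations\<close>

context star_rep
begin

lemmas act_simps = lin_add[OF lin_act] lin_scale[OF lin_act] lin_zero[OF lin_act] lin_neg[OF lin_act]
  lin_diff[OF lin_act] lin_sum[OF lin_act]

end

text \<open>Shared by the Fock space, the tensor product and an arbitrary highest weight
  representation. \<open>locally_finite\<close> makes vacuum vectors exist and normal ordered sums
  finite. In a representation with a cyclic vacuum vector it holds because the vectors that satisfy
  it form an invariant subspace.\<close>

locale fermi_rep = star_rep fermion_star F for F :: "('a fermion, 'v::ab_group_add) prehilbert_rep" +
  assumes fermion_relations: "fermion_relations F"
    and locally_finite: "v \<in> carr F \<Longrightarrow> \<exists>N. \<forall>a n. n \<ge> N \<longrightarrow> act F (Psi a n) v = 0"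
begin

abbreviation psi :: "'a \<Rightarrow> int \<Rightarrow> 'v \<Rightarrow> 'v" where
  "psi a n \<equiv> act F (Psi a n)"

lemma anticommute:
  "v \<in> carr F \<Longrightarrow> psi a m (psi b n v) = (if a = b \<and> m + n + 1 = 0 then v else 0) - psi b n (psi a m v)"
  using fermion_relations unfolding fermion_relations_def eq_diff_eq by blast

lemma psi_square: "\<lbrakk>v \<in> carr F; 2 * n + 1 \<noteq> 0\<rbrakk> \<Longrightarrow> psi a n (psi a n v) = 0"
proof -
  assume v: "v \<in> carr F" and n: "2 * n + 1 \<noteq> 0"
  have "vscale F 2 (psi a n (psi a n v)) = psi a n (psi a n v) + psi a n (psi a n v)"
    using scale_left_distrib[of 1 1] by simp
  also have "\<dots> = 0"
    using anticommute[OF v, of a n a n] n by (simp add: eq_neg_iff_add_eq_0)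
  finally show ?thesis by simp
qed

lemma adjoint_psi: "\<lbrakk>u \<in> carr F; v \<in> carr F\<rbrakk> \<Longrightarrow> inn F (psi a n u) v = inn F u (psi a (- n - 1) v)"
  by (simp add: adjoint)

definition vac :: "'v set" where
  "vac = {v \<in> carr F. \<forall>a n. n \<ge> 0 \<longrightarrow> psi a n v = 0}"

lemma vac_carr: "v \<in> vac \<Longrightarrow> v \<in> carr F"
  and vacD: "\<lbrakk>v \<in> vac; n \<ge> 0\<rbrakk> \<Longrightarrow> psi a n v = 0"
  by (simp_all add: vac_def)

lemma subspace_vac: "subspace vac"
  by (rule subspaceI) (auto simp: vac_def act_simps)

text \<open>Apply, one after the other, the finitely many annihilation operators that do not yet kill the vector.\<close>

lemma vac_exists:
  fixes W :: "'v set"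
  assumes fin: "finite (UNIV :: 'a set)" and sub: "W \<subseteq> carr F"
    and inv: "\<And>a n w. w \<in> W \<Longrightarrow> psi a n w \<in> W" and w: "w \<in> W" "w \<noteq> 0"
  obtains u where "u \<in> W" "u \<in> vac" "u \<noteq> 0"
proof -
  obtain N where N: "\<And>a n. n \<ge> N \<Longrightarrow> psi a n w = 0"
    using locally_finite[of w] w sub by blast
  have *: "\<exists>u\<in>W. u \<noteq> 0 \<and> (\<forall>a n. n \<ge> N \<and> n \<ge> 0 \<longrightarrow> psi a n u = 0) \<and> (\<forall>(a, n)\<in>M. psi a n u = 0)"
    if "finite M" "M \<subseteq> UNIV \<times> {0..}" for M
    using that
  proof (induction M rule: finite_induct)
    case empty
    then show ?case using w N by auto
  next
    case (insert x M)
    then obtain u where u: "u \<in> W" "u \<noteq> 0" "\<And>a n. \<lbrakk>n \<ge> N; n \<ge> 0\<rbrakk> \<Longrightarrow> psi a n u = 0"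
        "\<And>a n. (a, n) \<in> M \<Longrightarrow> psi a n u = 0"
      by fastforce
    obtain b m where x: "x = (b, m)" by fastforce
    have m: "m \<ge> 0" and M: "\<And>a n. (a, n) \<in> M \<Longrightarrow> n \<ge> 0"
      using insert.prems x by auto
    \<comment> \<open>If \<open>psi b m\<close> does not kill u, pass to \<open>psi b m u\<close>:
      it is killed by \<open>psi b m\<close>, whose square is zero, and by the operators already
      treated, because annihilation operators anticommute.\<close>
    show ?case
    proof (cases "psi b m u = 0")
      case True
      then show ?thesis
        using u x by (intro bexI[of _ u]) auto
    next
      case False
      have c: "u \<in> carr F" using u(1) sub by blast
      have kill: "psi a n (psi b m u) = 0" if "n \<ge> 0" "psi a n u = 0" for a n
        using that m c by (simp add: anticommute[OF c, of a n] act_simps)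
      have "psi b m (psi b m u) = 0"
        by (rule psi_square[OF c]) (use m in simp)
      with False show ?thesis
        using u x M inv[OF u(1)] kill by (intro bexI[of _ "psi b m u"]) auto
    qed
  qed
  have "finite (UNIV \<times> {0..<N} :: ('a \<times> int) set)"
    using fin by simp
  from *[OF this] obtain u where u: "u \<in> W" "u \<noteq> 0" "\<And>a n. \<lbrakk>n \<ge> N; n \<ge> 0\<rbrakk> \<Longrightarrow> psi a n u = 0"
      "\<And>a n. \<lbrakk>0 \<le> n; n < N\<rbrakk> \<Longrightarrow> psi a n u = 0"
    by fastforce
  have "u \<in> vac"
    unfolding vac_def using u sub by (auto) (metis linorder_not_less)
  with u that show thesis by blast
qed

end

section \<open>The currents built from the fermions\<close>

text \<open>
  The truncation of \<open>S_mode\<close> to modes \<open>p \<in> A\<close>. Normal ordering is invisible: it only matters for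
  \<open>a = b\<close>, where \<open>Gam\<close> vanishes.
\<close>

definition S_on ::
  "('a::finite, 'g::ab_group_add) lie_data \<Rightarrow> ('a fermion, 'v::ab_group_add) prehilbert_rep \<Rightarrow> int set
    \<Rightarrow> 'a \<Rightarrow> int \<Rightarrow> 'v \<Rightarrow> 'v" where
  "S_on G F A c n v = vscale F (- \<i> / 2)
     (\<Sum>a\<in>UNIV. \<Sum>b\<in>UNIV. vscale F (complex_of_real (Gam G a b c))
        (\<Sum>p\<in>A. act F (Psi a p) (act F (Psi b (n - 1 - p)) v)))"

locale fermi_lie = simple_lie_data G + fermi_rep F
  for G :: "('a::finite, 'g::ab_group_add) lie_data" and F :: "('a fermion, 'v::ab_group_add) prehilbert_rep"
begin

abbreviation S :: "'a \<Rightarrow> int \<Rightarrow> 'v \<Rightarrow> 'v" where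
  "S \<equiv> S_mode G F"

text \<open>Stated for all large finite A and not for one, so that finitely many such identities can
  be met by a common truncation. Linearity, adjoints and commutators of \<open>S\<close> thereby
  reduce to finite sums.\<close>

lemma S_mode_eventually:
  assumes v: "v \<in> carr F"
  shows "\<forall>\<^sub>F A in finite_subsets_at_top UNIV. S c n v = S_on G F A c n v"
proof -
  obtain N where N: "\<And>a n. n \<ge> N \<Longrightarrow> psi a n v = 0"
    using locally_finite[OF v] by blast
  \<comment> \<open>For p outside this interval either p or n - 1 - p is at least N, so one of the
    two fermions kills v, and for a \<noteq> b they anticommute up to sign whenever both orders are
    compared there.\<close>
  have "\<forall>\<^sub>F A in finite_subsets_at_top UNIV. finite A \<and> {n - N..<N} \<subseteq> A"
    unfolding eventually_finite_subsets_at_top by (intro exI[of _ "{n - N..<N}"]) auto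
  then show ?thesis
  proof (rule eventually_mono)
    fix A assume A: "finite A \<and> {n - N..<N} \<subseteq> A"
    have "vscale F (complex_of_real (Gam G a b c)) (Sum_any (\<lambda>p. normal_ordered F a p b (n - 1 - p) v))
        = vscale F (complex_of_real (Gam G a b c)) (\<Sum>p\<in>A. psi a p (psi b (n - 1 - p) v))" for a b
    proof (cases "a = b")
      case False
      have no: "normal_ordered F a p b q v = psi a p (psi b q v)" for p q
        using False v by (simp add: normal_ordered_def anticommute[OF v, of a p b q])
      have "{p. psi a p (psi b (n - 1 - p) v) \<noteq> 0} \<subseteq> A"
      proof
        fix p assume "p \<in> {p. psi a p (psi b (n - 1 - p) v) \<noteq> 0}"
        then have nz: "psi a p (psi b (n - 1 - p) v) \<noteq> 0" by simp
        have "psi b (n - 1 - p) v \<noteq> 0"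
          using nz by (auto simp: act_simps)
        moreover have "psi a p v \<noteq> 0"
        proof
          assume "psi a p v = 0"
          with nz show False
            unfolding anticommute[OF v, of a p b] using False by (simp add: act_simps)
        qed
        ultimately have "\<not> N \<le> p" "\<not> N \<le> n - 1 - p"
          using N by auto
        then show "p \<in> A" using A by auto
      qed
      then have "Sum_any (\<lambda>p. psi a p (psi b (n - 1 - p) v)) = (\<Sum>p\<in>A. psi a p (psi b (n - 1 - p) v))"
        using A by (intro Sum_any.expand_superset) auto
      then show ?thesis
        by (simp only: no)
    qed simp
    then show "S c n v = S_on G F A c n v"
      unfolding S_mode_def S_on_def by (simp only:)
  qed
qed

lemma lin_S_on: "lin (S_on G F A c n)"
proof -
  have pp: "lin (\<lambda>v. psi a p (psi b q v))" for a p b q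
    by (rule lin_compI) (rule lin_act)+
  have "lin (\<lambda>v. S_on G F A c n v)"
    unfolding S_on_def by (rule lin_scaleI, rule lin_sumI, rule lin_sumI, rule lin_scaleI, rule lin_sumI, rule pp)
  then show ?thesis .
qed

lemma eventually_S_on:
  assumes "\<forall>\<^sub>F A in finite_subsets_at_top UNIV. P A"
  obtains A :: "int set" where "finite A" "P A"
proof -
  obtain A0 where "finite A0" "\<forall>A. finite A \<and> A0 \<subseteq> A \<and> A \<subseteq> UNIV \<longrightarrow> P A"
    using assms unfolding eventually_finite_subsets_at_top by auto
  with that[of A0] show thesis
    by simp
qed

lemma lin_S [simp]: "lin (S c n)"
proof (rule linI)
  fix u assume u: "u \<in> carr F"
  obtain A where "S c n u = S_on G F A c n u"
    using S_mode_eventually[OF u] by (rule eventually_S_on)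
  then show "S c n u \<in> carr F"
    using u lin_S_on by simp
  fix k
  have "\<forall>\<^sub>F A in finite_subsets_at_top UNIV.
      S c n (vscale F k u) = S_on G F A c n (vscale F k u) \<and> S c n u = S_on G F A c n u"
    using u by (intro eventually_conj S_mode_eventually) auto
  then obtain A where "S c n (vscale F k u) = S_on G F A c n (vscale F k u) \<and> S c n u = S_on G F A c n u"
    by (rule eventually_S_on)
  then show "S c n (vscale F k u) = vscale F k (S c n u)"
    by (simp add: lin_scale[OF lin_S_on] u)
next
  fix u v assume uv: "u \<in> carr F" "v \<in> carr F"
  have "\<forall>\<^sub>F A in finite_subsets_at_top UNIV. S c n (u + v) = S_on G F A c n (u + v)
      \<and> S c n u = S_on G F A c n u \<and> S c n v = S_on G F A c n v"
    using uv by (intro eventually_conj S_mode_eventually) auto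
  then obtain A where "S c n (u + v) = S_on G F A c n (u + v)
      \<and> S c n u = S_on G F A c n u \<and> S c n v = S_on G F A c n v"
    by (rule eventually_S_on)
  then show "S c n (u + v) = S c n u + S c n v"
    by (simp add: lin_add[OF lin_S_on] uv)
qed

lemmas S_simps = lin_add[OF lin_S] lin_scale[OF lin_S] lin_zero[OF lin_S] lin_neg[OF lin_S]
  lin_diff[OF lin_S] lin_sum[OF lin_S]

text \<open>The mode indices p and n - 1 - p cannot both be negative when n \<ge> 0, so each product
  contains an annihilation operator, which for a \<noteq> b can be moved to the right.\<close>

lemma S_vac:
  assumes v: "v \<in> vac" and n: "n \<ge> 0"
  shows "S c n v = 0"
proof -
  have c: "v \<in> carr F" using v by (rule vac_carr)
  have "vscale F (complex_of_real (Gam G a b c)) (psi a p (psi b (n - 1 - p) v)) = 0" for a b p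
  proof (cases "a = b")
    case False
    then show ?thesis
      using n c by (cases "p \<ge> 0") (simp_all add: anticommute[OF c, of a p b] vacD[OF v] act_simps)
  qed simp
  then have "S_on G F A c n v = 0" for A
    by (simp only: S_on_def scale_sum_right[of _ _ A] sum.neutral_const scale_zero_right)
  moreover obtain A where "S c n v = S_on G F A c n v"
    using S_mode_eventually[OF c] by (rule eventually_S_on)
  ultimately show ?thesis
    by simp
qed

text \<open>Taking adjoints reverses the two fermions and conjugates \<open>- \<i> / 2\<close>.
  Restoring the order, for a \<noteq> b, costs a sign, which cancels the one from the
  conjugation.\<close>

lemma S_adjoint:
  assumes u: "u \<in> carr F" and v: "v \<in> carr F"
  shows "inn F (S c n u) v = inn F u (S c (- n) v)"
proof -
  obtain A0 where A0: "finite A0" "\<And>A. \<lbrakk>finite A; A0 \<subseteq> A\<rbrakk> \<Longrightarrow> S c n u = S_on G F A c n u"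
    using S_mode_eventually[OF u, of c n] by (auto simp: eventually_finite_subsets_at_top)
  obtain A1 where A1: "finite A1" "\<And>A. \<lbrakk>finite A; A1 \<subseteq> A\<rbrakk> \<Longrightarrow> S c (- n) v = S_on G F A c (- n) v"
    using S_mode_eventually[OF v, of c "- n"] by (auto simp: eventually_finite_subsets_at_top)
  let ?r = "\<lambda>p::int. - p - 1"
  \<comment> \<open>The reflection \<open>?r\<close> gives the index of the adjoint mode and is an
    involution, so A is large enough for u and its reflection is large enough for v.\<close>
  define A where "A = A0 \<union> ?r ` A1"
  have rA: "S c (- n) v = S_on G F (?r ` A) c (- n) v"
    by (rule A1(2)) (auto simp: A_def A0 A1 image_Un image_image)
  have inj: "inj_on ?r A" by (auto simp: inj_on_def)
  let ?t = "\<lambda>a b p. inn F u (psi a (?r p) (psi b (p - n) v))"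
  have pair: "inn F (vscale F (complex_of_real (Gam G a b c)) (\<Sum>p\<in>A. psi a p (psi b (n - 1 - p) u))) v
      = - inn F u (vscale F (complex_of_real (Gam G a b c)) (\<Sum>p\<in>A. psi a (?r p) (psi b (p - n) v)))" for a b
  proof (cases "a = b")
    case False
    have "inn F (psi a p (psi b (n - 1 - p) u)) v = - ?t a b p" for p
      using False u v by (simp add: adjoint_psi anticommute[OF v, of a])
    then show ?thesis
      using u v by (simp add: inn_sum_left inn_sum_right sum_negf)
  qed (use u v in simp)
  have "inn F (S c n u) v = cnj (- \<i> / 2) * (\<Sum>a\<in>UNIV. \<Sum>b\<in>UNIV.
      inn F (vscale F (complex_of_real (Gam G a b c)) (\<Sum>p\<in>A. psi a p (psi b (n - 1 - p) u))) v)"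
    using A0 A1 u v by (subst A0(2)[of A]) (auto simp: A_def S_on_def inn_sum_left)
  also have "\<dots> = (- \<i> / 2) * (\<Sum>a\<in>UNIV. \<Sum>b\<in>UNIV.
      inn F u (vscale F (complex_of_real (Gam G a b c)) (\<Sum>p\<in>A. psi a (?r p) (psi b (p - n) v))))"
    by (simp only: pair sum_negf) simp
  also have "\<dots> = inn F u (S c (- n) v)"
    unfolding rA S_on_def sum.reindex[OF inj] using u v by (simp add: inn_sum_right algebra_simps)
  finally show ?thesis .
qed

text \<open>Moving \<open>psi d r\<close> through two fermions leaves two contractions. By the
  antisymmetry of \<open>Gam\<close> they contribute equally, which cancels the factor 1/2 in
  \<open>S\<close>.\<close>

lemma S_psi:
  assumes v: "v \<in> carr F"
  shows "S c n (psi d r v) - psi d r (S c n v)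
    = vscale F \<i> (\<Sum>e\<in>UNIV. vscale F (complex_of_real (Gam G c d e)) (psi e (n + r) v))"
proof -
  \<comment> \<open>The two extra indices are those of the contractions: at p = n + r the second
    fermion meets \<open>psi d r\<close>, at p = - r - 1 the first one does.\<close>
  have ev: "\<forall>\<^sub>F A in finite_subsets_at_top UNIV. (S c n (psi d r v) = S_on G F A c n (psi d r v)
      \<and> S c n v = S_on G F A c n v) \<and> {n + r, - r - 1} \<subseteq> A"
    using v by (intro eventually_conj S_mode_eventually)
      (auto simp: eventually_finite_subsets_at_top intro!: exI[of _ "{n + r, - r - 1}"])
  then obtain A :: "int set" where fin: "finite A" and A: "(S c n (psi d r v) = S_on G F A c n (psi d r v)
      \<and> S c n v = S_on G F A c n v) \<and> {n + r, - r - 1} \<subseteq> A"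
    by (rule eventually_S_on)
  show ?thesis
  proof -
    let ?G = "\<lambda>a b. complex_of_real (Gam G a b c)"
    have summand: "psi a p (psi b (n - 1 - p) (psi d r v)) - psi d r (psi a p (psi b (n - 1 - p) v))
        = (if p = n + r then if b = d then psi a (n + r) v else 0 else 0)
          - (if p = - r - 1 then if a = d then psi b (n + r) v else 0 else 0)" for a b p
    proof -
      have "psi a p (psi b (n - 1 - p) (psi d r v)) = psi a p (if b = d \<and> n - 1 - p + r + 1 = 0 then v else 0)
          - psi a p (psi d r (psi b (n - 1 - p) v))"
        using v by (subst anticommute[OF v]) (simp add: act_simps)
      moreover have "psi a p (psi d r (psi b (n - 1 - p) v))
          = (if a = d \<and> p + r + 1 = 0 then psi b (n - 1 - p) v else 0) - psi d r (psi a p (psi b (n - 1 - p) v))"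
        using v by (intro anticommute) simp
      moreover have "n - 1 - p + r + 1 = 0 \<longleftrightarrow> p = n + r" "p + r + 1 = 0 \<longleftrightarrow> p = - r - 1"
        by auto
      moreover have "psi a p (if b = d \<and> p = n + r then v else 0)
          = (if p = n + r then if b = d then psi a (n + r) v else 0 else 0)"
        "(if a = d \<and> p = - r - 1 then psi b (n - 1 - p) v else 0)
          = (if p = - r - 1 then if a = d then psi b (n + r) v else 0 else 0)"
        by (auto simp: act_simps)
      ultimately show ?thesis
        by (simp only:) simp
    qed
    have diff: "vscale F (?G a b) (\<Sum>p\<in>A. psi a p (psi b (n - 1 - p) (psi d r v))
          - psi d r (psi a p (psi b (n - 1 - p) v)))
        = (if b = d then vscale F (?G a b) (psi a (n + r) v) else 0)
          - (if a = d then vscale F (?G a b) (psi b (n + r) v) else 0)" for a b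
      unfolding summand sum_subtractf using fin A by (simp add: scale_right_diff_distrib)
    have "S c n (psi d r v) - psi d r (S c n v)
        = vscale F (- \<i> / 2) (\<Sum>a\<in>UNIV. \<Sum>b\<in>UNIV.
            (if b = d then vscale F (?G a b) (psi a (n + r) v) else 0)
          - (if a = d then vscale F (?G a b) (psi b (n + r) v) else 0))"
    proof -
      have "psi d r (S_on G F A c n v) = vscale F (- \<i> / 2)
          (\<Sum>a\<in>UNIV. \<Sum>b\<in>UNIV. vscale F (?G a b) (\<Sum>p\<in>A. psi d r (psi a p (psi b (n - 1 - p) v))))"
        using v by (simp add: S_on_def act_simps)
      then have "S c n (psi d r v) - psi d r (S c n v)
        = vscale F (- \<i> / 2) (\<Sum>a\<in>UNIV. \<Sum>b\<in>UNIV.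
            vscale F (?G a b) (\<Sum>p\<in>A. psi a p (psi b (n - 1 - p) (psi d r v))))
          - vscale F (- \<i> / 2) (\<Sum>a\<in>UNIV. \<Sum>b\<in>UNIV.
            vscale F (?G a b) (\<Sum>p\<in>A. psi d r (psi a p (psi b (n - 1 - p) v))))"
        using A by (simp only: S_on_def)
      then show ?thesis
        by (simp only: diff flip: scale_right_diff_distrib sum_subtractf)
    qed
    also have "(\<Sum>a\<in>UNIV. \<Sum>b\<in>UNIV. (if b = d then vscale F (?G a b) (psi a (n + r) v) else 0)
          - (if a = d then vscale F (?G a b) (psi b (n + r) v) else 0))
        = (\<Sum>a\<in>UNIV. vscale F (?G a d) (psi a (n + r) v)) - (\<Sum>b\<in>UNIV. vscale F (?G d b) (psi b (n + r) v))"
      unfolding sum_subtractf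
      by (simp add: sum.delta)
        (subst sum.swap, simp add: sum.delta)
    also have "\<dots> = (\<Sum>e\<in>UNIV. vscale F (- 2 * complex_of_real (Gam G c d e)) (psi e (n + r) v))"
      unfolding sum_subtractf[symmetric]
    proof (intro sum.cong refl)
      fix e
      have "Gam G e d c = - Gam G c d e" "Gam G d e c = Gam G c d e"
        using Gam_swap_outer[where a = c and b = d and c = e] Gam_cyclic[where a = c and b = d and c = e] by simp_all
      then show "vscale F (?G e d) (psi e (n + r) v) - vscale F (?G d e) (psi e (n + r) v)
          = vscale F (- 2 * complex_of_real (Gam G c d e)) (psi e (n + r) v)"
        unfolding scale_left_diff_distrib[symmetric] by simp
    qed
    finally show "S c n (psi d r v) - psi d r (S c n v)
        = vscale F \<i> (\<Sum>e\<in>UNIV. vscale F (complex_of_real (Gam G c d e)) (psi e (n + r) v))"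
      by (simp add: scale_sum_right)
  qed
qed

end

text \<open>On a truncation valid for both v and T v, T passes through a finite polynomial in the
  fermions. For F = F' this says that whatever commutes with the fermions commutes with
  \<open>S_mode\<close>.\<close>

lemma S_mode_intertwine:
  assumes F: "fermi_lie G F" and F': "fermi_lie G F'" and T: "linear_map_between F F' T"
    and psi: "\<And>a n v. v \<in> carr F \<Longrightarrow> T (act F (Psi a n) v) = act F' (Psi a n) (T v)"
    and v: "v \<in> carr F"
  shows "T (S_mode G F c n v) = S_mode G F' c n (T v)"
proof -
  interpret F: fermi_lie G F by (rule F)
  interpret F': fermi_lie G F' by (rule F')
  have Tv: "T v \<in> carr F'" using T v by (simp add: linear_map_between_def)
  have T_add: "T (u + w) = T u + T w" if "u \<in> carr F" "w \<in> carr F" for u w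
    using T that by (simp add: linear_map_between_def)
  have T_scale: "T (vscale F k u) = vscale F' k (T u)" if "u \<in> carr F" for u k
    using T that by (simp add: linear_map_between_def)
  have T_zero: "T 0 = 0"
    using T_scale[of 0 0] by simp
  have T_neg: "T (- u) = - T u" if "u \<in> carr F" for u
    using T_scale[of u "- 1"] that by simp
  have T_sum: "T (sum f A) = (\<Sum>x\<in>A. T (f x))" if "\<And>x. x \<in> A \<Longrightarrow> f x \<in> carr F"
    for f and A :: "'x set"
    using that by (induction A rule: infinite_finite_induct) (auto simp: T_add T_zero)
  have T_on: "T (S_on G F A c n v) = S_on G F' A c n (T v)" for A
    using v by (simp add: S_on_def T_scale T_neg T_sum psi)
  have "\<forall>\<^sub>F A in finite_subsets_at_top UNIV. S_mode G F c n v = S_on G F A c n v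
      \<and> S_mode G F' c n (T v) = S_on G F' A c n (T v)"
    using v Tv by (intro eventually_conj F.S_mode_eventually F'.S_mode_eventually)
  then obtain A where "S_mode G F c n v = S_on G F A c n v
      \<and> S_mode G F' c n (T v) = S_on G F' A c n (T v)"
    by (rule F.eventually_S_on)
  then show ?thesis
    by (simp add: T_on)
qed

section \<open>The Fock space\<close>

text \<open>The condition of \<open>locally_finite\<close> as a predicate: it must be shown to cut
  out an invariant subspace before \<open>fermi_rep\<close> is available.\<close>

definition fermion_bounded :: "('a fermion, 'v::ab_group_add) prehilbert_rep \<Rightarrow> 'v \<Rightarrow> bool" where
  "fermion_bounded F v \<longleftrightarrow> (\<exists>N. \<forall>a n. n \<ge> N \<longrightarrow> act F (Psi a n) v = 0)"

lemma (in prehilbert) subspace_fermion_bounded: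
  fixes F :: "('a fermion, 'v) prehilbert_rep"
  assumes "carr F = carr V" "vscale F = vscale V" "\<And>i. lin (act F i)"
  shows "subspace {v \<in> carr V. fermion_bounded F v}"
proof (rule subspaceI)
  show "0 \<in> {v \<in> carr V. fermion_bounded F v}"
    using assms(3) by (auto simp: fermion_bounded_def lin_zero)
next
  fix u v assume "u \<in> {v \<in> carr V. fermion_bounded F v}" "v \<in> {v \<in> carr V. fermion_bounded F v}"
  then obtain M N where uv: "u \<in> carr V" "v \<in> carr V" "\<And>a n. n \<ge> M \<Longrightarrow> act F (Psi a n) u = 0"
      "\<And>a n. n \<ge> N \<Longrightarrow> act F (Psi a n) v = 0"
    unfolding fermion_bounded_def by blast
  then have "act F (Psi a n) (u + v) = 0" if "n \<ge> max M N" for a n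
    using that assms(3) by (simp add: lin_add)
  then show "u + v \<in> {v \<in> carr V. fermion_bounded F v}"
    using uv(1,2) unfolding fermion_bounded_def by (auto intro!: exI[of _ "max M N"])
next
  fix c v assume "v \<in> {v \<in> carr V. fermion_bounded F v}"
  then show "vscale V c v \<in> {v \<in> carr V. fermion_bounded F v}"
    using assms(3) unfolding fermion_bounded_def by (auto simp: lin_scale)
qed

lemma fermion_bounded_psi:
  fixes F :: "('a fermion, 'v::ab_group_add) prehilbert_rep"
  assumes "star_rep fermion_star F" "fermion_relations F" "v \<in> carr F" "fermion_bounded F v"
  shows "fermion_bounded F (act F (Psi b m) v)"
proof -
  interpret star_rep fermion_star F by fact
  obtain N where N: "\<And>a n. n \<ge> N \<Longrightarrow> act F (Psi a n) v = 0"
    using assms(4) unfolding fermion_bounded_def by blast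
  \<comment> \<open>From n \<ge> - m on, the anticommutator with \<open>Psi b m\<close> is
    zero.\<close>
  have "act F (Psi a n) (act F (Psi b m) v) = 0" if "n \<ge> max N (- m)" for a n
  proof -
    have "act F (Psi a n) (act F (Psi b m) v) + act F (Psi b m) (act F (Psi a n) v) = 0"
      using assms(2,3) that unfolding fermion_relations_def by auto
    then show ?thesis
      using N that by (simp add: act_simps)
  qed
  then show ?thesis
    unfolding fermion_bounded_def by blast
qed

locale fock = fermi_rep F for F :: "('a fermion, 'v::ab_group_add) prehilbert_rep" +
  fixes \<Omega> :: 'v
  assumes cyclic: "cyclic_vector F \<Omega>" and unit: "inn F \<Omega> \<Omega> = 1"
    and annihilated: "n \<ge> 0 \<Longrightarrow> act F (Psi a n) \<Omega> = 0"

lemma is_fock_NS_fock: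
  fixes F :: "('a fermion, 'v::ab_group_add) prehilbert_rep"
  assumes F: "is_fock_NS F"
  obtains \<Omega> where "fock F \<Omega>"
proof -
  interpret star_rep fermion_star F
    using F by (simp add: star_rep_def is_fock_NS_def)
  have rel: "fermion_relations F"
    using F by (simp add: is_fock_NS_def)
  obtain \<Omega> where \<Omega>: "cyclic_vector F \<Omega>" "inn F \<Omega> \<Omega> = 1" "\<And>a n. n \<ge> 0 \<Longrightarrow> act F (Psi a n) \<Omega> = 0"
    using F unfolding is_fock_NS_def by blast
  have "invariant_subspace F {v \<in> carr F. fermion_bounded F v}"
    unfolding invariant_subspace_def
  proof (intro conjI allI ballI)
    show "subspace {v \<in> carr F. fermion_bounded F v}"
      by (rule subspace_fermion_bounded) simp_all
    fix i w assume "w \<in> {v \<in> carr F. fermion_bounded F v}"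
    then show "act F i w \<in> {v \<in> carr F. fermion_bounded F v}"
      using fermion_bounded_psi[OF star_rep_axioms rel] by (cases i) simp
  qed auto
  moreover have "\<Omega> \<in> {v \<in> carr F. fermion_bounded F v}"
    using \<Omega> unfolding cyclic_vector_def fermion_bounded_def by blast
  ultimately have "{v \<in> carr F. fermion_bounded F v} = carr F"
    using \<Omega>(1) unfolding cyclic_vector_def by blast
  then have "\<And>v. v \<in> carr F \<Longrightarrow> \<exists>N. \<forall>a n. n \<ge> N \<longrightarrow> act F (Psi a n) v = 0"
    unfolding fermion_bounded_def by blast
  then have "fock F \<Omega>"
    using rel \<Omega> by unfold_locales auto
  with that show thesis .
qed

context fock
begin

lemma Omega_carr [simp]: "\<Omega> \<in> carr F"
  using cyclic by (simp add: cyclic_vector_def)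

lemma Omega_vac: "\<Omega> \<in> vac"
  by (simp add: vac_def annihilated)

text \<open>Only creation modes n < 0 are constructors. Stability under annihilation becomes a
  lemma, and the induction rule obtained for the whole Fock space has to treat creation operators
  only.\<close>

inductive_set created :: "'v set" where
  vac: "\<Omega> \<in> created"
| create: "\<lbrakk>y \<in> created; n < 0\<rbrakk> \<Longrightarrow> psi a n y \<in> created"
| add: "\<lbrakk>y \<in> created; z \<in> created\<rbrakk> \<Longrightarrow> y + z \<in> created"
| scale: "y \<in> created \<Longrightarrow> vscale F c y \<in> created"

lemma created_carr: "y \<in> created \<Longrightarrow> y \<in> carr F"
  by (induction rule: created.induct) auto

lemma subspace_created: "subspace created"
  using created.scale[OF created.vac, of 0] by (intro subspaceI) (auto intro: created.intros)

lemma created_annihilate: "\<lbrakk>y \<in> created; n \<ge> 0\<rbrakk> \<Longrightarrow> psi a n y \<in> created"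
proof (induction rule: created.induct)
  case vac
  then show ?case by (simp add: annihilated subspace_0[OF subspace_created])
next
  case (create y m b)
  have "psi a n (psi b m y) = (if a = b \<and> n + m + 1 = 0 then y else 0) - psi b m (psi a n y)"
    by (rule anticommute) (rule created_carr[OF create.hyps(1)])
  moreover have "psi b m (psi a n y) \<in> created"
    using create.IH create.prems create.hyps(2) by (intro created.create[of "psi a n y"]) auto
  moreover have "(if a = b \<and> n + m + 1 = 0 then y else 0) \<in> created"
    using create.hyps subspace_0[OF subspace_created] by simp
  ultimately show ?case
    by (simp only: subspace_diff[OF subspace_created])
next
  case (add y z)
  then show ?case by (simp add: created_carr act_simps created.add)
next
  case (scale y c)
  then show ?case by (simp add: created_carr act_simps created.scale)
qed

lemma created_eq: "created = carr F"
proof -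
  have "invariant_subspace F created"
    unfolding invariant_subspace_def
  proof (intro conjI allI ballI)
    fix i :: "'a fermion" and y assume y: "y \<in> created"
    obtain a n where "i = Psi a n" by (cases i)
    with y show "act F i y \<in> created"
      by (cases "n \<ge> 0") (auto intro: created_annihilate created.create)
  qed (auto intro: subspace_created created_carr)
  then show ?thesis
    using cyclic created.vac unfolding cyclic_vector_def by blast
qed

lemma fock_induct [consumes 1, case_names vac create add scale]:
  assumes "y \<in> carr F" "P \<Omega>"
    and "\<And>a n y. \<lbrakk>y \<in> carr F; P y; n < 0\<rbrakk> \<Longrightarrow> P (psi a n y)"
    and "\<And>y z. \<lbrakk>y \<in> carr F; P y; z \<in> carr F; P z\<rbrakk> \<Longrightarrow> P (y + z)"
    and "\<And>y c. \<lbrakk>y \<in> carr F; P y\<rbrakk> \<Longrightarrow> P (vscale F c y)"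
  shows "P y"
proof -
  have "y \<in> created" using assms(1) by (simp add: created_eq)
  then show ?thesis
    by (induction rule: created.induct) (auto simp: assms created_carr)
qed

text \<open>The part u of x orthogonal to \<Omega> is again a vacuum vector. It is orthogonal to
  every \<open>psi a n y\<close> with n < 0, because the adjoint mode kills u, and hence to the
  whole Fock space.\<close>

lemma vac_eq: "x \<in> vac \<Longrightarrow> x = vscale F (inn F \<Omega> x) \<Omega>"
proof -
  assume x: "x \<in> vac"
  define u where "u = x - vscale F (inn F \<Omega> x) \<Omega>"
  have u: "u \<in> vac"
    unfolding u_def using x by (intro subspace_diff subspace_scale subspace_vac Omega_vac)
  have xc: "x \<in> carr F" and uc: "u \<in> carr F"
    using x u by (auto intro: vac_carr)
  have "inn F u y = 0" if "y \<in> carr F" for y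
    using that
  proof (induction rule: fock_induct)
    case vac
    have "inn F \<Omega> u = 0" unfolding u_def using xc by (simp add: unit)
    then show ?case using uc by (simp add: inn_commute[of \<Omega> u])
  next
    case (create a n y)
    then show ?case
      using adjoint_psi[OF uc create(1), of a "- n - 1"] u by (simp add: vacD)
  qed (use uc in simp_all)
  then have "u = 0"
    using inn_self_eq_0 uc by blast
  then show ?thesis
    by (simp add: u_def)
qed

lemma psi_psi_expectation:
  assumes "q < 0"
  shows "inn F \<Omega> (psi a p (psi b q \<Omega>)) = (if a = b \<and> p + q + 1 = 0 then 1 else 0)"
proof -
  have "inn F \<Omega> (psi b q (psi a p \<Omega>)) = 0"
    using assms adjoint_psi[of \<Omega> "psi a p \<Omega>" b "- q - 1"] by (simp add: annihilated)
  then show ?thesis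
    by (simp add: anticommute[of \<Omega> a p b q] unit)
qed

end

section \<open>The affine relations of the currents at level \<open>dual_cox G\<close>\<close>

locale fock_lie = fermi_lie G F + fock F \<Omega>
  for G :: "('a::finite, 'g::ab_group_add) lie_data" and F :: "('a fermion, 'v::ab_group_add) prehilbert_rep"
    and \<Omega> :: 'v
begin

lemma S_Omega: "n \<ge> 0 \<Longrightarrow> S c n \<Omega> = 0"
  using Omega_vac by (rule S_vac)

text \<open>Expand \<open>S b n \<Omega>\<close> only. Both fermions are creation operators exactly
  for n \<le> p < 0, which is m indices when m + n = 0; each contributes a product of two structure
  constants. Their sum is 2g by the dual Coxeter relation, and the prefactor halves it.\<close>

lemma S_expectation:
  assumes m: "m \<ge> 0" and n: "n < 0"
  shows "inn F \<Omega> (S a m (S b n \<Omega>)) = (if a = b \<and> m + n = 0 then of_int m * complex_of_real (dual_cox G) else 0)"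
proof -
  have "\<forall>\<^sub>F A in finite_subsets_at_top UNIV. S b n \<Omega> = S_on G F A b n \<Omega> \<and> {n..<0} \<subseteq> A"
    by (intro eventually_conj S_mode_eventually)
      (auto simp: eventually_finite_subsets_at_top intro!: exI[of _ "{n..<0}"])
  then obtain A where fin: "finite A" and A: "S b n \<Omega> = S_on G F A b n \<Omega> \<and> {n..<0} \<subseteq> A"
    by (rule eventually_S_on)
  have summand: "inn F \<Omega> (S a m (psi c p (psi d (n - 1 - p) \<Omega>)))
      = (if p \<in> {n..<0} then if m + n = 0 then \<i> * complex_of_real (Gam G a c d) else 0 else 0)"
    if cd: "c \<noteq> d" for c d p
  proof (cases "p \<in> {n..<0}")
    case True
    let ?y = "psi d (n - 1 - p) \<Omega>"
    have "S a m (psi c p ?y) = psi c p (S a m ?y)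
        + vscale F \<i> (\<Sum>e\<in>UNIV. vscale F (complex_of_real (Gam G a c e)) (psi e (m + p) ?y))"
      using S_psi[of ?y a m c p] by (simp add: diff_eq_eq add.commute)
    moreover have "inn F \<Omega> (psi c p (S a m ?y)) = 0"
      using True adjoint_psi[of \<Omega> "S a m ?y" c "- p - 1"] by (simp add: annihilated)
    ultimately have "inn F \<Omega> (S a m (psi c p ?y))
        = \<i> * (\<Sum>e\<in>UNIV. complex_of_real (Gam G a c e) * inn F \<Omega> (psi e (m + p) ?y))"
      by (simp add: inn_sum_right)
    also have "\<dots> = (if m + n = 0 then \<i> * complex_of_real (Gam G a c d) else 0)"
      using True by (simp add: psi_psi_expectation if_distrib[of "\<lambda>x. _ * x"] sum.delta cong: if_cong)
    finally show ?thesis using True by simp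
  next
    case False
    then have "psi c p (psi d (n - 1 - p) \<Omega>) = 0"
      using cd by (cases "p \<ge> 0") (simp_all add: anticommute[of \<Omega> c p d] annihilated act_simps)
    then show ?thesis
      by (simp only: False if_False S_simps(3) inn_zero_right[OF Omega_carr])
  qed
  have "inn F \<Omega> (S a m (S b n \<Omega>)) = - \<i> / 2 * (\<Sum>c\<in>UNIV. \<Sum>d\<in>UNIV. complex_of_real (Gam G c d b)
      * (\<Sum>p\<in>A. inn F \<Omega> (S a m (psi c p (psi d (n - 1 - p) \<Omega>)))))"
    using A by (simp add: S_on_def S_simps inn_sum_right)
  also have "\<dots> = - \<i> / 2 * (\<Sum>c\<in>UNIV. \<Sum>d\<in>UNIV. complex_of_real (Gam G c d b)
      * (if m + n = 0 then of_int m * \<i> * complex_of_real (Gam G c d a) else 0))"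
  proof -
    have "complex_of_real (Gam G c d b) * (\<Sum>p\<in>A. inn F \<Omega> (S a m (psi c p (psi d (n - 1 - p) \<Omega>))))
        = complex_of_real (Gam G c d b) * (if m + n = 0 then of_int m * \<i> * complex_of_real (Gam G c d a) else 0)"
      for c d
    proof (cases "c = d")
      case False
      have "(\<Sum>p\<in>A. inn F \<Omega> (S a m (psi c p (psi d (n - 1 - p) \<Omega>))))
          = (\<Sum>p\<in>{n..<0}. if m + n = 0 then \<i> * complex_of_real (Gam G a c d) else 0)"
        unfolding summand[OF False] using fin A by (subst sum.inter_restrict[symmetric]) (auto simp: Int_absorb1)
      also have "\<dots> = (if m + n = 0 then of_int m * \<i> * complex_of_real (Gam G c d a) else 0)"
      proof (cases "m + n = 0")
        case True
        then have "nat (- n) = nat m" by simp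
        then show ?thesis
          using True m Gam_cyclic[where a = a and b = c and c = d] by (simp add: of_nat_nat)
      qed simp
      finally show ?thesis by simp
    qed simp
    then show ?thesis by (simp only:)
  qed
  also have "\<dots> = (if m + n = 0 then of_int m / 2 * complex_of_real
      (\<Sum>c\<in>UNIV. \<Sum>d\<in>UNIV. Gam G c d b * Gam G c d a) else 0)"
    by (simp add: sum_distrib_left mult_ac)
  also have "\<dots> = (if a = b \<and> m + n = 0 then of_int m * complex_of_real (dual_cox G) else 0)"
    by (simp add: dual_coxeter)
  finally show ?thesis .
qed

lemma sum_scale_swap:
  "(\<Sum>e\<in>A. vscale F (x e) (\<Sum>f\<in>B. vscale F (y e f) (w f))) = (\<Sum>f\<in>B. vscale F (\<Sum>e\<in>A. x e * y e f) (w f))"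
  by (simp add: scale_sum_right scale_sum_left) (rule sum.swap)

text \<open>
  The defect of the commutation relations commutes with the fermions, so it is the scalar given by its
  vacuum expectation.
\<close>

definition S_defect :: "'a \<Rightarrow> int \<Rightarrow> 'a \<Rightarrow> int \<Rightarrow> 'v \<Rightarrow> 'v" where
  "S_defect a m b n v = S a m (S b n v) - S b n (S a m v)
     - (vscale F \<i> (\<Sum>c\<in>UNIV. vscale F (complex_of_real (Gam G a b c)) (S c (m + n) v))
        + (if a = b \<and> m + n = 0 then vscale F (of_int m * complex_of_real (dual_cox G)) v else 0))"

lemma lin_S_defect: "lin (S_defect a m b n)"
  by (rule linI)
    (simp_all add: S_defect_def S_simps scale_right_distrib scale_right_diff_distrib sum.distrib scale_sum_right
      scale_left_commute algebra_simps)

text \<open>Terms in which one current acts on the fermion and the other on v are symmetric in the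
  two currents and cancel in the commutator. Terms in which both act on the fermion match the
  bracket term by the Jacobi identity.\<close>

lemma S_defect_psi:
  assumes v: "v \<in> carr F"
  shows "S_defect a m b n (psi d r v) = psi d r (S_defect a m b n v)"
proof -
  let ?g = "\<lambda>x y z. complex_of_real (Gam G x y z)"
  have S1: "S x k (psi y s u) = psi y s (S x k u) + vscale F \<i> (\<Sum>e\<in>UNIV. vscale F (?g x y e) (psi e (k + s) u))"
    if "u \<in> carr F" for x k y s u
    using S_psi[OF that, of x k y s] by (simp add: diff_eq_eq add.commute)
  \<comment> \<open>T x y: the fermion is hit by y and then by x. U x k y s: it is hit by x, while y
    acts on v.\<close>
  define T where "T x y = (\<Sum>f\<in>UNIV. vscale F (\<Sum>e\<in>UNIV. ?g y d e * ?g x e f) (psi f (m + n + r) v))" for x y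
  define U where "U x k y s = vscale F \<i> (\<Sum>e\<in>UNIV. vscale F (?g x d e) (psi e (k + r) (S y s v)))" for x k y s
  have S2: "S x k (S y s (psi d r v)) = psi d r (S x k (S y s v)) + U x k y s + (U y s x k - T x y)"
    if ks: "k + s = m + n" for x k y s
  proof -
    have "S x k (S y s (psi d r v)) = S x k (psi d r (S y s v))
        + vscale F \<i> (\<Sum>e\<in>UNIV. vscale F (?g y d e) (S x k (psi e (s + r) v)))"
      using v by (simp add: S1[OF v, of y s d r] S_simps)
    also have "S x k (psi d r (S y s v)) = psi d r (S x k (S y s v)) + U x k y s"
      using v by (simp add: S1 U_def)
    also have "(\<Sum>e\<in>UNIV. vscale F (?g y d e) (S x k (psi e (s + r) v)))
        = (\<Sum>e\<in>UNIV. vscale F (?g y d e) (psi e (s + r) (S x k v)))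
          + vscale F \<i> (\<Sum>e\<in>UNIV. vscale F (?g y d e) (\<Sum>f\<in>UNIV. vscale F (?g x e f) (psi f (m + n + r) v)))"
      using v by (simp add: S1 scale_right_distrib sum.distrib scale_sum_right scale_left_commute add.assoc[symmetric] ks mult.left_commute)
    also have "(\<Sum>e\<in>UNIV. vscale F (?g y d e) (\<Sum>f\<in>UNIV. vscale F (?g x e f) (psi f (m + n + r) v))) = T x y"
      unfolding T_def by (rule sum_scale_swap)
    finally show ?thesis
      by (simp add: scale_right_distrib U_def)
  qed
  have "(\<Sum>c\<in>UNIV. vscale F (?g a b c) (S c (m + n) (psi d r v)))
      = psi d r (\<Sum>c\<in>UNIV. vscale F (?g a b c) (S c (m + n) v))
        + vscale F \<i> (\<Sum>c\<in>UNIV. vscale F (?g a b c) (\<Sum>f\<in>UNIV. vscale F (?g c d f) (psi f (m + n + r) v)))"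
    using v by (simp add: S1 act_simps scale_right_distrib sum.distrib scale_sum_right scale_left_commute mult.left_commute)
  also have "(\<Sum>c\<in>UNIV. vscale F (?g a b c) (\<Sum>f\<in>UNIV. vscale F (?g c d f) (psi f (m + n + r) v))) = T a b - T b a"
  proof -
    have "(\<Sum>c\<in>UNIV. ?g a b c * ?g c d f)
        = (\<Sum>e\<in>UNIV. ?g b d e * ?g a e f) - (\<Sum>e\<in>UNIV. ?g a d e * ?g b e f)" for f
      by (simp flip: Gam_jacobi of_real_mult of_real_sum of_real_diff)
    then show ?thesis
      unfolding T_def sum_scale_swap by (simp only: scale_left_diff_distrib sum_subtractf)
  qed
  finally have S3: "vscale F \<i> (\<Sum>c\<in>UNIV. vscale F (?g a b c) (S c (m + n) (psi d r v)))
      = psi d r (vscale F \<i> (\<Sum>c\<in>UNIV. vscale F (?g a b c) (S c (m + n) v))) - (T a b - T b a)"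
    using v by (simp add: scale_right_distrib act_simps)
  show ?thesis
    unfolding S_defect_def S3 S2[of m n a b, OF refl] S2[of n m b a, OF add.commute]
    using v by (simp add: act_simps algebra_simps)
qed

lemma S_defect_zero:
  assumes v: "v \<in> carr F"
  shows "S_defect a m b n v = 0"
proof -
  have defect_vac: "S_defect a m b n \<Omega> \<in> vac"
    using lin_S_defect by (auto simp: vac_def annihilated lin_zero simp flip: S_defect_psi)
  have neg: "inn F \<Omega> (S c k u) = 0" if "k < 0" "u \<in> carr F" for c k u
    using S_adjoint[of \<Omega> u c "- k"] that by (simp add: S_Omega)
  have one: "inn F \<Omega> (S c k \<Omega>) = 0" for c k
    by (cases "k < 0") (simp_all add: neg S_Omega)
  have "inn F \<Omega> (S_defect a m b n \<Omega>) = inn F \<Omega> (S a m (S b n \<Omega>)) - inn F \<Omega> (S b n (S a m \<Omega>))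
      - (if a = b \<and> m + n = 0 then of_int m * complex_of_real (dual_cox G) else 0)"
    by (simp add: S_defect_def inn_sum_right one unit)
  also have "\<dots> = 0"
  \<comment> \<open>A central term occurs only for m and n of opposite sign: if both are
    nonnegative, m + n = 0 forces m = 0; if both are negative, m + n \<noteq> 0.\<close>
  proof (cases "m \<ge> 0"; cases "n \<ge> 0")
    assume "m \<ge> 0" "n \<ge> 0"
    then show ?thesis by (auto simp: S_Omega S_simps)
  next
    assume "m \<ge> 0" "\<not> n \<ge> 0"
    then show ?thesis by (simp add: S_expectation neg)
  next
    assume "\<not> m \<ge> 0" "n \<ge> 0"
    then show ?thesis by (auto simp: S_expectation neg add_eq_0_iff)
  next
    assume "\<not> m \<ge> 0" "\<not> n \<ge> 0"
    then show ?thesis by (auto simp: neg)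
  qed
  finally have "S_defect a m b n \<Omega> = 0"
    using vac_eq[OF defect_vac] by simp
  from v show ?thesis
    by (induction rule: fock_induct) (use \<open>S_defect a m b n \<Omega> = 0\<close> lin_S_defect in \<open>simp_all add: S_defect_psi lin_add lin_scale act_simps\<close>)
qed

lemma S_S:
  assumes "v \<in> carr F"
  shows "S a m (S b n v) - S b n (S a m v)
     = vscale F \<i> (\<Sum>c\<in>UNIV. vscale F (complex_of_real (Gam G a b c)) (S c (m + n) v))
        + (if a = b \<and> m + n = 0 then vscale F (of_int m * complex_of_real (dual_cox G)) v else 0)"
  using S_defect_zero[OF assms, of a m b n] unfolding S_defect_def by simp

end

section \<open>Tensor products of prehilbert spaces\<close>

text \<open>
  Higher-order unification eta-expands functions; the simplifier would then unfold their sums pointwise.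
\<close>

declare plus_fun_apply [simp del] zero_fun_apply [simp del] minus_apply [simp del]

lemma tensor_scale_apply: "tensor_scale c f z = c * f z"
  by (simp add: tensor_scale_def)

lemmas fun_apply = plus_fun_apply zero_fun_apply minus_apply tensor_scale_apply

lemma vector_space_tensor_scale: "vector_space (tensor_scale :: complex \<Rightarrow> ('p \<times> 'q \<Rightarrow> complex) \<Rightarrow> _)"
  by unfold_locales (auto simp: fun_eq_iff fun_apply algebra_simps)

section \<open>Operators with an adjoint\<close>

context prehilbert
begin

text \<open>The adjoint is carried along because an operator on a prehilbert space need not have
  one. Its existence already makes A linear on the carrier, since the inner product is
  definite.\<close>

definition adj :: "('v \<Rightarrow> 'v) \<Rightarrow> ('v \<Rightarrow> 'v) \<Rightarrow> bool" where
  "adj A A' \<longleftrightarrow> (\<forall>u\<in>carr V. A u \<in> carr V \<and> A' u \<in> carr V)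
     \<and> (\<forall>u\<in>carr V. \<forall>v\<in>carr V. inn V (A' u) v = inn V u (A v))"

lemma adjD:
  assumes "adj A A'"
  shows "u \<in> carr V \<Longrightarrow> A u \<in> carr V" "u \<in> carr V \<Longrightarrow> A' u \<in> carr V"
    "\<lbrakk>u \<in> carr V; v \<in> carr V\<rbrakk> \<Longrightarrow> inn V (A' u) v = inn V u (A v)"
  using assms by (simp_all add: adj_def)

lemma adj_sym: "adj A A' \<Longrightarrow> adj A' A"
  unfolding adj_def by (metis inn_commute)

lemma adj_id: "adj id id"
  by (simp add: adj_def)

end

lemma (in star_rep) adj_act: "adj (act V i) (act V (star i))" if "\<And>i. star (star i) = i"
  using that by (simp add: adj_def adjoint)

lemma (in fermi_lie) adj_S: "adj (S c n) (S c (- n))"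
  by (simp add: adj_def S_adjoint)

locale tensor_pair = P: prehilbert P + Q: prehilbert Q
  for P :: "('i, 'p::ab_group_add) prehilbert_rep" and Q :: "('j, 'q::ab_group_add) prehilbert_rep"
begin

sublocale T: vector_space "tensor_scale :: complex \<Rightarrow> ('p \<times> 'q \<Rightarrow> complex) \<Rightarrow> _"
  by (rule vector_space_tensor_scale)

abbreviation tp :: "'p \<Rightarrow> 'q \<Rightarrow> 'p \<times> 'q \<Rightarrow> complex" where "tp \<equiv> tensor P Q"
abbreviation TC :: "('p \<times> 'q \<Rightarrow> complex) set" where "TC \<equiv> tensor_carrier P Q"

lemma tp_apply: "\<lbrakk>x \<in> carr P; y \<in> carr Q\<rbrakk> \<Longrightarrow> tp v w (x, y) = inn P x v * inn Q y w"
  by (simp add: tensor_def)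

lemma tp_add_left: "\<lbrakk>u \<in> carr P; v \<in> carr P\<rbrakk> \<Longrightarrow> tp (u + v) w = tp u w + tp v w"
  by (auto simp: tensor_def fun_eq_iff fun_apply algebra_simps)

lemma tp_add_right: "\<lbrakk>v \<in> carr Q; w \<in> carr Q\<rbrakk> \<Longrightarrow> tp u (v + w) = tp u v + tp u w"
  by (auto simp: tensor_def fun_eq_iff fun_apply algebra_simps)

lemma tp_scale_left: "v \<in> carr P \<Longrightarrow> tp (vscale P c v) w = tensor_scale c (tp v w)"
  by (auto simp: tensor_def fun_eq_iff fun_apply)

lemma tp_scale_right: "w \<in> carr Q \<Longrightarrow> tp v (vscale Q c w) = tensor_scale c (tp v w)"
  by (auto simp: tensor_def fun_eq_iff fun_apply)

lemma tp_zero_left [simp]: "tp 0 w = 0"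
  by (auto simp: tensor_def fun_eq_iff fun_apply)

lemma tp_zero_right [simp]: "tp v 0 = 0"
  by (auto simp: tensor_def fun_eq_iff fun_apply)

lemma tp_diff_left: "\<lbrakk>u \<in> carr P; v \<in> carr P\<rbrakk> \<Longrightarrow> tp (u - v) w = tp u w - tp v w"
  by (auto simp: tensor_def fun_eq_iff fun_apply algebra_simps)

lemma tp_diff_right: "\<lbrakk>v \<in> carr Q; w \<in> carr Q\<rbrakk> \<Longrightarrow> tp u (v - w) = tp u v - tp u w"
  by (auto simp: tensor_def fun_eq_iff fun_apply algebra_simps)

lemma tp_sum_left: "(\<And>x. x \<in> A \<Longrightarrow> f x \<in> carr P) \<Longrightarrow> tp (sum f A) w = (\<Sum>x\<in>A. tp (f x) w)"
  by (induction A rule: infinite_finite_induct) (auto simp: tp_add_left)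

lemma tp_sum_right: "(\<And>x. x \<in> A \<Longrightarrow> f x \<in> carr Q) \<Longrightarrow> tp v (sum f A) = (\<Sum>x\<in>A. tp v (f x))"
  by (induction A rule: infinite_finite_induct) (auto simp: tp_add_right)

lemma subspace_TC: "T.subspace TC"
  by (simp add: tensor_carrier_def)

lemma TC_zero [simp]: "0 \<in> TC"
  and TC_add [simp]: "\<lbrakk>f \<in> TC; g \<in> TC\<rbrakk> \<Longrightarrow> f + g \<in> TC"
  and TC_diff [simp]: "\<lbrakk>f \<in> TC; g \<in> TC\<rbrakk> \<Longrightarrow> f - g \<in> TC"
  and TC_scale [simp]: "f \<in> TC \<Longrightarrow> tensor_scale c f \<in> TC"
  using subspace_TC by (auto intro: T.subspace_0 T.subspace_add T.subspace_diff T.subspace_scale)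

lemma tp_TC [simp]: "\<lbrakk>v \<in> carr P; w \<in> carr Q\<rbrakk> \<Longrightarrow> tp v w \<in> TC"
  unfolding tensor_carrier_def by (rule T.span_base) blast

text \<open>There is no case for scalars: they are absorbed into the left factor of a pure
  tensor.\<close>

lemma TC_induct [consumes 1, case_names pure add]:
  assumes "f \<in> TC" and pure: "\<And>v w. \<lbrakk>v \<in> carr P; w \<in> carr Q\<rbrakk> \<Longrightarrow> Pr (tp v w)"
    and add: "\<And>f g. \<lbrakk>f \<in> TC; Pr f; g \<in> TC; Pr g\<rbrakk> \<Longrightarrow> Pr (f + g)"
  shows "Pr f"
proof -
  have "f \<in> TC \<and> Pr f"
    using assms(1)[unfolded tensor_carrier_def]
  proof (induction rule: T.span_induct_alt)
    case base
    then show ?case using pure[of 0 0] by simp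
  next
    case (step c x y)
    then obtain v w where "x = tp v w" "v \<in> carr P" "w \<in> carr Q"
      by blast
    then show ?case
      using step.IH pure[of "vscale P c v" w] by (auto simp: tp_scale_left intro: add)
  qed
  then show ?thesis ..
qed

definition tsum :: "('p \<times> 'q) list \<Rightarrow> 'p \<times> 'q \<Rightarrow> complex" where
  "tsum ps = (\<Sum>(v, w)\<leftarrow>ps. tp v w)"

lemma tsum_simps [simp]: "tsum [] = 0" "tsum ((v, w) # ps) = tp v w + tsum ps" "tsum (ps @ qs) = tsum ps + tsum qs"
  by (simp_all add: tsum_def)

lemma tsum_TC: "set ps \<subseteq> carr P \<times> carr Q \<Longrightarrow> tsum ps \<in> TC"
  by (induction ps) auto

lemma tensor_decomp:
  assumes "f \<in> TC"
  shows "set (tensor_decomp P Q f) \<subseteq> carr P \<times> carr Q" "tsum (tensor_decomp P Q f) = f"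
proof -
  have "\<exists>ps. set ps \<subseteq> carr P \<times> carr Q \<and> f = tsum ps"
    using assms
  proof (induction rule: TC_induct)
    case (pure v w)
    then show ?case by (intro exI[of _ "[(v, w)]"]) auto
  next
    case (add f g)
    then obtain ps qs where "set ps \<subseteq> carr P \<times> carr Q" "f = tsum ps" "set qs \<subseteq> carr P \<times> carr Q" "g = tsum qs"
      by blast
    then show ?case by (intro exI[of _ "ps @ qs"]) auto
  qed
  then show "set (tensor_decomp P Q f) \<subseteq> carr P \<times> carr Q" "tsum (tensor_decomp P Q f) = f"
    unfolding tensor_decomp_def tsum_def by (metis (mono_tags, lifting) someI_ex)+
qed

lemma TC_outside: "\<lbrakk>f \<in> TC; x \<notin> carr P \<or> y \<notin> carr Q\<rbrakk> \<Longrightarrow> f (x, y) = 0"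
  by (induction rule: TC_induct) (auto simp: tensor_def fun_apply)

lemma TC_ext:
  assumes "f \<in> TC" "g \<in> TC" "\<And>x y. \<lbrakk>x \<in> carr P; y \<in> carr Q\<rbrakk> \<Longrightarrow> f (x, y) = g (x, y)"
  shows "f = g"
proof
  fix z :: "'p \<times> 'q"
  show "f z = g z"
    using assms TC_outside by (cases z) metis
qed

lemma TC_add_snd: "\<lbrakk>f \<in> TC; x \<in> carr P; y \<in> carr Q; z \<in> carr Q\<rbrakk> \<Longrightarrow> f (x, y + z) = f (x, y) + f (x, z)"
  by (induction rule: TC_induct) (auto simp: tp_apply fun_apply algebra_simps)

lemma TC_scale_snd: "\<lbrakk>f \<in> TC; x \<in> carr P; y \<in> carr Q\<rbrakk> \<Longrightarrow> f (x, vscale Q c y) = cnj c * f (x, y)"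
  by (induction rule: TC_induct) (auto simp: tp_apply fun_apply algebra_simps)

text \<open>The contraction of f with y. It is represented by a vector without completeness because
  f is a finite sum of pure tensors.\<close>

lemma TC_section:
  assumes "f \<in> TC" "y \<in> carr Q"
  shows "\<exists>v\<in>carr P. \<forall>x\<in>carr P. f (x, y) = inn P x v"
  using assms
proof (induction rule: TC_induct)
  case (pure v w)
  then show ?case by (intro bexI[of _ "vscale P (inn Q y w) v"]) (auto simp: tp_apply)
next
  case (add f g)
  then obtain u v where "u \<in> carr P" "v \<in> carr P" "\<forall>x\<in>carr P. f (x, y) = inn P x u"
      "\<forall>x\<in>carr P. g (x, y) = inn P x v"
    by blast
  then show ?case by (intro bexI[of _ "u + v"]) (auto simp: fun_apply)
qed

text \<open>The right-hand side does not mention \<open>tensor_decomp\<close>, so the choice made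
  there has no influence. Linearity and the action on pure tensors follow by comparing
  values.\<close>

lemma tensor_op_apply:
  assumes A: "P.adj A A'" and B: "Q.adj B B'" and f: "f \<in> TC" and x: "x \<in> carr P" and y: "y \<in> carr Q"
  shows "tensor_op P Q A B f (x, y) = f (A' x, B' y)"
proof -
  have "(\<Sum>(v, w)\<leftarrow>ps. tp (A v) (B w)) (x, y) = tsum ps (A' x, B' y)" if "set ps \<subseteq> carr P \<times> carr Q" for ps
    using that
  proof (induction ps)
    case (Cons p ps)
    then show ?case
      using x y P.adjD[OF A] Q.adjD[OF B] by (cases p) (auto simp: tp_apply fun_apply)
  qed (simp add: fun_apply)
  then show ?thesis
    unfolding tensor_op_def using tensor_decomp[OF f] by simp
qed

lemma tensor_op_TC:
  assumes A: "P.adj A A'" and B: "Q.adj B B'" and f: "f \<in> TC"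
  shows "tensor_op P Q A B f \<in> TC"
proof -
  have "(\<Sum>(v, w)\<leftarrow>ps. tp (A v) (B w)) \<in> TC" if "set ps \<subseteq> carr P \<times> carr Q" for ps
    using that P.adjD(1)[OF A] Q.adjD(1)[OF B] by (induction ps) auto
  then show ?thesis
    unfolding tensor_op_def using tensor_decomp(1)[OF f] by simp
qed

lemma tensor_op_tp:
  assumes A: "P.adj A A'" and B: "Q.adj B B'" and v: "v \<in> carr P" "w \<in> carr Q"
  shows "tensor_op P Q A B (tp v w) = tp (A v) (B w)"
  by (rule TC_ext)
    (use assms in \<open>simp_all add: tensor_op_TC tensor_op_apply tp_apply P.adjD[OF A] Q.adjD[OF B]\<close>)

lemma tensor_op_add:
  assumes A: "P.adj A A'" and B: "Q.adj B B'" and f: "f \<in> TC" "g \<in> TC"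
  shows "tensor_op P Q A B (f + g) = tensor_op P Q A B f + tensor_op P Q A B g"
  by (rule TC_ext) (use assms in \<open>simp_all add: tensor_op_TC tensor_op_apply P.adjD[OF A] Q.adjD[OF B] fun_apply\<close>)

lemma tensor_op_scale:
  assumes A: "P.adj A A'" and B: "Q.adj B B'" and f: "f \<in> TC"
  shows "tensor_op P Q A B (tensor_scale c f) = tensor_scale c (tensor_op P Q A B f)"
  by (rule TC_ext) (use assms in \<open>simp_all add: tensor_op_TC tensor_op_apply P.adjD[OF A] Q.adjD[OF B] fun_apply\<close>)

section \<open>The inner product of the tensor product\<close>

abbreviation tinner :: "('p \<times> 'q \<Rightarrow> complex) \<Rightarrow> ('p \<times> 'q \<Rightarrow> complex) \<Rightarrow> complex" where
  "tinner \<equiv> tensor_inner P Q"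

text \<open>Independence of the decomposition: for a pure tensor g the right-hand side is the
  conjugate of a value of \<open>tsum ps\<close>, so it depends on the sum only, and both sides are
  additive in g.\<close>

lemma tinner_tsum:
  assumes ps: "set ps \<subseteq> carr P \<times> carr Q" and g: "g \<in> TC"
  shows "tinner (tsum ps) g = sum_list (map g ps)"
proof -
  have cnj: "sum_list (map (tp a b) qs) = cnj (tsum qs (a, b))"
    if "set qs \<subseteq> carr P \<times> carr Q" "a \<in> carr P" "b \<in> carr Q" for qs a b
    using that
  proof (induction qs)
    case (Cons q qs)
    then show ?case
      by (cases q) (auto simp: tp_apply fun_apply P.inn_commute[of a] Q.inn_commute[of b])
  qed (simp add: fun_apply)
  have sum: "sum_list (map (f + g) rs) = sum_list (map f rs) + sum_list (map g rs)"
    for f g :: "'p \<times> 'q \<Rightarrow> complex" and rs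
    by (induction rs) (auto simp: fun_apply)
  have "sum_list (map g qs) = sum_list (map g ps)"
    if "set qs \<subseteq> carr P \<times> carr Q" "tsum qs = tsum ps" for qs
    using g
  proof (induction rule: TC_induct)
    case (pure v w)
    then show ?case by (simp only: cnj[OF that(1)] cnj[OF ps] that(2))
  next
    case (add f g)
    then show ?case by (simp add: sum)
  qed
  then show ?thesis
    unfolding tensor_inner_def using tensor_decomp[OF tsum_TC[OF ps]] by simp
qed

lemma tinner_tp: "\<lbrakk>v \<in> carr P; w \<in> carr Q; g \<in> TC\<rbrakk> \<Longrightarrow> tinner (tp v w) g = g (v, w)"
  using tinner_tsum[of "[(v, w)]" g] by simp

lemma tinner_add_left: "\<lbrakk>f \<in> TC; f' \<in> TC; g \<in> TC\<rbrakk> \<Longrightarrow> tinner (f + f') g = tinner f g + tinner f' g"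
  using tinner_tsum[of "tensor_decomp P Q f @ tensor_decomp P Q f'" g]
    tinner_tsum[of "tensor_decomp P Q f" g] tinner_tsum[of "tensor_decomp P Q f'" g]
  by (simp add: tensor_decomp)

lemma tinner_add_right: "\<lbrakk>f \<in> TC; g \<in> TC; g' \<in> TC\<rbrakk> \<Longrightarrow> tinner f (g + g') = tinner f g + tinner f g'"
  by (induction f rule: TC_induct) (simp_all add: tinner_tp tinner_add_left fun_apply)

lemma tinner_scale_right: "\<lbrakk>f \<in> TC; g \<in> TC\<rbrakk> \<Longrightarrow> tinner f (tensor_scale c g) = c * tinner f g"
  by (induction f rule: TC_induct) (simp_all add: tinner_tp tinner_add_left algebra_simps fun_apply)

lemma tinner_commute: "\<lbrakk>f \<in> TC; g \<in> TC\<rbrakk> \<Longrightarrow> tinner g f = cnj (tinner f g)"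
proof (induction f rule: TC_induct)
  case (pure v w)
  have "tinner g (tp v w) = cnj (g (v, w))" if "g \<in> TC"
    using that
  proof (induction g rule: TC_induct)
    case (pure a b)
    then show ?case
      using \<open>v \<in> carr P\<close> \<open>w \<in> carr Q\<close>
      by (simp add: tinner_tp tp_apply P.inn_commute[of v] Q.inn_commute[of w])
  next
    case (add f h)
    then show ?case
      using pure by (simp add: tinner_add_left) (simp add: fun_apply)
  qed
  with pure show ?case by (simp add: tinner_tp)
qed (simp add: tinner_add_left tinner_add_right)

text \<open>One step of the Gram--Schmidt process in the second factor.\<close>

lemma orthogonalize:
  assumes "set ps \<subseteq> carr P \<times> carr Q" "sorted_wrt (\<lambda>w w'. inn Q w w' = 0) (map snd ps)" "v \<in> carr P" "w \<in> carr Q"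
  shows "\<exists>ps' w'. map snd ps' = map snd ps \<and> set ps' \<subseteq> carr P \<times> carr Q \<and> w' \<in> carr Q
    \<and> (\<forall>u\<in>set (map snd ps). inn Q w' u = 0) \<and> tp v w + tsum ps = tp v w' + tsum ps'"
  using assms
proof (induction ps)
  case Nil
  then show ?case by (intro exI[of _ "[]"] exI[of _ w]) auto
next
  case (Cons p ps)
  obtain a b where p: "p = (a, b)" by fastforce
  have "\<exists>ps' w'. map snd ps' = map snd ps \<and> set ps' \<subseteq> carr P \<times> carr Q \<and> w' \<in> carr Q
    \<and> (\<forall>u\<in>set (map snd ps). inn Q w' u = 0) \<and> tp v w + tsum ps = tp v w' + tsum ps'"
    using Cons.prems by (intro Cons.IH) auto
  then obtain ps' w' where IH: "map snd ps' = map snd ps" "set ps' \<subseteq> carr P \<times> carr Q" "w' \<in> carr Q"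
      "\<And>u. u \<in> set (map snd ps) \<Longrightarrow> inn Q w' u = 0" "tp v w + tsum ps = tp v w' + tsum ps'"
    by blast
  have ab: "a \<in> carr P" "b \<in> carr Q" "\<And>u. u \<in> set (map snd ps) \<Longrightarrow> u \<in> carr Q \<and> inn Q b u = 0"
    using Cons.prems p by auto
  \<comment> \<open>The Gram-Schmidt coefficient. If \<open>inn Q b b = 0\<close>, then b = 0, and c
    is 0 by the convention for division by zero.\<close>
  define c where "c = inn Q b w' / inn Q b b"
  define w'' where "w'' = w' - vscale Q c b"
  have "inn Q b w'' = 0"
    using ab IH(3) Q.inn_self_eq_0[of b] unfolding w''_def c_def by (cases "inn Q b b = 0") auto
  then have "inn Q w'' b = 0"
    using ab IH(3) Q.inn_commute[of b w''] unfolding w''_def by simp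
  moreover have "inn Q w'' u = 0" if "u \<in> set (map snd ps)" for u
    using ab(3)[OF that] IH(3,4) that ab(2) unfolding w''_def by simp
  \<comment> \<open>The multiple of v \<otimes> b split off from v \<otimes> w' is absorbed by the
    left factor of b, so the list of right factors is unchanged.\<close>
  moreover have "tp v w + tsum (p # ps) = tp v w'' + tsum ((a + vscale P c v, b) # ps')"
  proof -
    have "tp v w' = tp v w'' + tensor_scale c (tp v b)"
      using ab IH(3) unfolding w''_def by (simp add: tp_diff_right tp_scale_right)
    moreover have "tp (a + vscale P c v) b = tp a b + tensor_scale c (tp v b)"
      using ab Cons.prems by (simp add: tp_add_left tp_scale_left)
    ultimately show ?thesis
      using IH(5) by (simp add: p add_ac)
  qed
  moreover have "w'' \<in> carr Q"
    unfolding w''_def using IH ab by simp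
  ultimately show ?case
    using IH ab Cons.prems by (intro exI[of _ "(a + vscale P c v, b) # ps'"] exI[of _ w'']) (auto simp: p)
qed

lemma orthogonal_decomp:
  assumes "f \<in> TC"
  shows "\<exists>ps. set ps \<subseteq> carr P \<times> carr Q \<and> sorted_wrt (\<lambda>w w'. inn Q w w' = 0) (map snd ps) \<and> f = tsum ps"
proof -
  have "\<exists>ps. set ps \<subseteq> carr P \<times> carr Q \<and> sorted_wrt (\<lambda>w w'. inn Q w w' = 0) (map snd ps) \<and> tsum qs = tsum ps"
    if "set qs \<subseteq> carr P \<times> carr Q" for qs
    using that
  proof (induction qs)
    case Nil
    then show ?case by (intro exI[of _ "[]"]) simp
  next
    case (Cons q qs)
    obtain v w where q: "q = (v, w)" by fastforce
    from Cons obtain ps where ps: "set ps \<subseteq> carr P \<times> carr Q" "sorted_wrt (\<lambda>w w'. inn Q w w' = 0) (map snd ps)"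
        "tsum qs = tsum ps"
      by auto
    from orthogonalize[OF ps(1,2), of v w] Cons.prems q obtain ps' w' where "map snd ps' = map snd ps"
        "set ps' \<subseteq> carr P \<times> carr Q" "w' \<in> carr Q" "\<forall>u\<in>set (map snd ps). inn Q w' u = 0"
        "tp v w + tsum ps = tp v w' + tsum ps'"
      by auto
    then show ?case
      using ps Cons.prems q by (intro exI[of _ "(v, w') # ps'"]) auto
  qed
  from this[OF tensor_decomp(1)[OF assms]] show ?thesis
    by (simp add: tensor_decomp(2)[OF assms])
qed

text \<open>For orthogonal right factors the cross terms vanish, and the square is a sum of products
  of squared norms.\<close>

lemma tinner_pos:
  assumes f: "f \<in> TC" "f \<noteq> 0"
  shows "Re (tinner f f) > 0"
proof -
  have "Re (tinner (tsum ps) (tsum ps)) \<ge> 0 \<and> (Re (tinner (tsum ps) (tsum ps)) = 0 \<longrightarrow> tsum ps = 0)"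
    if "set ps \<subseteq> carr P \<times> carr Q" "sorted_wrt (\<lambda>w w'. inn Q w w' = 0) (map snd ps)" for ps
    using that
  proof (induction ps)
    case Nil
    have "tinner 0 0 = 0"
      using tinner_tp[of 0 0 0] by (simp add: fun_apply)
    then show ?case by simp
  next
    case (Cons p ps)
    obtain v w where p: "p = (v, w)" by fastforce
    have vw: "v \<in> carr P" "w \<in> carr Q" "tsum ps \<in> TC"
      using Cons.prems p by (auto intro: tsum_TC)
    have "tsum ps (v, w) = 0"
      using Cons.prems vw(1,2) by (induction ps) (auto simp: p tp_apply fun_apply)
    then have "tinner (tsum (p # ps)) (tsum (p # ps)) = inn P v v * inn Q w w + tinner (tsum ps) (tsum ps)"
      using vw tinner_commute[of "tp v w" "tsum ps"]
      by (simp add: p tinner_add_left tinner_add_right tinner_tp tp_apply fun_apply)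
    moreover have "inn P v v * inn Q w w = complex_of_real (Re (inn P v v) * Re (inn Q w w))"
      unfolding of_real_mult using vw by (simp only: P.inn_self_real[symmetric] Q.inn_self_real[symmetric])
    ultimately have eq: "Re (tinner (tsum (p # ps)) (tsum (p # ps)))
        = Re (inn P v v) * Re (inn Q w w) + Re (tinner (tsum ps) (tsum ps))"
      by simp
    have nonneg: "Re (inn P v v) * Re (inn Q w w) \<ge> 0"
      using vw by (simp add: P.inn_self_nonneg Q.inn_self_nonneg)
    have IH: "Re (tinner (tsum ps) (tsum ps)) \<ge> 0" "Re (tinner (tsum ps) (tsum ps)) = 0 \<longrightarrow> tsum ps = 0"
      using Cons by auto
    have "tp v w = 0" if "Re (inn P v v) * Re (inn Q w w) = 0"
      using that vw P.inn_pos[of v] Q.inn_pos[of w] by fastforce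
    then show ?case
      using eq nonneg IH by (simp add: p add_nonneg_eq_0_iff)
  qed
  with orthogonal_decomp[OF f(1)] f(2) show ?thesis
    by fastforce
qed

end

lemma unitary_restrict:
  assumes V: "unitary_rep star V" and f: "\<And>j. star (f j) = f (star' j)"
  shows "unitary_rep star' (restrict_rep f V)"
proof -
  have "linear_rep (restrict_rep f V)"
    using V by (simp add: unitary_rep_def linear_rep_def linear_map_between_def restrict_rep_def)
  moreover have "inner_product (restrict_rep f V) = inner_product V"
    by (simp add: inner_product_def restrict_rep_def)
  ultimately show ?thesis
    using V by (simp add: unitary_rep_def f[symmetric]) (simp add: restrict_rep_def f)
qed

section \<open>The tensor product is a unitary highest weight representation\<close>

context tensor_pair
begin

lemma tinner_scale_left: "\<lbrakk>f \<in> TC; g \<in> TC\<rbrakk> \<Longrightarrow> tinner (tensor_scale c f) g = cnj c * tinner f g"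
  using tinner_commute[of g "tensor_scale c f"] tinner_commute[of g f] by (simp add: tinner_scale_right)

lemma tinner_adjoint:
  assumes A: "P.adj A A'" and B: "Q.adj B B'" and f: "f \<in> TC" and g: "g \<in> TC"
  shows "tinner (tensor_op P Q A B f) g = tinner f (tensor_op P Q A' B' g)"
  using f
proof (induction rule: TC_induct)
  case (pure v w)
  then show ?case
    using g by (simp add: tensor_op_tp[OF A B] tinner_tp P.adjD[OF A] Q.adjD[OF B]
        tensor_op_TC[OF P.adj_sym[OF A] Q.adj_sym[OF B]] tensor_op_apply[OF P.adj_sym[OF A] Q.adj_sym[OF B]])
next
  case (add f h)
  then show ?case
    using g by (simp add: tensor_op_add[OF A B] tinner_add_left tensor_op_TC[OF A B]
        tensor_op_TC[OF P.adj_sym[OF A] Q.adj_sym[OF B]])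
qed

end

locale boson_fock = fock_lie G F \<Omega> + R: star_rep affine_star R
  for G :: "('a::finite, 'g::ab_group_add) lie_data" and F :: "('a fermion, 'v::ab_group_add) prehilbert_rep"
    and \<Omega> :: 'v and R :: "('a affine, 'l::ab_group_add) prehilbert_rep" +
  assumes affine: "affine_relations G R"
begin

sublocale tensor_pair R F ..

abbreviation H :: "('a super, 'l \<times> 'v \<Rightarrow> complex) prehilbert_rep" where
  "H \<equiv> super_tensor G R F"

lemma adj_R: "R.adj (act R i) (act R (affine_star i))"
proof (rule R.adj_act)
  fix i :: "'a affine"
  show "affine_star (affine_star i) = i" by (cases i) auto
qed

lemma adj_F: "adj (act F i) (act F (fermion_star i))"
proof (rule adj_act)
  fix i :: "'a fermion"
  show "fermion_star (fermion_star i) = i" by (cases i) auto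
qed

lemma H_simps [simp]: "carr H = TC" "vscale H = tensor_scale" "inn H = tinner"
  by (simp_all add: super_tensor_def)

lemma act_Ferm: "act H (Ferm p) f = tensor_op R F id (act F p) f"
  by (simp add: super_tensor_def)

lemma act_Xmode: "act H (Bos (Xmode a n)) f = tensor_op R F (act R (Xmode a n)) id f + tensor_op R F id (S a n) f"
  by (simp add: super_tensor_def)

lemma act_Level: "act H (Bos Level) f = tensor_op R F (act R Level) id f + tensor_scale (complex_of_real (dual_cox G)) f"
  by (simp add: super_tensor_def)

lemma act_tp:
  assumes "v \<in> carr R" "w \<in> carr F"
  shows "act H (Ferm p) (tp v w) = tp v (act F p w)"
    and "act H (Bos (Xmode a n)) (tp v w) = tp (act R (Xmode a n) v) w + tp v (S a n w)"
    and "act H (Bos Level) (tp v w) = tp (act R Level v) w + tensor_scale (complex_of_real (dual_cox G)) (tp v w)"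
  using assms by (simp_all add: act_Ferm act_Xmode act_Level tensor_op_tp[OF adj_R adj_id]
      tensor_op_tp[OF R.adj_id adj_F] tensor_op_tp[OF R.adj_id adj_S])

lemma H_unitary: "unitary_rep super_star H"
proof -
  have lin_op: "linear_map_between H H (tensor_op R F A B)" if "R.adj A A'" "adj B B'" for A A' B B'
    using that by (simp add: linear_map_between_def tensor_op_TC tensor_op_add tensor_op_scale)
  have lin_sum: "linear_map_between H H (\<lambda>f. L f + M f)"
    if "linear_map_between H H L" "linear_map_between H H M" for L M
    using that by (simp add: linear_map_between_def T.scale_right_distrib)
  have lin_level: "linear_map_between H H (tensor_scale c)" for c
    by (simp add: linear_map_between_def T.scale_right_distrib mult.commute)
  have lin: "linear_map_between H H (act H i)" for i
  proof (cases i)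
    case (Bos x)
    show ?thesis
    proof (cases x)
      case (Xmode a n)
      have "act H i = (\<lambda>f. tensor_op R F (act R (Xmode a n)) id f + tensor_op R F id (S a n) f)"
        using act_Xmode Bos Xmode by blast
      then show ?thesis
        using lin_sum[OF lin_op[OF adj_R adj_id] lin_op[OF R.adj_id adj_S]] by simp
    next
      case Level
      have "act H i = (\<lambda>f. tensor_op R F (act R Level) id f + tensor_scale (complex_of_real (dual_cox G)) f)"
        using act_Level Bos Level by blast
      then show ?thesis
        using lin_sum[OF lin_op[OF adj_R adj_id] lin_level] by simp
    qed
  next
    case (Ferm p)
    have "act H i = tensor_op R F id (act F p)"
      using act_Ferm Ferm by blast
    then show ?thesis
      using lin_op[OF R.adj_id adj_F] by simp
  qed
  have adjoint: "tinner (act H i f) g = tinner f (act H (super_star i) g)" if "f \<in> TC" "g \<in> TC" for i f g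
  proof (cases i)
    case (Bos x)
    show ?thesis
    proof (cases x)
      case (Xmode a n)
      show ?thesis
        using that tinner_adjoint[OF adj_R adj_id that, of "Xmode a n"] tinner_adjoint[OF R.adj_id adj_S that, of a n]
          tensor_op_TC[OF adj_R adj_id] tensor_op_TC[OF R.adj_id adj_S]
        by (simp add: Bos Xmode act_Xmode tinner_add_left tinner_add_right)
    next
      case Level
      show ?thesis
        using that tinner_adjoint[OF adj_R adj_id that, of Level] tensor_op_TC[OF adj_R adj_id]
        by (simp add: Bos Level act_Level tinner_add_left tinner_add_right tinner_scale_left tinner_scale_right)
    qed
  next
    case (Ferm p)
    then show ?thesis
      using tinner_adjoint[OF R.adj_id adj_F that] by (simp add: act_Ferm)
  qed
  have "linear_rep H"
    using lin vector_space_tensor_scale subspace_TC by (simp add: linear_rep_def)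
  moreover have "inner_product H"
    unfolding inner_product_def H_simps
    by (intro conjI ballI allI impI) (fact tinner_add_right tinner_scale_right tinner_commute tinner_pos)+
  ultimately show ?thesis
    using adjoint by (simp add: unitary_rep_def)
qed

sublocale H: star_rep super_star H
  by unfold_locales (rule H_unitary)

lemmas act_H_simps = H.act_simps[unfolded H_simps]

lemma act_H_TC [simp]: "f \<in> TC \<Longrightarrow> act H i f \<in> TC"
  using H.act_carr[of f i] by simp

lemma R_commutator:
  assumes "v \<in> carr R"
  shows "act R (Xmode a m) (act R (Xmode b n) v) - act R (Xmode b n) (act R (Xmode a m) v)
      = vscale R \<i> (\<Sum>c\<in>UNIV. vscale R (complex_of_real (Gam G a b c)) (act R (Xmode c (m + n)) v))
        + (if a = b \<and> m + n = 0 then vscale R (of_int m) (act R Level v) else 0)"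
    and "act R Level (act R (Xmode a n) v) - act R (Xmode a n) (act R Level v) = 0"
  using assms affine unfolding affine_relations_def by blast+

text \<open>On a pure tensor the mixed terms cancel, leaving the commutators in the two factors,
  whose central terms add up to the action of \<open>Level\<close>.\<close>

lemma H_affine: "affine_relations G (restrict_rep Bos H)"
proof -
  let ?X = "\<lambda>a n. act H (Bos (Xmode a n))"
  have "?X a m (?X b n f) - ?X b n (?X a m f)
      = tensor_scale \<i> (\<Sum>c\<in>UNIV. tensor_scale (complex_of_real (Gam G a b c)) (?X c (m + n) f))
        + (if a = b \<and> m + n = 0 then tensor_scale (of_int m) (act H (Bos Level) f) else 0)"
    if "f \<in> TC" for a b m n f
    using that
  proof (induction rule: TC_induct)
    case (pure v w)
    have "?X a m (?X b n (tp v w)) - ?X b n (?X a m (tp v w))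
        = tp (act R (Xmode a m) (act R (Xmode b n) v) - act R (Xmode b n) (act R (Xmode a m) v)) w
          + tp v (S a m (S b n w) - S b n (S a m w))"
      using pure by (simp add: act_tp act_H_simps tp_diff_left tp_diff_right)
    then show ?case
      using pure by (simp add: R_commutator S_S act_tp tp_add_left tp_add_right tp_scale_left tp_scale_right
          tp_sum_left tp_sum_right T.scale_right_distrib sum.distrib add_ac)
  next
    case (add f g)
    then show ?case
      by (simp add: act_H_simps T.scale_right_distrib sum.distrib add_diff_add)
  qed
  moreover have "act H (Bos Level) (?X a n f) - ?X a n (act H (Bos Level) f) = 0" if "f \<in> TC" for a n f
    using that
  proof (induction rule: TC_induct)
    case (pure v w)
    then show ?case
      using R_commutator(2)[of v a n] by (simp add: act_tp act_H_simps T.scale_right_distrib)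
  next
    case (add f g)
    then show ?case
      by (simp add: act_H_simps)
  qed
  ultimately show ?thesis
    by (simp add: affine_relations_def restrict_rep_def)
qed

lemma H_fermion: "fermion_relations (restrict_rep Ferm H)"
proof -
  let ?p = "\<lambda>a n. act H (Ferm (Psi a n))"
  have "?p a m (?p b n f) + ?p b n (?p a m f) = (if a = b \<and> m + n + 1 = 0 then f else 0)"
    if "f \<in> TC" for a b m n f
    using that
  proof (induction rule: TC_induct)
    case (pure v w)
    then show ?case
      by (simp add: act_tp anticommute[of w a m b n] tp_diff_right)
  next
    case (add f g)
    have "?p a m (?p b n (f + g)) + ?p b n (?p a m (f + g))
        = (?p a m (?p b n f) + ?p b n (?p a m f)) + (?p a m (?p b n g) + ?p b n (?p a m g))"
      using add.hyps by (simp add: act_H_simps add_ac)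
    then show ?case
      unfolding add.IH by simp
  qed
  then show ?thesis
    by (simp add: fermion_relations_def restrict_rep_def)
qed

lemma H_mixed:
  assumes "f \<in> TC"
  shows "act H (Bos (Xmode a m)) (act H (Ferm (Psi b n)) f) - act H (Ferm (Psi b n)) (act H (Bos (Xmode a m)) f)
      = tensor_scale \<i> (\<Sum>c\<in>UNIV. tensor_scale (complex_of_real (Gam G a b c)) (act H (Ferm (Psi c (m + n))) f))"
    and "act H (Bos Level) (act H (Ferm (Psi b n)) f) - act H (Ferm (Psi b n)) (act H (Bos Level) f) = 0"
proof -
  show "act H (Bos (Xmode a m)) (act H (Ferm (Psi b n)) f) - act H (Ferm (Psi b n)) (act H (Bos (Xmode a m)) f)
      = tensor_scale \<i> (\<Sum>c\<in>UNIV. tensor_scale (complex_of_real (Gam G a b c)) (act H (Ferm (Psi c (m + n))) f))"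
    using assms
  proof (induction rule: TC_induct)
    case (pure v w)
    then have "act H (Bos (Xmode a m)) (act H (Ferm (Psi b n)) (tp v w))
        - act H (Ferm (Psi b n)) (act H (Bos (Xmode a m)) (tp v w)) = tp v (S a m (psi b n w) - psi b n (S a m w))"
      by (simp add: act_tp act_H_simps tp_diff_right)
    with pure show ?case
      by (simp add: S_psi act_tp tp_scale_right tp_sum_right)
  next
    case (add f g)
    then show ?case
      by (simp add: act_H_simps T.scale_right_distrib sum.distrib add_diff_add)
  qed
  show "act H (Bos Level) (act H (Ferm (Psi b n)) f) - act H (Ferm (Psi b n)) (act H (Bos Level) f) = 0"
    using assms
  proof (induction rule: TC_induct)
    case (pure v w)
    then show ?case
      by (simp add: act_tp act_H_simps)
  next
    case (add f g)
    then show ?case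
      by (simp add: act_H_simps)
  qed
qed

lemma H_super: "super_relations G H"
  using H_affine H_fermion H_mixed by (simp add: super_relations_def)

lemma H_fermi_rep: "fermi_rep (restrict_rep Ferm H)"
proof
  show "unitary_rep fermion_star (restrict_rep Ferm H)"
    using H_unitary by (rule unitary_restrict) simp
  interpret f: star_rep fermion_star "restrict_rep Ferm H"
    by unfold_locales fact
  show "fermion_relations (restrict_rep Ferm H)" by (rule H_fermion)
  fix f assume "f \<in> carr (restrict_rep Ferm H)"
  then have "f \<in> TC" by (simp add: restrict_rep_def)
  then have "f \<in> {f \<in> carr (restrict_rep Ferm H). fermion_bounded (restrict_rep Ferm H) f}"
  proof (induction rule: TC_induct)
    case (pure v w)
    then obtain N where "\<And>a n. n \<ge> N \<Longrightarrow> psi a n w = 0"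
      using locally_finite by blast
    then have "\<forall>a n. n \<ge> N \<longrightarrow> act H (Ferm (Psi a n)) (tp v w) = 0"
      using pure by (simp add: act_tp)
    with pure show ?case
      by (auto simp: restrict_rep_def fermion_bounded_def)
  next
    case (add f g)
    then show ?case
      using f.subspace_add[OF f.subspace_fermion_bounded[OF refl refl f.lin_act]] by blast
  qed
  then show "\<exists>N. \<forall>a n. n \<ge> N \<longrightarrow> act (restrict_rep Ferm H) (Psi a n) f = 0"
    by (simp add: fermion_bounded_def)
qed

text \<open>The value of f at \<open>(x, psi a n y)\<close> with n < 0 is that of an annihilation
  operator applied to f, hence 0. So f is determined by its contraction v with \<Omega>.\<close>

lemma vacuum_is_pure:
  assumes f: "f \<in> TC" and vac: "\<And>a n. n \<ge> 0 \<Longrightarrow> act H (Ferm (Psi a n)) f = 0"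
  obtains v where "v \<in> carr R" "f = tp v \<Omega>"
proof -
  obtain v where v: "v \<in> carr R" "\<And>x. x \<in> carr R \<Longrightarrow> f (x, \<Omega>) = inn R x v"
    using TC_section[OF f Omega_carr] by blast
  have "f (x, y) = inn R x v * inn F y \<Omega>" if x: "x \<in> carr R" and y: "y \<in> carr F" for x y
    using y
  proof (induction rule: fock_induct)
    case vac
    then show ?case using x by (simp add: v unit)
  next
    case (create a n y)
    have "f (x, psi a n y) = act H (Ferm (Psi a (- n - 1))) f (x, y)"
      using tensor_op_apply[OF R.adj_id adj_F f x create(1), of "Psi a (- n - 1)"] by (simp add: act_Ferm)
    also have "\<dots> = 0"
      using vac[of "- n - 1" a] create by (simp add: fun_apply)
    finally show ?case
      using create by (simp add: adjoint_psi annihilated)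
  next
    case (add y z)
    then show ?case using x by (simp add: TC_add_snd[OF f] algebra_simps)
  next
    case (scale y c)
    then show ?case using x by (simp add: TC_scale_snd[OF f])
  qed
  then have "f = tp v \<Omega>"
    using f v(1) by (intro TC_ext) (simp_all add: tp_apply)
  with v(1) that show thesis by blast
qed

text \<open>
  A nonzero invariant subspace contains a nonzero vacuum vector; being a pure tensor \<open>v \<otimes> \<Omega>\<close>, it generates
  everything by the irreducibility of \<open>R\<close> and the cyclicity of \<open>\<Omega>\<close>.
\<close>

lemma H_irreducible:
  assumes R: "irreducible_rep R"
  shows "irreducible_rep H"
  unfolding irreducible_rep_def
proof (intro conjI allI impI)
  obtain v where "v \<in> carr R" "v \<noteq> 0"
    using R R.carr_zero unfolding irreducible_rep_def by blast
  then have "tp v \<Omega> (v, \<Omega>) \<noteq> 0"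
    using R.inn_self_eq_0[of v] by (auto simp: tp_apply unit)
  then have "tp v \<Omega> \<noteq> 0" "tp v \<Omega> \<in> carr H"
    using \<open>v \<in> carr R\<close> by (auto simp: fun_apply)
  then show "carr H \<noteq> {0}"
    by auto
next
  fix W assume W: "invariant_subspace H W"
  have sub: "T.subspace W" "W \<subseteq> TC" and act: "\<And>i w. w \<in> W \<Longrightarrow> act H i w \<in> W"
    using W by (auto simp: invariant_subspace_def)
  show "W = {0} \<or> W = carr H"
  proof (cases "W = {0}")
    case False
    then obtain w where w: "w \<in> W" "w \<noteq> 0"
      using T.subspace_0[OF sub(1)] by blast
    interpret f: fermi_rep "restrict_rep Ferm H" by (rule H_fermi_rep)
    obtain u where u: "u \<in> W" "u \<in> f.vac" "u \<noteq> 0"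
      using f.vac_exists[of W w] w sub act by (auto simp: restrict_rep_def)
    have "\<And>a n. n \<ge> 0 \<Longrightarrow> act H (Ferm (Psi a n)) u = 0"
      using f.vacD[OF u(2)] by (simp add: restrict_rep_def)
    then obtain v where v: "v \<in> carr R" "u = tp v \<Omega>"
      using vacuum_is_pure[of u] u sub by blast
    have extend: "tp v y \<in> W" if v: "v \<in> carr R" and vW: "tp v \<Omega> \<in> W" and y: "y \<in> carr F" for v y
      using y
    proof (induction rule: fock_induct)
      case (create a n y)
      then show ?case using act[of "tp v y" "Ferm (Psi a n)"] v by (simp add: act_tp)
    next
      case (add y z)
      then show ?case using v by (simp add: tp_add_right T.subspace_add[OF sub(1)])
    next
      case (scale y c)
      then show ?case using v by (simp add: tp_scale_right T.subspace_scale[OF sub(1)])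
    qed (rule vW)
    define M where "M = {v \<in> carr R. tp v \<Omega> \<in> W}"
    have "invariant_subspace R M"
      unfolding invariant_subspace_def
    proof (intro conjI allI ballI)
      show "R.subspace M"
        unfolding M_def by (rule R.subspaceI)
          (auto simp: tp_add_left tp_scale_left T.subspace_0[OF sub(1)] T.subspace_add[OF sub(1)] T.subspace_scale[OF sub(1)])
      fix i v assume "v \<in> M"
      then have v: "v \<in> carr R" "tp v \<Omega> \<in> W" by (auto simp: M_def)
      have "tp (act R i v) \<Omega> \<in> W"
      proof (cases i)
        case (Xmode a n)
        \<comment> \<open>The correction stays in W by \<open>extend\<close>, because
          \<open>S a n \<Omega>\<close> is again a Fock vector.\<close>
        have "tp (act R i v) \<Omega> = act H (Bos (Xmode a n)) (tp v \<Omega>) - tp v (S a n \<Omega>)"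
          using v by (simp add: act_tp Xmode)
        then show ?thesis
          using T.subspace_diff[OF sub(1) act[OF v(2)] extend[OF v]] by simp
      next
        case Level
        have "tp (act R i v) \<Omega> = act H (Bos Level) (tp v \<Omega>) - tensor_scale (complex_of_real (dual_cox G)) (tp v \<Omega>)"
          using v by (simp add: act_tp Level)
        then show ?thesis
          using T.subspace_diff[OF sub(1) act[OF v(2)] T.subspace_scale[OF sub(1) v(2)]] by simp
      qed
      then show "act R i v \<in> M"
        using v by (simp add: M_def)
    qed (auto simp: M_def)
    moreover have "v \<in> M" "v \<noteq> 0"
      using u v by (auto simp: M_def)
    ultimately have "M = carr R"
      using R unfolding irreducible_rep_def by blast
    then have "tp v y \<in> W" if "v \<in> carr R" "y \<in> carr F" for v y
      using extend[of v y] that by (auto simp: M_def)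
    note pure = this
    have "f \<in> W" if "f \<in> TC" for f
      using that by (induction rule: TC_induct) (auto intro: pure T.subspace_add[OF sub(1)])
    with sub show ?thesis by auto
  qed simp
qed

text \<open>The currents \<open>S\<close> with nonnegative modes kill \<Omega>, so v \<otimes>
  \<Omega> inherits its weight and the highest weight conditions from v.\<close>

lemma unitary_hw_super_tensor:
  assumes R: "unitary_hw_affine_rep G R"
  shows "unitary_hw_super_rep G H"
proof -
  have irr: "irreducible_rep H"
    using R by (intro H_irreducible) (simp add: unitary_hw_affine_rep_def)
  obtain v lam where v: "highest_weight_vector G (zero_modes G R) lam v" "\<And>a n. n > 0 \<Longrightarrow> act R (Xmode a n) v = 0"
    using R unfolding unitary_hw_affine_rep_def by blast
  have vc: "v \<in> carr R" "v \<noteq> 0" and lam: "lam \<in> cartan G"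
    using v(1) by (auto simp: highest_weight_vector_def zero_modes_def)
  let ?u = "tp v \<Omega>"
  have "?u (v, \<Omega>) \<noteq> 0"
    using vc R.inn_self_eq_0[of v] by (auto simp: tp_apply unit)
  then have u: "?u \<noteq> 0"
    by (auto simp: fun_apply)
  have zero: "act (zero_modes G (restrict_rep Bos H)) x ?u = tp (act (zero_modes G R) x v) \<Omega>" for x
    using vc by (simp add: zero_modes_def restrict_rep_def act_tp S_Omega tp_sum_left tp_scale_left)
  have "highest_weight_vector G (zero_modes G (restrict_rep Bos H)) lam ?u"
    using v(1) u vc unfolding highest_weight_vector_def zero
    by (auto simp: zero_modes_def restrict_rep_def tp_scale_left)
  moreover have "cyclic_vector H ?u"
    using irr u vc unfolding cyclic_vector_def irreducible_rep_def by auto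
  moreover have "\<forall>a n. n > 0 \<longrightarrow> act H (Bos (Xmode a n)) ?u = 0"
    using vc v(2) by (simp add: act_tp S_Omega)
  moreover have "\<forall>a n. n \<ge> 0 \<longrightarrow> act H (Ferm (Psi a n)) ?u = 0"
    using vc by (simp add: act_tp annihilated)
  ultimately show ?thesis
    using irr H_unitary H_super unfolding unitary_hw_super_rep_def by blast
qed

end

section \<open>Splitting off the Fock space\<close>

locale fock_module = F: fock F \<Omega> + M: fermi_rep M
  for F :: "('a fermion, 'f::ab_group_add) prehilbert_rep" and \<Omega> :: 'f
    and M :: "('a fermion, 'h::ab_group_add) prehilbert_rep"
begin

text \<open>The graph, in \<open>(y, h)\<close>, of the homomorphism from the Fock space to \<open>M\<close> mapping \<open>\<Omega>\<close> to \<open>x\<close>.\<close>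

inductive graph :: "'h \<Rightarrow> 'f \<Rightarrow> 'h \<Rightarrow> bool" where
  vac: "x \<in> M.vac \<Longrightarrow> graph x \<Omega> x"
| create: "\<lbrakk>graph x y h; n < 0\<rbrakk> \<Longrightarrow> graph x (F.psi a n y) (M.psi a n h)"
| add: "\<lbrakk>graph x y h; graph x y' h'\<rbrakk> \<Longrightarrow> graph x (y + y') (h + h')"
| scale: "graph x y h \<Longrightarrow> graph x (vscale F c y) (vscale M c h)"

lemma graph_carr: "graph x y h \<Longrightarrow> x \<in> M.vac \<and> y \<in> carr F \<and> h \<in> carr M"
  by (induction rule: graph.induct) (auto intro: M.vac_carr)

lemma graph_zero: "x \<in> M.vac \<Longrightarrow> graph x 0 0"
  using graph.scale[OF graph.vac, of x 0] by simp

lemma graph_diff: "\<lbrakk>graph x y h; graph x y' h'\<rbrakk> \<Longrightarrow> graph x (y - y') (h - h')"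
  using graph.add[OF _ graph.scale[of x y' h' "- 1"], of y h] by simp

lemma graph_annihilate: "\<lbrakk>graph x y h; n \<ge> 0\<rbrakk> \<Longrightarrow> graph x (F.psi a n y) (M.psi a n h)"
proof (induction rule: graph.induct)
  case (vac x)
  then show ?case by (simp add: F.annihilated M.vacD graph_zero)
next
  case (create x y h m b)
  have c: "x \<in> M.vac" "y \<in> carr F" "h \<in> carr M"
    using graph_carr[OF create.hyps(1)] by auto
  have "graph x (F.psi b m (F.psi a n y)) (M.psi b m (M.psi a n h))"
    by (rule graph.create[OF create.IH[OF create.prems] create.hyps(2)])
  then show ?case
    using create.hyps c graph_diff[OF create.hyps(1)] graph_diff[OF graph_zero]
    unfolding F.anticommute[OF c(2), of a n b m] M.anticommute[OF c(3), of a n b m]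
    by (cases "a = b \<and> n + m + 1 = 0") auto
next
  case (add x y h y' h')
  then show ?case
    using graph_carr[OF add.hyps(1)] graph_carr[OF add.hyps(2)]
    by (simp add: F.act_simps M.act_simps graph.add)
next
  case (scale x y h c)
  then show ?case
    using graph_carr[OF scale.hyps] by (simp add: F.act_simps M.act_simps graph.scale)
qed

lemma graph_psi: "graph x y h \<Longrightarrow> graph x (F.psi a n y) (M.psi a n h)"
  by (cases "n < 0") (auto intro: graph.create graph_annihilate)

text \<open>A creation operator on the left is moved as an annihilation operator to the right, where
  \<open>graph_psi\<close> follows it in both components. This isometry property is what makes the
  relation single-valued.\<close>

lemma graph_inner:
  assumes "graph x y h" "graph x' y' h'"
  shows "inn M h h' = inn M x x' * inn F y y'"
  using assms
proof (induction arbitrary: y' h' rule: graph.induct)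
  case (vac x)
  have x: "x \<in> carr M" using vac.hyps by (rule M.vac_carr)
  from vac.prems vac.hyps show ?case
  proof (induction rule: graph.induct)
    case (vac x')
    then show ?case by (simp add: F.unit)
  next
    case (create x' y h n a)
    then show ?case
      using graph_carr[OF create.hyps(1)] M.adjoint_psi[OF x, of h a "- n - 1"]
        F.adjoint_psi[of \<Omega> y a "- n - 1"]
      by (simp add: M.vacD F.annihilated)
  next
    case (add x' y h y' h')
    then show ?case
      using graph_carr[OF add.hyps(1)] graph_carr[OF add.hyps(2)] x by (simp add: algebra_simps)
  next
    case (scale x' y h c)
    then show ?case
      using graph_carr[OF scale.hyps] x by simp
  qed
next
  case (create x y h n a)
  have "inn M h (M.psi a (- n - 1) h') = inn M x x' * inn F y (F.psi a (- n - 1) y')"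
    by (rule create.IH) (rule graph_psi[OF create.prems])
  then show ?case
    using graph_carr[OF create.hyps(1)] graph_carr[OF create.prems] by (simp add: M.adjoint_psi F.adjoint_psi)
next
  case (add x y h z k)
  then show ?case
    using graph_carr[OF add.hyps(1)] graph_carr[OF add.hyps(2)] graph_carr[OF add.prems] by (simp add: algebra_simps)
next
  case (scale x y h c)
  then show ?case
    using graph_carr[OF scale.hyps] graph_carr[OF scale.prems] by simp
qed

lemma graph_unique:
  assumes "graph x y h" "graph x y k"
  shows "h = k"
proof -
  have "graph x 0 (h - k)"
    using graph_diff[OF assms] by simp
  then have "inn M (h - k) (h - k) = 0"
    using graph_inner[of x 0 "h - k" x 0 "h - k"] by simp
  then show ?thesis
    using M.inn_self_eq_0[of "h - k"] graph_carr[OF assms(1)] graph_carr[OF assms(2)] by simp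
qed

lemma graph_total:
  assumes "y \<in> carr F" "x \<in> M.vac"
  shows "\<exists>h. graph x y h"
  using assms(1) by (induction rule: F.fock_induct) (use assms(2) graph.intros in blast)+

text \<open>Under the identification to be proved, the pure tensor of x and y.\<close>

definition mu :: "'h \<Rightarrow> 'f \<Rightarrow> 'h" where
  "mu x y = (THE h. graph x y h)"

lemma graph_mu: "\<lbrakk>x \<in> M.vac; y \<in> carr F\<rbrakk> \<Longrightarrow> graph x y (mu x y)"
  unfolding mu_def using graph_total graph_unique by (metis theI)

lemma mu_eq: "graph x y h \<Longrightarrow> mu x y = h"
  using graph_carr graph_mu graph_unique by blast

lemma mu_carr [simp]: "\<lbrakk>x \<in> M.vac; y \<in> carr F\<rbrakk> \<Longrightarrow> mu x y \<in> carr M"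
  using graph_mu graph_carr by blast

lemma mu_Omega [simp]: "x \<in> M.vac \<Longrightarrow> mu x \<Omega> = x"
  by (rule mu_eq) (rule graph.vac)

lemma mu_psi: "\<lbrakk>x \<in> M.vac; y \<in> carr F\<rbrakk> \<Longrightarrow> mu x (F.psi a n y) = M.psi a n (mu x y)"
  by (intro mu_eq graph_psi graph_mu)

lemma mu_add_right: "\<lbrakk>x \<in> M.vac; y \<in> carr F; z \<in> carr F\<rbrakk> \<Longrightarrow> mu x (y + z) = mu x y + mu x z"
  by (intro mu_eq graph.add graph_mu)

lemma mu_scale_right: "\<lbrakk>x \<in> M.vac; y \<in> carr F\<rbrakk> \<Longrightarrow> mu x (vscale F c y) = vscale M c (mu x y)"
  by (intro mu_eq graph.scale graph_mu)

lemma mu_linear: "x \<in> M.vac \<Longrightarrow> linear_map_between F M (mu x)"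
  by (simp add: linear_map_between_def mu_add_right mu_scale_right)

lemma mu_inner:
  "\<lbrakk>x \<in> M.vac; y \<in> carr F; x' \<in> M.vac; y' \<in> carr F\<rbrakk> \<Longrightarrow> inn M (mu x y) (mu x' y') = inn M x x' * inn F y y'"
  by (intro graph_inner graph_mu)

lemma mu_commute:
  assumes T: "M.lin T" "\<And>a n h. h \<in> carr M \<Longrightarrow> T (M.psi a n h) = M.psi a n (T h)"
    and x: "x \<in> M.vac" "T x \<in> M.vac" and y: "y \<in> carr F"
  shows "T (mu x y) = mu (T x) y"
  using y
  by (induction rule: F.fock_induct)
    (use T x in \<open>simp_all add: mu_psi mu_add_right mu_scale_right M.lin_add M.lin_scale\<close>)

end

lemma restrict_rep_simps [simp]:
  "carr (restrict_rep f V) = carr V" "vscale (restrict_rep f V) = vscale V"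
  "act (restrict_rep f V) j = act V (f j)" "inn (restrict_rep f V) = inn V"
  by (simp_all add: restrict_rep_def)

section \<open>The operators commuting with the fermions in a highest weight representation\<close>

locale super_rep = fock_lie G F \<Omega> + H: star_rep super_star H
  for G :: "('a::finite, 'g::ab_group_add) lie_data" and F :: "('a fermion, 'f::ab_group_add) prehilbert_rep"
    and \<Omega> :: 'f and H :: "('a super, 'h::ab_group_add) prehilbert_rep" +
  fixes v\<^sub>0 :: 'h and lam :: 'g
  assumes super: "super_relations G H" and irreducible: "irreducible_rep H" and cyclic_v0: "cyclic_vector H v\<^sub>0"
    and hw: "highest_weight_vector G (zero_modes G (restrict_rep Bos H)) lam v\<^sub>0"
    and v0_raise: "n > 0 \<Longrightarrow> act H (Bos (Xmode a n)) v\<^sub>0 = 0"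
    and v0_annihilate: "n \<ge> 0 \<Longrightarrow> act H (Ferm (Psi a n)) v\<^sub>0 = 0"
begin

abbreviation HF :: "('a fermion, 'h) prehilbert_rep" where
  "HF \<equiv> restrict_rep Ferm H"

abbreviation B :: "'a \<Rightarrow> int \<Rightarrow> 'h \<Rightarrow> 'h" where
  "B a n \<equiv> act H (Bos (Xmode a n))"

abbreviation Z :: "'h \<Rightarrow> 'h" where
  "Z \<equiv> act H (Bos Level)"

abbreviation p :: "'a \<Rightarrow> int \<Rightarrow> 'h \<Rightarrow> 'h" where
  "p a n \<equiv> act H (Ferm (Psi a n))"

lemma B_B: "h \<in> carr H \<Longrightarrow> B a m (B b n h) - B b n (B a m h)
    = vscale H \<i> (\<Sum>c\<in>UNIV. vscale H (complex_of_real (Gam G a b c)) (B c (m + n) h))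
      + (if a = b \<and> m + n = 0 then vscale H (of_int m) (Z h) else 0)"
  and Z_B: "h \<in> carr H \<Longrightarrow> Z (B a n h) = B a n (Z h)"
  and B_p: "h \<in> carr H \<Longrightarrow> B a m (p b n h) - p b n (B a m h)
    = vscale H \<i> (\<Sum>c\<in>UNIV. vscale H (complex_of_real (Gam G a b c)) (p c (m + n) h))"
  and Z_p: "h \<in> carr H \<Longrightarrow> Z (p a n h) = p a n (Z h)"
  using super by (simp_all add: super_relations_def affine_relations_def)

lemma HF_unitary: "unitary_rep fermion_star HF"
  using H.unitary by (rule unitary_restrict) simp

lemma HF_relations: "fermion_relations HF"
  using super by (simp add: super_relations_def)

lemma HF_fermi_rep: "fermi_rep HF"
proof
  show "unitary_rep fermion_star HF" by (rule HF_unitary)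
  interpret f: star_rep fermion_star HF by unfold_locales (rule HF_unitary)
  show "fermion_relations HF" by (rule HF_relations)
  let ?W = "{h \<in> carr H. fermion_bounded HF h}"
  have sub: "H.subspace ?W"
    using f.subspace_fermion_bounded[OF refl refl f.lin_act] by simp
  have "invariant_subspace H ?W"
    unfolding invariant_subspace_def
  proof (intro conjI allI ballI sub)
    fix i h assume "h \<in> ?W"
    then have h: "h \<in> carr H" "fermion_bounded HF h" by auto
    obtain N where N: "\<And>a n. n \<ge> N \<Longrightarrow> p a n h = 0"
      using h(2) by (auto simp: fermion_bounded_def)
    have "fermion_bounded HF (act H i h)"
    proof (cases i)
      case (Bos x)
      show ?thesis
      proof (cases x)
        case (Xmode b m)
        \<comment> \<open>The commutator produces the mode m + n, so both n and m + n have to reach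
          N.\<close>
        have "p a n (B b m h) = 0" if "n \<ge> max N (N - m)" for a n
          using B_p[OF h(1), of b m a n] that N by (simp add: H.act_simps)
        then show ?thesis
          unfolding fermion_bounded_def Bos Xmode by (auto intro!: exI[of _ "max N (N - m)"])
      next
        case Level
        then show ?thesis
          using N h(1) unfolding fermion_bounded_def Bos by (auto simp: H.act_simps intro!: exI[of _ N] simp flip: Z_p)
      qed
    next
      case (Ferm q)
      then obtain b m where "i = Ferm (Psi b m)" by (cases q) auto
      then show ?thesis
        using fermion_bounded_psi[OF f.star_rep_axioms HF_relations _ h(2), of b m] h(1) by simp
    qed
    then show "act H i h \<in> ?W"
      using h(1) by simp
  qed auto
  moreover have "v\<^sub>0 \<in> ?W"
    using cyclic_v0 v0_annihilate by (auto simp: cyclic_vector_def fermion_bounded_def)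
  ultimately have "?W = carr H"
    using cyclic_v0 unfolding cyclic_vector_def by blast
  then show "\<exists>N. \<forall>a n. n \<ge> N \<longrightarrow> act HF (Psi a n) h = 0" if "h \<in> carr HF" for h
    using that by (auto simp: fermion_bounded_def)
qed

sublocale M: fermi_lie G HF
  using simple_lie_data_axioms HF_fermi_rep by (rule fermi_lie.intro)

sublocale fock_module F \<Omega> HF ..

abbreviation H0 :: "'h set" where "H0 \<equiv> M.vac"

lemma H0_carr: "x \<in> H0 \<Longrightarrow> x \<in> carr H"
  using M.vac_carr by simp

lemma v0_H0: "v\<^sub>0 \<in> H0"
  using cyclic_v0 v0_annihilate by (simp add: M.vac_def cyclic_vector_def)

definition X :: "'a \<Rightarrow> int \<Rightarrow> 'h \<Rightarrow> 'h" where
  "X a n h = B a n h - M.S a n h"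

definition L :: "'h \<Rightarrow> 'h" where
  "L h = Z h - vscale H (complex_of_real (dual_cox G)) h"

lemma lin_S_H: "H.lin (M.S a n)"
  using M.lin_S[of a n] by (simp add: linear_map_between_def)

lemma lin_X: "H.lin (X a n)"
  unfolding X_def[abs_def] by (rule H.lin_diffI[OF H.lin_act lin_S_H])

lemma lin_L: "H.lin L"
  unfolding L_def[abs_def] by (rule H.lin_diffI[OF H.lin_act H.lin_scaleI[OF H.lin_idI]])

lemma X_p: "h \<in> carr H \<Longrightarrow> X a m (p b n h) = p b n (X a m h)"
  using B_p[of h a m b n] M.S_psi[of h a m b n]
  by (simp add: X_def H.act_simps H.lin_carr[OF lin_S_H] algebra_simps)

lemma L_p: "h \<in> carr H \<Longrightarrow> L (p b n h) = p b n (L h)"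
  by (simp add: L_def Z_p H.act_simps)

lemma commute_vac:
  assumes "H.lin T" "\<And>a n h. h \<in> carr H \<Longrightarrow> T (p a n h) = p a n (T h)" "x \<in> H0"
  shows "T x \<in> H0"
  using assms by (auto simp: M.vac_def H.lin_zero simp flip: assms(2))

lemma X_H0: "x \<in> H0 \<Longrightarrow> X a n x \<in> H0"
  using lin_X X_p by (rule commute_vac)

lemma L_H0: "x \<in> H0 \<Longrightarrow> L x \<in> H0"
  using lin_L L_p by (rule commute_vac)

lemma lin_HF: "linear_map_between HF HF T \<longleftrightarrow> H.lin T"
  by (simp add: linear_map_between_def)

lemma X_mu: "\<lbrakk>x \<in> H0; y \<in> carr F\<rbrakk> \<Longrightarrow> X a n (mu x y) = mu (X a n x) y"
  by (rule mu_commute) (simp_all add: lin_HF lin_X X_p X_H0)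

lemma L_mu: "\<lbrakk>x \<in> H0; y \<in> carr F\<rbrakk> \<Longrightarrow> L (mu x y) = mu (L x) y"
  by (rule mu_commute) (simp_all add: lin_HF lin_L L_p L_H0)

lemma S_mu: "\<lbrakk>x \<in> H0; y \<in> carr F\<rbrakk> \<Longrightarrow> M.S a n (mu x y) = mu x (S a n y)"
  by (rule S_mode_intertwine[OF fermi_lie_axioms M.fermi_lie_axioms mu_linear, symmetric])
    (simp_all add: mu_psi)

lemma S_commute:
  assumes "H.lin T" "\<And>a n h. h \<in> carr H \<Longrightarrow> T (p a n h) = p a n (T h)" "h \<in> carr H"
  shows "T (M.S a n h) = M.S a n (T h)"
  by (rule S_mode_intertwine[OF M.fermi_lie_axioms M.fermi_lie_axioms]) (use assms in \<open>simp_all add: lin_HF\<close>)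

lemma act_mu:
  assumes "x \<in> H0" "y \<in> carr F"
  shows "p a n (mu x y) = mu x (psi a n y)"
    and "B a n (mu x y) = mu (X a n x) y + mu x (S a n y)"
    and "Z (mu x y) = mu (L x) y + vscale H (complex_of_real (dual_cox G)) (mu x y)"
  using assms mu_psi[OF assms] X_mu[OF assms, of a n] L_mu[OF assms] S_mu[OF assms, of a n]
  by (simp_all add: X_def[of a n "mu x y"] L_def[of "mu x y"] flip: diff_eq_eq)

text \<open>Stated for a general W: for \<open>H0\<close> it shows that the vectors
  \<open>mu x y\<close> span, for an invariant subspace of R it transfers irreducibility from H to
  R.\<close>

lemma mu_span_invariant:
  assumes W: "H.subspace W" "W \<subseteq> H0" "\<And>a n w. w \<in> W \<Longrightarrow> X a n w \<in> W" "\<And>w. w \<in> W \<Longrightarrow> L w \<in> W"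
  shows "invariant_subspace H (H.span {mu x y | x y. x \<in> W \<and> y \<in> carr F})" (is "invariant_subspace H (H.span ?S)")
  unfolding invariant_subspace_def
proof (intro conjI allI ballI)
  have SH: "?S \<subseteq> carr H"
    using W(2) mu_carr by auto
  then show SpH: "H.span ?S \<subseteq> carr H"
    by (rule H.span_subset_carr)
  have base: "mu x y \<in> H.span ?S" if "x \<in> W" "y \<in> carr F" for x y
    using that by (intro H.span_base) auto
  fix i h assume "h \<in> H.span ?S"
  then have "h \<in> carr H \<and> act H i h \<in> H.span ?S"
  proof (induction rule: H.span_induct_alt)
    case base
    then show ?case by (simp add: H.act_simps H.span_zero)
  next
    case (step c h k)
    then obtain x y where xy: "h = mu x y" "x \<in> W" "y \<in> carr F" by blast
    then have x: "x \<in> H0" using W(2) by blast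
    have "act H i h \<in> H.span ?S"
    proof (cases i)
      case (Bos z)
      show ?thesis
      proof (cases z)
        case (Xmode a n)
        then show ?thesis
          using xy x W(3) by (simp add: Bos act_mu base H.span_add)
      next
        case Level
        then show ?thesis
          using xy x W(4) by (simp add: Bos act_mu base H.span_add H.span_scale)
      qed
    next
      case (Ferm q)
      then obtain a n where "i = Ferm (Psi a n)" by (cases q) auto
      then show ?thesis
        using xy x by (simp add: act_mu base)
    qed
    moreover have "h \<in> carr H"
      using step.hyps SH by auto
    ultimately show ?case
      using step.IH by (simp add: H.act_simps H.span_add H.span_scale)
  qed
  then show "act H i h \<in> H.span ?S" ..
qed simp

lemma mu_span: "H.span {mu x y | x y. x \<in> H0 \<and> y \<in> carr F} = carr H" (is "H.span ?S = _")
proof -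
  have "H.subspace H0"
    using M.subspace_vac by simp
  then have "invariant_subspace H (H.span ?S)"
    by (rule mu_span_invariant) (auto simp: X_H0 L_H0)
  moreover have "v\<^sub>0 \<in> ?S"
    using v0_H0 by (auto intro!: exI[of _ v\<^sub>0] exI[of _ \<Omega>])
  then have "v\<^sub>0 \<in> H.span ?S"
    by (rule H.span_base)
  ultimately show ?thesis
    using cyclic_v0 unfolding cyclic_vector_def by blast
qed

lemma mu_induct [consumes 1, case_names mu add]:
  assumes "h \<in> carr H" and mu: "\<And>x y. \<lbrakk>x \<in> H0; y \<in> carr F\<rbrakk> \<Longrightarrow> P (mu x y)"
    and add: "\<And>h k. \<lbrakk>h \<in> carr H; P h; k \<in> carr H; P k\<rbrakk> \<Longrightarrow> P (h + k)"
  shows "P h"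
proof -
  have "h \<in> H.span {mu x y | x y. x \<in> H0 \<and> y \<in> carr F}"
    using assms(1) by (simp add: mu_span)
  then have "h \<in> carr H \<and> P h"
  proof (induction rule: H.span_induct_alt)
    case base
    then show ?case
      using mu[of 0 "0"] M.subspace_0[OF M.subspace_vac] mu_scale_right[of 0 0 0] by simp
  next
    case (step c h k)
    then obtain x y where xy: "h = mu x y" "x \<in> H0" "y \<in> carr F" by blast
    then have "vscale H c h = mu x (vscale F c y)"
      by (simp add: mu_scale_right)
    with step.IH xy show ?case
      using mu[of x "vscale F c y"] mu_carr[of x "vscale F c y"] by (auto intro: add)
  qed
  then show ?thesis ..
qed

section \<open>The affine representation on the fermionic vacuum vectors\<close>

definition R :: "('a affine, 'h) prehilbert_rep" where
  "R = \<lparr>carr = H0, vscale = vscale H, act = (\<lambda>i. case i of Xmode a n \<Rightarrow> X a n | Level \<Rightarrow> L), inn = inn H\<rparr>"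

lemma R_simps [simp]: "carr R = H0" "vscale R = vscale H" "inn R = inn H"
  "act R (Xmode a n) = X a n" "act R Level = L"
  by (simp_all add: R_def)

lemma R_unitary: "unitary_rep affine_star R"
proof -
  have "linear_map_between R R T" if "H.lin T" "\<And>x. x \<in> H0 \<Longrightarrow> T x \<in> H0" for T
    using that H0_carr by (simp add: linear_map_between_def)
  then have "linear_map_between R R (act R i)" for i
    by (cases i) (simp_all add: lin_X X_H0 lin_L L_H0)
  then have "linear_rep R"
    using H.vector_space_scale M.subspace_vac by (simp add: linear_rep_def)
  moreover have "inner_product R"
    unfolding inner_product_def R_simps
    by (intro conjI ballI allI impI; intro H.inn_add_right H.inn_scale_right H.inn_commute H.inn_pos; (rule H0_carr)?)
  moreover have "inn R (act R i u) w = inn R u (act R (affine_star i) w)" if "u \<in> carr R" "w \<in> carr R" for i u w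
  proof (cases i)
    case (Xmode a n)
    have "inn H (M.S a n u) w = inn H u (M.S a (- n) w)"
      using M.S_adjoint[of u w a n] that H0_carr by simp
    then show ?thesis
      using that H0_carr H.adjoint[of u w "Bos (Xmode a n)"]
      by (simp add: Xmode X_def H.lin_carr[OF lin_S_H])
  next
    case Level
    then show ?thesis
      using that H0_carr H.adjoint[of u w "Bos Level"] by (simp add: L_def)
  qed
  ultimately show ?thesis
    by (simp add: unitary_rep_def)
qed

text \<open>The relations are known on the Fock space. The map \<open>mu x\<close> carries them
  over, as it sends \<Omega> to x and intertwines the currents.\<close>

lemma S_S_H0:
  assumes x: "x \<in> H0"
  shows "M.S a m (M.S b n x) - M.S b n (M.S a m x)
      = vscale H \<i> (\<Sum>c\<in>UNIV. vscale H (complex_of_real (Gam G a b c)) (M.S c (m + n) x))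
        + (if a = b \<and> m + n = 0 then vscale H (of_int m * complex_of_real (dual_cox G)) x else 0)"
proof -
  have mu_diff: "mu x (y - z) = mu x y - mu x z" if "y \<in> carr F" "z \<in> carr F" for y z
    using mu_add_right[OF x, of "y - z" z] that by simp
  have mu_zero: "mu x 0 = 0"
    using mu_scale_right[OF x, of 0 0] by simp
  have mu_sum: "mu x (sum f A) = (\<Sum>c\<in>A. mu x (f c))" if "\<And>c. c \<in> A \<Longrightarrow> f c \<in> carr F" for f and A :: "'a set"
    using that by (induction A rule: infinite_finite_induct) (auto simp: mu_zero mu_add_right[OF x])
  have SS: "M.S c k x = mu x (S c k \<Omega>)" for c k
    using S_mu[OF x Omega_carr, of c k] x by simp
  then have "M.S a m (M.S b n x) - M.S b n (M.S a m x) = mu x (S a m (S b n \<Omega>) - S b n (S a m \<Omega>))"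
    using x by (simp add: mu_diff S_mu)
  also have "\<dots> = vscale H \<i> (\<Sum>c\<in>UNIV. vscale H (complex_of_real (Gam G a b c)) (M.S c (m + n) x))
        + (if a = b \<and> m + n = 0 then vscale H (of_int m * complex_of_real (dual_cox G)) x else 0)"
    using x unfolding S_S[OF Omega_carr] by (simp add: mu_add_right mu_scale_right mu_sum mu_zero SS)
  finally show ?thesis .
qed

lemma R_affine: "affine_relations G R"
proof -
  have "X a m (X b n x) - X b n (X a m x)
      = vscale H \<i> (\<Sum>c\<in>UNIV. vscale H (complex_of_real (Gam G a b c)) (X c (m + n) x))
        + (if a = b \<and> m + n = 0 then vscale H (of_int m) (L x) else 0)"
    if x: "x \<in> H0" for a b m n x
  proof -
    have c: "x \<in> carr H" using x by (rule H0_carr)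
    note Sc = H.lin_carr[OF lin_S_H]
    \<comment> \<open>Since X = B - S commutes with S, the commutator of two X is that of the two B
      minus that of the two S; hence the levels are subtracted.\<close>
    have "X d k (M.S e l x) = M.S e l (X d k x)" for d k e l
      by (rule S_commute[OF lin_X X_p c])
    from this[of a m b n] this[of b n a m]
    have comm: "B a m (M.S b n x) - M.S a m (M.S b n x) = M.S b n (B a m x) - M.S b n (M.S a m x)"
        "B b n (M.S a m x) - M.S b n (M.S a m x) = M.S a m (B b n x) - M.S a m (M.S b n x)"
      using c by (simp_all add: X_def H.lin_diff[OF lin_S_H] Sc)
    have "X a m (X b n x) - X b n (X a m x)
        = (B a m (B b n x) - B b n (B a m x)) - (M.S a m (M.S b n x) - M.S b n (M.S a m x))"
      using c comm by (simp add: X_def H.act_simps H.lin_diff[OF lin_S_H] Sc algebra_simps)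
    then show ?thesis
      unfolding B_B[OF c] S_S_H0[OF x]
      by (simp add: X_def L_def H.scale_right_diff_distrib sum_subtractf)
  qed
  moreover have "L (X a n x) - X a n (L x) = 0" if x: "x \<in> H0" for a n x
  proof -
    have c: "x \<in> carr H" using x by (rule H0_carr)
    have "Z (M.S a n x) = M.S a n (Z x)"
      by (rule S_commute[OF H.lin_act Z_p c])
    then show ?thesis
      using c Z_B[OF c, of a n]
      by (simp add: L_def X_def H.act_simps H.lin_diff[OF lin_S_H] H.lin_scale[OF lin_S_H] H.lin_carr[OF lin_S_H]
          H.scale_right_diff_distrib)
  qed
  ultimately show ?thesis
    by (simp add: affine_relations_def)
qed

lemma R_irreducible: "irreducible_rep R"
  unfolding irreducible_rep_def
proof (intro conjI allI impI)
  show "carr R \<noteq> {0}"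
    using v0_H0 hw by (auto simp: highest_weight_vector_def)
next
  fix W assume inv: "invariant_subspace R W"
  then have W: "H.subspace W" "W \<subseteq> H0" and act: "\<And>i w. w \<in> W \<Longrightarrow> act R i w \<in> W"
    by (auto simp: invariant_subspace_def)
  have XW: "\<And>a n w. w \<in> W \<Longrightarrow> X a n w \<in> W" and LW: "\<And>w. w \<in> W \<Longrightarrow> L w \<in> W"
    using act[of _ "Xmode _ _"] act[of _ Level] by simp_all
  let ?S = "{mu x y | x y. x \<in> W \<and> y \<in> carr F}"
  show "W = {0} \<or> W = carr R"
  proof (cases "W = {0}")
    case False
    then obtain w where w: "w \<in> W" "w \<noteq> 0"
      using H.subspace_0[OF W(1)] by blast
    have "w = mu w \<Omega>" using w W by auto
    then have "w \<in> H.span ?S"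
      using w by (intro H.span_base) (auto intro!: exI[of _ w] exI[of _ \<Omega>])
    then have span: "H.span ?S = carr H"
      using mu_span_invariant[OF W XW LW] irreducible w(2) unfolding irreducible_rep_def by blast
    \<comment> \<open>Contracting the Fock factor with \<Omega> replaces \<open>mu u y\<close> by
      \<open>inn F \<Omega> y\<close> times u, which lies in W.\<close>
    have proj: "h \<in> carr H \<and> (\<exists>w\<in>W. \<forall>x\<in>H0. inn H x h = inn H x w)" if "h \<in> H.span ?S" for h
      using that
    proof (induction rule: H.span_induct_alt)
      case base
      then show ?case
        using H.subspace_0[OF W(1)] by auto
    next
      case (step c h k)
      then obtain u y w where u: "h = mu u y" "u \<in> W" "y \<in> carr F" and w: "w \<in> W" "\<forall>x\<in>H0. inn H x k = inn H x w"
          and k: "k \<in> carr H"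
        by blast
      show ?case
      proof (intro conjI bexI ballI)
        show "vscale H c h + k \<in> carr H"
          using u k W(2) mu_carr[of u y] by auto
        show "vscale H c (vscale H (inn F \<Omega> y) u) + w \<in> W"
          using u w by (intro H.subspace_add H.subspace_scale W)
        fix x assume x: "x \<in> H0"
        have "inn H x (mu u y) = inn H x u * inn F \<Omega> y"
          using mu_inner[OF x Omega_carr, of u y] u W(2) x by auto
        then show "inn H x (vscale H c h + k) = inn H x (vscale H c (vscale H (inn F \<Omega> y) u) + w)"
          using u w x k W(2) H0_carr mu_carr[of u y] by (auto simp: subset_iff)
      qed
    qed
    have "x \<in> W" if x: "x \<in> H0" for x
    proof -
      obtain w where w: "w \<in> W" "\<And>x'. x' \<in> H0 \<Longrightarrow> inn H x' x = inn H x' w"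
        using proj[of x] x H0_carr span by blast
      have "x - w \<in> H0"
        using w x W(2) M.subspace_diff[OF M.subspace_vac] by auto
      then have "inn H (x - w) (x - w) = 0"
        using w x W(2) H0_carr by (auto simp: subset_iff)
      then show ?thesis
        using H.inn_self_eq_0[of "x - w"] w x W(2) H0_carr by (auto simp: subset_iff)
    qed
    then show ?thesis
      using W(2) by auto
  qed simp
qed

lemma R_highest:
  "highest_weight_vector G (zero_modes G R) lam v\<^sub>0" "n > 0 \<Longrightarrow> act R (Xmode a n) v\<^sub>0 = 0"
proof -
  have "X a n v\<^sub>0 = B a n v\<^sub>0" if "n \<ge> 0" for a n
    using M.S_vac[OF v0_H0 that] by (simp add: X_def)
  then show "highest_weight_vector G (zero_modes G R) lam v\<^sub>0" "n > 0 \<Longrightarrow> act R (Xmode a n) v\<^sub>0 = 0"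
    using hw v0_H0 v0_raise by (simp_all add: highest_weight_vector_def zero_modes_def)
qed

lemma R_hw: "unitary_hw_affine_rep G R"
proof -
  have "cyclic_vector R v\<^sub>0"
    using R_irreducible v0_H0 hw unfolding cyclic_vector_def irreducible_rep_def highest_weight_vector_def by auto
  then show ?thesis
    using R_unitary R_affine R_irreducible R_highest unfolding unitary_hw_affine_rep_def by blast
qed

section \<open>The unitary equivalence with the tensor product\<close>

sublocale BF: boson_fock G F \<Omega> R
  by (intro boson_fock.intro fock_lie_axioms star_rep.intro boson_fock_axioms.intro R_unitary R_affine)

text \<open>Tensors are functions of inner products, so the isomorphism can be written down without
  decomposing h: its value at (x, y) is the inner product of \<open>mu x y\<close> with h.\<close>

definition to_tensor :: "'h \<Rightarrow> 'h \<times> 'f \<Rightarrow> complex" where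
  "to_tensor h = (\<lambda>(x, y). if x \<in> H0 \<and> y \<in> carr F then inn H (mu x y) h else 0)"

lemma to_tensor_add: "\<lbrakk>h \<in> carr H; k \<in> carr H\<rbrakk> \<Longrightarrow> to_tensor (h + k) = to_tensor h + to_tensor k"
  using mu_carr by (auto simp: to_tensor_def fun_eq_iff fun_apply)

lemma to_tensor_scale: "h \<in> carr H \<Longrightarrow> to_tensor (vscale H c h) = tensor_scale c (to_tensor h)"
  using mu_carr by (auto simp: to_tensor_def fun_eq_iff fun_apply)

lemma to_tensor_mu: "\<lbrakk>x \<in> H0; y \<in> carr F\<rbrakk> \<Longrightarrow> to_tensor (mu x y) = BF.tp x y"
  using mu_inner by (auto simp: to_tensor_def tensor_def fun_eq_iff)

lemma to_tensor_TC: "h \<in> carr H \<Longrightarrow> to_tensor h \<in> BF.TC"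
proof (induction rule: mu_induct)
  case (mu x y)
  then show ?case using BF.tp_TC[of x y] by (simp add: to_tensor_mu)
qed (simp add: to_tensor_add)

lemma to_tensor_act: "h \<in> carr H \<Longrightarrow> to_tensor (act H i h) = act BF.H i (to_tensor h)"
proof (induction rule: mu_induct)
  case (mu x y)
  show ?case
  proof (cases i)
    case (Bos z)
    show ?thesis
    proof (cases z)
      case (Xmode a n)
      show ?thesis
        using mu BF.act_tp(2)[of x y a n] mu_carr[of "X a n x" y] mu_carr[of x "S a n y"]
        by (simp add: Bos Xmode act_mu to_tensor_add to_tensor_mu X_H0)
    next
      case Level
      show ?thesis
        using mu BF.act_tp(3)[of x y] mu_carr[of "L x" y] mu_carr[of x y]
        by (simp add: Bos Level act_mu to_tensor_add to_tensor_scale to_tensor_mu L_H0)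
    qed
  next
    case (Ferm q)
    then obtain a n where "i = Ferm (Psi a n)" by (cases q) auto
    then show ?thesis
      using mu BF.act_tp(1)[of x y "Psi a n"] by (simp add: act_mu to_tensor_mu)
  qed
next
  case (add h k)
  then show ?case
    by (simp add: to_tensor_add H.act_simps BF.act_H_simps to_tensor_TC)
qed

lemma to_tensor_inner: "\<lbrakk>h \<in> carr H; k \<in> carr H\<rbrakk> \<Longrightarrow> BF.tinner (to_tensor h) (to_tensor k) = inn H h k"
proof (induction rule: mu_induct)
  case (mu x y)
  then show ?case
    using BF.tinner_tp[of x y "to_tensor k"] to_tensor_TC by (simp add: to_tensor_mu) (simp add: to_tensor_def)
next
  case (add h h')
  then show ?case
    by (simp add: to_tensor_add BF.tinner_add_left to_tensor_TC)
qed

lemma H_equivalent: "unitarily_equivalent H (super_tensor G R F)"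
  unfolding unitarily_equivalent_def
proof (intro exI[of _ to_tensor] conjI allI ballI)
  show "linear_map_between H BF.H to_tensor"
    by (simp add: linear_map_between_def to_tensor_TC to_tensor_add to_tensor_scale)
  show "bij_betw to_tensor (carr H) (carr BF.H)"
  proof (rule bij_betw_imageI)
    show "inj_on to_tensor (carr H)"
    proof
      fix h k assume hk: "h \<in> carr H" "k \<in> carr H" "to_tensor h = to_tensor k"
      have "to_tensor (h - k) + to_tensor k = to_tensor k"
        using to_tensor_add[of "h - k" k] hk by simp
      then have "BF.tinner (to_tensor (h - k)) (to_tensor (h - k)) = 0"
        using BF.tinner_tp[of 0 0 0] M.subspace_0[OF M.subspace_vac] by (simp add: fun_apply)
      then show "h = k"
        using H.inn_self_eq_0[of "h - k"] hk by (simp add: to_tensor_inner)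
    qed
    have "f \<in> to_tensor ` carr H" if "f \<in> BF.TC" for f
      using that
    proof (induction rule: BF.TC_induct)
      case (pure x y)
      then have "BF.tp x y = to_tensor (mu x y)" "mu x y \<in> carr H"
        using mu_carr[of x y] by (simp_all add: to_tensor_mu)
      then show ?case by (rule image_eqI)
    next
      case (add f g)
      then obtain h k where "h \<in> carr H" "k \<in> carr H" "f = to_tensor h" "g = to_tensor k"
        by blast
      then show ?case
        by (intro image_eqI[of _ to_tensor "h + k"]) (simp_all add: to_tensor_add)
    qed
    then show "to_tensor ` carr H = carr BF.H"
      using to_tensor_TC by auto
  qed
qed (simp_all add: to_tensor_act to_tensor_inner)

end

section \<open>Root decomposition\<close>

context vector_space
begin

text \<open>Eigenvectors for the same eigenvalue are merged, so that the components are indexed by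
  distinct eigenvalues and can be separated afterwards.\<close>

lemma span_eigenvectors_sum:
  assumes "x \<in> span {y. \<exists>c. T y = scale c y}"
    and T: "\<And>y z. T (y + z) = T y + T z" "\<And>c y. T (scale c y) = scale c (T y)"
  shows "\<exists>C z. finite C \<and> (\<forall>c. T (z c) = scale c (z c)) \<and> (\<forall>c. c \<notin> C \<longrightarrow> z c = 0) \<and> x = sum z C"
  using assms(1)
proof (induction rule: span_induct_alt)
  case base
  have "T 0 = 0" using T(2)[of 0 0] by simp
  then show ?case by (intro exI[of _ "{}"] exI[of _ "\<lambda>_. 0"]) simp
next
  case (step k y x)
  then obtain c C z where y: "T y = scale c y"
    and z: "finite C" "\<And>c. T (z c) = scale c (z c)" "\<And>c. c \<notin> C \<Longrightarrow> z c = 0" "x = sum z C"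
    by blast
  let ?z = "z(c := scale k y + z c)"
  have "sum ?z (insert c C) = scale k y + (z c + sum z (C - {c}))"
    using z(1) by (subst sum.insert_remove) (auto simp: add.assoc)
  also have "z c + sum z (C - {c}) = sum z C"
    using z(1,3) by (cases "c \<in> C") (simp_all add: sum.remove[of C c])
  finally have "sum ?z (insert c C) = scale k y + x"
    by (simp add: z(4))
  moreover have "T (?z d) = scale d (?z d)" for d
    using y z(2) by (simp add: T scale_right_distrib scale_left_commute)
  ultimately show ?case
    using z by (intro exI[of _ "insert c C"] exI[of _ ?z]) auto
qed

text \<open>The operator T - d removes the component of eigenvalue d and multiplies the others by c
  - d \<noteq> 0; induct on the set of eigenvalues.\<close>

lemma eigencomponents_in_invariant_subspace:
  assumes "finite C" "\<And>c. c \<in> C \<Longrightarrow> T (z c) = scale c (z c)" "sum z C \<in> E" "subspace E" "\<And>y. y \<in> E \<Longrightarrow> T y \<in> E"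
    and T: "\<And>y z. T (y + z) = T y + T z" "\<And>c y. T (scale c y) = scale c (T y)"
  shows "\<forall>c\<in>C. z c \<in> E"
  using assms(1-3)
proof (induction C arbitrary: z rule: finite_induct)
  case (insert d C)
  have T0: "T 0 = 0" using T(2)[of 0 0] by simp
  have Tsum: "T (sum z A) = (\<Sum>c\<in>A. T (z c))" for A
    by (induction A rule: infinite_finite_induct) (auto simp: T T0)
  have "T (sum z (insert d C)) - scale d (sum z (insert d C)) \<in> E"
    using insert.prems(2) assms(4,5) by (intro subspace_diff subspace_scale) auto
  also have "T (sum z (insert d C)) - scale d (sum z (insert d C)) = (\<Sum>c\<in>C. scale (c - d) (z c))"
    using insert.hyps insert.prems(1)
    by (simp add: T Tsum scale_sum_right scale_right_distrib scale_left_diff_distrib sum_subtractf)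
  finally have "\<forall>c\<in>C. scale (c - d) (z c) \<in> E"
    using insert.prems(1) by (intro insert.IH) (auto simp: T scale_left_commute)
  then have C: "z c \<in> E" if "c \<in> C" for c
  proof -
    have "c \<noteq> d" using that insert.hyps(2) by blast
    moreover have "scale (1 / (c - d)) (scale (c - d) (z c)) \<in> E"
      using that \<open>\<forall>c\<in>C. scale (c - d) (z c) \<in> E\<close> by (intro subspace_scale[OF assms(4), of "scale (c - d) (z c)"]) blast
    ultimately show ?thesis by simp
  qed
  have "z d = sum z (insert d C) - sum z C"
    using insert.hyps by simp
  also have "\<dots> \<in> E"
    by (rule subspace_diff[OF assms(4) insert.prems(2)]) (rule subspace_sum[OF assms(4) C])
  finally show ?case
    using C by auto
qed simp

lemma span_eigenvectors_Int:
  assumes "x \<in> span {y. \<exists>c. T y = scale c y}" "x \<in> E" "subspace E" "\<And>y. y \<in> E \<Longrightarrow> T y \<in> E"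
    and T: "\<And>y z. T (y + z) = T y + T z" "\<And>c y. T (scale c y) = scale c (T y)"
  shows "x \<in> span ({y. \<exists>c. T y = scale c y} \<inter> E)"
proof -
  obtain C z where z: "finite C" "\<And>c. T (z c) = scale c (z c)" "x = sum z C"
    using span_eigenvectors_sum[OF assms(1) T] by blast
  then have "\<forall>c\<in>C. z c \<in> E"
    using assms by (intro eigencomponents_in_invariant_subspace[of C T z E]) auto
  with z(2) show ?thesis
    unfolding z(3) by (intro span_sum span_base) auto
qed

end

section \<open>Simultaneous eigenvectors and roots\<close>

context simple_lie_data
begin

lemma cartan_subspace: "g.subspace (cartan G)"
  and cartan_abelian: "\<lbrakk>h \<in> cartan G; k \<in> cartan G\<rbrakk> \<Longrightarrow> brk G h k = 0"
  and cartan_selfcentralizing: "(\<And>h. h \<in> cartan G \<Longrightarrow> brk G h x = 0) \<Longrightarrow> x \<in> cartan G"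
  and cartan_diagonalizable: "h \<in> cartan G \<Longrightarrow> g.span {x. \<exists>c. brk G h x = gscale G c x} = UNIV"
  using cartan unfolding cartan_subalgebra_def by blast+

lemma cartan_gstar: "h \<in> cartan G \<Longrightarrow> gstar G h \<in> cartan G"
  using cartan_star by blast

definition eigen :: "'g set \<Rightarrow> 'g set" where
  "eigen A = {x. \<forall>h\<in>A. \<exists>c. brk G h x = gscale G c x}"

text \<open>The Cartan subalgebra is abelian, so a further element h maps the joint eigenspace of A
  through x to itself and can be diagonalized inside it.\<close>

lemma span_eigen_finite:
  assumes "finite A" "A \<subseteq> cartan G"
  shows "g.span (eigen A) = UNIV"
  using assms
proof (induction A rule: finite_induct)
  case empty
  then show ?case by (simp add: eigen_def)
next
  case (insert h A)
  have "eigen A \<subseteq> g.span (eigen (insert h A))"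
  proof
    fix x assume "x \<in> eigen A"
    then obtain \<chi> where \<chi>: "\<And>k. k \<in> A \<Longrightarrow> brk G k x = gscale G (\<chi> k) x"
      unfolding eigen_def by simp metis
    define E where "E = {y. \<forall>k\<in>A. brk G k y = gscale G (\<chi> k) y}"
    have "brk G h y \<in> E" if "y \<in> E" for y
    proof -
      have "brk G k (brk G h y) = gscale G (\<chi> k) (brk G h y)" if "k \<in> A" for k
      proof -
        have "brk G k h = 0" using that insert.prems by (intro cartan_abelian) auto
        then show ?thesis
          using \<open>y \<in> E\<close> that by (simp add: E_def jacobi_derivation[of k h y] brk_scale_right)
      qed
      then show ?thesis by (simp add: E_def)
    qed
    moreover have "g.subspace E"
      unfolding E_def by (rule g.subspaceI) (auto simp: brk_add_right brk_scale_right g.scale_right_distrib g.scale_left_commute)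
    moreover have "x \<in> g.span {y. \<exists>c. brk G h y = gscale G c y}"
      using cartan_diagonalizable insert.prems by auto
    ultimately have "x \<in> g.span ({y. \<exists>c. brk G h y = gscale G c y} \<inter> E)"
      using \<chi> by (intro g.span_eigenvectors_Int[of x "brk G h"])
        (auto simp: E_def brk_add_right brk_scale_right)
    then show "x \<in> g.span (eigen (insert h A))"
      by (rule set_mp[OF g.span_mono, rotated]) (auto simp: E_def eigen_def)
  qed
  then have "g.span (eigen A) \<subseteq> g.span (eigen (insert h A))"
    by (rule g.span_minimal) simp
  then show ?case
    using insert by auto
qed

lemma finite_spanning_subset:
  obtains B where "B \<subseteq> A" "finite B" "0 \<notin> B" "A \<subseteq> g.span B"
proof -
  obtain B where B: "B \<subseteq> A" "g.independent B" "A \<subseteq> g.span B"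
    using g.maximal_independent_subset[of A] by blast
  have "finite B"
    using g.independent_span_bound[of "range (basis G)" B] B(2) basis_span by simp
  moreover have "0 \<notin> B"
    using B(2) g.dependent_zero by blast
  ultimately show thesis
    using B that by blast
qed

lemma span_eigen_cartan: "g.span (eigen (cartan G)) = UNIV"
proof -
  obtain B where B: "B \<subseteq> cartan G" "finite B" "0 \<notin> B" "cartan G \<subseteq> g.span B"
    by (rule finite_spanning_subset)
  have "x \<in> eigen (cartan G)" if "x \<in> eigen B" for x
  proof -
    have "g.subspace {h. \<exists>c. brk G h x = gscale G c x}"
    proof (rule g.subspaceI)
      show "0 \<in> {h. \<exists>c. brk G h x = gscale G c x}"
        by (rule CollectI, rule exI[of _ 0]) simp
      fix h k assume "h \<in> {h. \<exists>c. brk G h x = gscale G c x}" "k \<in> {h. \<exists>c. brk G h x = gscale G c x}"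
      then obtain c d where "brk G h x = gscale G c x" "brk G k x = gscale G d x"
        by blast
      then have "brk G (h + k) x = gscale G (c + d) x"
        by (simp add: brk_add_left g.scale_left_distrib)
      then show "h + k \<in> {h. \<exists>c. brk G h x = gscale G c x}"
        by blast
    next
      fix d h assume "h \<in> {h. \<exists>c. brk G h x = gscale G c x}"
      then obtain c where "brk G h x = gscale G c x"
        by blast
      then have "brk G (gscale G d h) x = gscale G (d * c) x"
        by (simp add: brk_scale_left)
      then show "gscale G d h \<in> {h. \<exists>c. brk G h x = gscale G c x}"
        by blast
    qed
    then have "g.span B \<subseteq> {h. \<exists>c. brk G h x = gscale G c x}"
      using that by (intro g.span_minimal) (auto simp: eigen_def)
    then show ?thesis
      using B(4) by (auto simp: eigen_def)
  qed
  then have "g.span (eigen B) \<subseteq> g.span (eigen (cartan G))"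
    by (intro g.span_mono) auto
  then show ?thesis
    using span_eigen_finite[OF B(2,1)] by auto
qed

lemma form_cartan_nondegenerate:
  assumes "\<alpha> \<in> cartan G" "\<beta> \<in> cartan G" "\<And>h. h \<in> cartan G \<Longrightarrow> form G \<alpha> h = form G \<beta> h"
  shows "\<alpha> = \<beta>"
proof -
  have "\<alpha> - \<beta> \<in> cartan G"
    using assms cartan_subspace by (simp add: g.subspace_diff)
  then have "form G (\<alpha> - \<beta>) (gstar G (\<alpha> - \<beta>)) = 0"
    using assms(3) by (simp add: form_diff_left cartan_gstar)
  then show ?thesis
    using form_gstar_pos[of "\<alpha> - \<beta>"] by fastforce
qed

text \<open>The root is the bracket of x and \<open>gstar G x\<close>, divided by their form. It has
  weight zero, so it lies in the self-centralizing Cartan subalgebra, and the invariance of the form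
  shows that it represents the eigenvalue functional of x.\<close>

lemma eigen_root_vector:
  assumes x: "x \<in> eigen (cartan G)" "x \<noteq> 0"
  obtains \<alpha> where "\<alpha> \<in> cartan G" "x \<in> root_space G \<alpha>" "gstar G x \<in> root_space G (- \<alpha>)" "gstar G \<alpha> = \<alpha>"
    "brk G x (gstar G x) = gscale G (form G x (gstar G x)) \<alpha>"
proof -
  obtain \<chi> where \<chi>: "\<And>h. h \<in> cartan G \<Longrightarrow> brk G h x = gscale G (\<chi> h) x"
    using x(1) unfolding eigen_def by simp metis
  let ?N = "form G x (gstar G x)"
  have N: "?N \<noteq> 0" using form_gstar_pos[OF x(2)] by force
  have star: "brk G h (gstar G x) = gscale G (- cnj (\<chi> (gstar G h))) (gstar G x)" if "h \<in> cartan G" for h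
  proof -
    have "gstar G (brk G (gstar G h) x) = - brk G h (gstar G x)"
      by (simp add: gstar_brk)
    then show ?thesis
      using \<chi>[OF cartan_gstar[OF that]] by (simp add: gstar_scale)
  qed
  \<comment> \<open>Moving the bracket with h to the other side of \<open>?N\<close> compares the
    eigenvalues on x and on \<open>gstar G x\<close>, which turn out to be opposite.\<close>
  have real: "cnj (\<chi> (gstar G h)) = \<chi> h" if "h \<in> cartan G" for h
  proof -
    have "\<chi> h * ?N = form G (gstar G x) (brk G h x)"
      using that by (simp add: \<chi> form_scale_right form_commute)
    also have "\<dots> = form G (- brk G h (gstar G x)) x"
      by (simp add: brk_swap[of _ h] flip: form_brk)
    also have "\<dots> = cnj (\<chi> (gstar G h)) * ?N"
      using star[OF that] form_commute[of "gstar G x" x] by (simp add: form_scale_left)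
    finally show ?thesis using N by simp
  qed
  define \<alpha> where "\<alpha> = gscale G (1 / ?N) (brk G x (gstar G x))"
  have brk: "brk G x (gstar G x) = gscale G ?N \<alpha>"
    using N by (simp add: \<alpha>_def)
  have "brk G h (brk G x (gstar G x)) = 0" if "h \<in> cartan G" for h
    using that by (simp add: jacobi_derivation \<chi> star real brk_scale_left brk_scale_right brk_neg_right)
  then have \<alpha>: "\<alpha> \<in> cartan G"
    unfolding \<alpha>_def by (intro g.subspace_scale cartan_subspace cartan_selfcentralizing) auto
  have form: "form G \<alpha> h = \<chi> h" if "h \<in> cartan G" for h
  proof -
    have "form G (brk G x (gstar G x)) h = form G x (- brk G h (gstar G x))"
      unfolding form_brk brk_swap[of "gstar G x" h] ..
    then show ?thesis
      using that N by (simp add: \<alpha>_def form_scale_left form_neg_right form_scale_right star real)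
  qed
  have "gstar G (brk G x (gstar G x)) = brk G x (gstar G x)"
    by (simp add: gstar_brk brk_swap[of "gstar G x" x])
  moreover have "cnj ?N = ?N"
    by (simp add: form_gstar_self)
  ultimately have "gstar G \<alpha> = \<alpha>"
    by (simp add: \<alpha>_def gstar_scale)
  with \<alpha> brk show thesis
    using that[of \<alpha>] by (simp add: root_space_def form \<chi> star real form_neg_left)
qed

lemma root_vector:
  assumes \<alpha>: "\<alpha> \<in> cartan G" and x: "x \<in> root_space G \<alpha>" "x \<noteq> 0"
  shows "gstar G x \<in> root_space G (- \<alpha>)" and "gstar G \<alpha> = \<alpha>"
    and "brk G x (gstar G x) = gscale G (form G x (gstar G x)) \<alpha>"
proof -
  have "x \<in> eigen (cartan G)"
    using x by (auto simp: eigen_def root_space_def)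
  then obtain \<beta> where \<beta>: "\<beta> \<in> cartan G" "x \<in> root_space G \<beta>" "gstar G x \<in> root_space G (- \<beta>)" "gstar G \<beta> = \<beta>"
    "brk G x (gstar G x) = gscale G (form G x (gstar G x)) \<beta>"
    using x(2) by (rule eigen_root_vector)
  have "\<alpha> = \<beta>"
    using x \<beta> \<alpha> by (intro form_cartan_nondegenerate) (auto simp: root_space_def)
  with \<beta> show "gstar G x \<in> root_space G (- \<alpha>)" "gstar G \<alpha> = \<alpha>"
    "brk G x (gstar G x) = gscale G (form G x (gstar G x)) \<alpha>"
    by simp_all
qed

lemma eigen_cartan_or_root:
  assumes "x \<in> eigen (cartan G)" "x \<noteq> 0"
  shows "x \<in> cartan G \<or> (\<exists>\<alpha>\<in>roots G. x \<in> root_space G \<alpha>)"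
proof -
  obtain \<alpha> where \<alpha>: "\<alpha> \<in> cartan G" "x \<in> root_space G \<alpha>"
    using assms by (rule eigen_root_vector)
  show ?thesis
  proof (cases "\<alpha> = 0")
    case True
    then have "x \<in> cartan G"
      using \<alpha> by (intro cartan_selfcentralizing) (simp add: root_space_def form_def)
    then show ?thesis ..
  next
    case False
    then have "\<alpha> \<in> roots G"
      using \<alpha> assms(2) by (auto simp: roots_def)
    with \<alpha> show ?thesis by blast
  qed
qed

lemma root_nonzero_vector:
  assumes "\<alpha> \<in> roots G"
  obtains x where "x \<in> root_space G \<alpha>" "x \<noteq> 0"
proof -
  have "0 \<in> root_space G \<alpha>" by (simp add: root_space_def)
  then show thesis
    using assms that unfolding roots_def by blast
qed

lemma root_gstar: "\<alpha> \<in> roots G \<Longrightarrow> gstar G \<alpha> = \<alpha>"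
  by (metis (no_types, lifting) mem_Collect_eq root_nonzero_vector root_vector(2) roots_def)

lemma root_space_gstar: "\<lbrakk>\<alpha> \<in> roots G; x \<in> root_space G \<alpha>\<rbrakk> \<Longrightarrow> gstar G x \<in> root_space G (- \<alpha>)"
  by (cases "x = 0")
    (auto simp: roots_def root_vector(1), simp add: root_space_def gstar_def coord_zero)

text \<open>The alphabet of the words in the zero modes: finitely many Cartan elements and root
  vectors that span.\<close>

definition letters :: "'g set" where
  "letters = (SOME B. B \<subseteq> eigen (cartan G) \<and> finite B \<and> 0 \<notin> B \<and> g.span B = UNIV)"

lemma letters: "letters \<subseteq> eigen (cartan G)" "finite letters" "0 \<notin> letters" "g.span letters = UNIV"
proof -
  obtain B where B: "B \<subseteq> eigen (cartan G)" "finite B" "0 \<notin> B" "eigen (cartan G) \<subseteq> g.span B"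
    by (rule finite_spanning_subset)
  have "UNIV \<subseteq> g.span B"
    using g.span_minimal[OF B(4)] span_eigen_cartan by simp
  with B have "\<exists>B. B \<subseteq> eigen (cartan G) \<and> finite B \<and> 0 \<notin> B \<and> g.span B = UNIV"
    by blast
  then show "letters \<subseteq> eigen (cartan G)" "finite letters" "0 \<notin> letters" "g.span letters = UNIV"
    unfolding letters_def by (metis (mono_tags, lifting) someI_ex)+
qed

lemma letter_cases:
  assumes "b \<in> letters"
  obtains "b \<in> cartan G" | \<alpha> where "\<alpha> \<in> roots G" "b \<in> root_space G \<alpha>"
  using assms eigen_cartan_or_root letters(1,3) by blast

end

section \<open>Unitary highest weight representations of the affine algebra\<close>

context prehilbert
begin

text \<open>
  Up to that of \<open>v\<close>, the squared norm of \<open>f\<^sup>k v\<close> is the product of the \<open>N (j + 1) (m - j)\<close>, \<open>j < k\<close>,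
  so positivity forces one of the factors to vanish.
\<close>

lemma sl2_highest_weight_nat:
  assumes e: "lin e" and f: "lin f" and h: "lin h"
    and v: "v \<in> carr V" "v \<noteq> 0" "e v = 0" "h v = vscale V (complex_of_real N * m) v" and N: "N > 0"
    and ef: "\<And>w. w \<in> carr V \<Longrightarrow> e (f w) = f (e w) + h w"
    and hf: "\<And>w. w \<in> carr V \<Longrightarrow> h (f w) = f (h w) - vscale V (2 * complex_of_real N) (f w)"
    and adj: "\<And>u w. \<lbrakk>u \<in> carr V; w \<in> carr V\<rbrakk> \<Longrightarrow> inn V (f u) w = inn V u (e w)"
  shows "\<exists>k::nat. m = of_nat k"
proof (rule ccontr)
  assume not_nat: "\<nexists>k::nat. m = of_nat k"
  define w where "w k = (f ^^ k) v" for k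
  have w_Suc: "w (Suc k) = f (w k)" for k
    by (simp add: w_def)
  have wc [simp]: "w k \<in> carr V" for k
    by (induction k) (use v f in \<open>simp_all add: w_def\<close>)
  have hw: "h (w k) = vscale V (complex_of_real N * (m - 2 * of_nat k)) (w k)" for k
  proof (induction k)
    case 0
    then show ?case using v by (simp add: w_def)
  next
    case (Suc k)
    then show ?case
      by (simp add: w_Suc hf lin_scale[OF f] algebra_simps flip: scale_left_diff_distrib)
  qed
  have ew: "e (w (Suc k)) = vscale V (complex_of_real N * of_nat (Suc k) * (m - of_nat k)) (w k)" for k
  proof (induction k)
    case 0
    then show ?case using hw[of 0] ef[of v] v by (simp add: w_def lin_zero[OF f])
  next
    case (Suc k)
    have "e (w (Suc (Suc k))) = f (e (w (Suc k))) + h (w (Suc k))"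
      using ef[OF wc[of "Suc k"]] by (simp add: w_Suc)
    also have "\<dots> = vscale V (complex_of_real N * of_nat (Suc k) * (m - of_nat k)
        + complex_of_real N * (m - 2 * of_nat (Suc k))) (w (Suc k))"
      using Suc hw[of "Suc k"] by (simp add: lin_scale[OF f] scale_left_distrib flip: w_Suc)
    also have "complex_of_real N * of_nat (Suc k) * (m - of_nat k) + complex_of_real N * (m - 2 * of_nat (Suc k))
        = complex_of_real N * of_nat (Suc (Suc k)) * (m - of_nat (Suc k))"
      by (simp add: algebra_simps)
    finally show ?case .
  qed
  have norm: "inn V (w (Suc k)) (w (Suc k))
      = complex_of_real N * of_nat (Suc k) * (m - of_nat k) * inn V (w k) (w k)" for k
  proof -
    have "inn V (w (Suc k)) (w (Suc k)) = inn V (w k) (e (w (Suc k)))"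
      using adj[OF wc[of k] wc[of "Suc k"]] by (simp add: w_Suc)
    then show ?thesis
      unfolding ew by simp
  qed
  have nz: "w k \<noteq> 0" for k
  proof (induction k)
    case 0
    then show ?case using v by (simp add: w_def)
  next
    case (Suc k)
    have "m - of_nat k \<noteq> 0"
      using not_nat by auto
    then have "inn V (w (Suc k)) (w (Suc k)) \<noteq> 0"
      unfolding norm using N Suc inn_self_eq_0[of "w k"] by (auto simp: add_eq_0_iff of_nat_neq_0 simp flip: of_nat_Suc)
    then show ?case by auto
  qed
  \<comment> \<open>Here m is still complex. As no vector of the chain vanishes, all squared norms
    are positive, and their quotients force Re m beyond every k.\<close>
  have "Re m - real k > 0" for k
  proof -
    have "Re (inn V (w (Suc k)) (w (Suc k))) = N * real (Suc k) * (Re m - real k) * Re (inn V (w k) (w k))"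
      unfolding norm by (subst inn_self_real[of "w k"]) (simp_all del: of_nat_Suc)
    moreover have "Re (inn V (w (Suc k)) (w (Suc k))) > 0" "Re (inn V (w k) (w k)) > 0"
      using nz by (simp_all add: inn_pos)
    ultimately have "0 < N * real (Suc k) * (Re m - real k)"
      by (metis zero_less_mult_pos2)
    then show ?thesis
      using N by (metis zero_less_mult_pos mult_pos_pos of_nat_0_less_iff zero_less_Suc)
  qed
  moreover obtain k where "Re m < real k"
    using reals_Archimedean2 by blast
  ultimately show False
    by (metis diff_gt_0_iff_gt less_asym)
qed

end

locale affine_hw = simple_lie_data G + star_rep affine_star R
  for G :: "('a::finite, 'g::ab_group_add) lie_data" and R :: "('a affine, 'v::ab_group_add) prehilbert_rep" +
  fixes v\<^sub>0 :: 'v and lam :: 'g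
  assumes affine: "affine_relations G R" and irreducible: "irreducible_rep R"
    and hw: "highest_weight_vector G (zero_modes G R) lam v\<^sub>0"
    and raise: "n > 0 \<Longrightarrow> act R (Xmode a n) v\<^sub>0 = 0"
begin

abbreviation Z :: "'v \<Rightarrow> 'v" where
  "Z \<equiv> act R Level"

text \<open>The action of \<open>x t\<^sup>n\<close>.\<close>

definition rho :: "int \<Rightarrow> 'g \<Rightarrow> 'v \<Rightarrow> 'v" where
  "rho n x w = (\<Sum>a\<in>UNIV. vscale R (coord G a x) (act R (Xmode a n) w))"

lemma lin_rho [simp]: "lin (rho n x)"
proof -
  have "lin (\<lambda>w. rho n x w)"
    unfolding rho_def by (rule lin_sumI, rule lin_scaleI, rule lin_act)
  then show ?thesis .
qed

lemma rho_carr: "w \<in> carr R \<Longrightarrow> rho n x w \<in> carr R"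
  by simp

lemmas rho_simps = lin_add[OF lin_rho] lin_scale[OF lin_rho] lin_zero[OF lin_rho] lin_neg[OF lin_rho]
  lin_diff[OF lin_rho] lin_sum[OF lin_rho]

lemma rho_add_left: "rho n (x + y) w = rho n x w + rho n y w"
  by (simp add: rho_def coord_add scale_left_distrib sum.distrib)

lemma rho_scale_left: "rho n (gscale G c x) w = vscale R c (rho n x w)"
  by (simp add: rho_def coord_scale scale_sum_right)

lemma rho_zero_left: "rho n 0 w = 0"
  using rho_scale_left[of n 0 0] by simp

lemma rho_neg_left: "rho n (- x) w = - rho n x w"
  using rho_scale_left[of n "- 1" x w] by simp

lemma rho_basis: "rho n (basis G a) w = act R (Xmode a n) w"
  by (simp add: rho_def coord_basis if_distrib[of "\<lambda>c. vscale R c _"] cong: if_cong)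

lemma rho_adjoint:
  "\<lbrakk>u \<in> carr R; w \<in> carr R\<rbrakk> \<Longrightarrow> inn R (rho n x u) w = inn R u (rho (- n) (gstar G x) w)"
  by (simp add: rho_def inn_sum_left inn_sum_right adjoint coord_gstar)

lemma rho_adjoint_right:
  "\<lbrakk>u \<in> carr R; w \<in> carr R\<rbrakk> \<Longrightarrow> inn R u (rho n x w) = inn R (rho (- n) (gstar G x) u) w"
  by (simp add: rho_adjoint)

lemma X_commutator: "w \<in> carr R \<Longrightarrow>
    act R (Xmode a m) (act R (Xmode b n) w) - act R (Xmode b n) (act R (Xmode a m) w)
      = rho (m + n) (brk G (basis G a) (basis G b)) w
        + (if a = b \<and> m + n = 0 then vscale R (of_int m) (Z w) else 0)"
  using affine by (simp add: affine_relations_def rho_def coord_brk_basis scale_sum_right)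

lemma Z_X: "w \<in> carr R \<Longrightarrow> Z (act R (Xmode a n) w) = act R (Xmode a n) (Z w)"
  using affine by (simp add: affine_relations_def)

lemma Z_rho: "w \<in> carr R \<Longrightarrow> Z (rho n x w) = rho n x (Z w)"
  by (simp add: rho_def act_simps Z_X)

lemma rho_sum_left: "rho n (sum f A) w = (\<Sum>x\<in>A. rho n (f x) w)"
  by (induction A rule: infinite_finite_induct) (auto simp: rho_add_left rho_zero_left)

lemma rho_commutator:
  assumes w: "w \<in> carr R"
  shows "rho m x (rho n y w) - rho n y (rho m x w)
    = rho (m + n) (brk G x y) w + (if m + n = 0 then vscale R (of_int m * form G x y) (Z w) else 0)"
proof -
  let ?x = "\<lambda>a. coord G a x" and ?y = "\<lambda>b. coord G b y"
  have "rho m x (rho n y w) = (\<Sum>a\<in>UNIV. \<Sum>b\<in>UNIV. vscale R (?x a * ?y b) (act R (Xmode a m) (act R (Xmode b n) w)))"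
    using w by (simp add: rho_def act_simps scale_sum_right)
  moreover have "rho n y (rho m x w) = (\<Sum>a\<in>UNIV. \<Sum>b\<in>UNIV. vscale R (?x a * ?y b) (act R (Xmode b n) (act R (Xmode a m) w)))"
    using w by (subst sum.swap) (simp add: rho_def act_simps scale_sum_right mult.commute)
  ultimately have "rho m x (rho n y w) - rho n y (rho m x w) = (\<Sum>a\<in>UNIV. \<Sum>b\<in>UNIV. vscale R (?x a * ?y b)
      (rho (m + n) (brk G (basis G a) (basis G b)) w + (if a = b \<and> m + n = 0 then vscale R (of_int m) (Z w) else 0)))"
    by (simp add: X_commutator[OF w, symmetric] scale_right_diff_distrib sum_subtractf)
  also have "\<dots> = (\<Sum>a\<in>UNIV. \<Sum>b\<in>UNIV. vscale R (?x a * ?y b) (rho (m + n) (brk G (basis G a) (basis G b)) w))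
      + (\<Sum>a\<in>UNIV. \<Sum>b\<in>UNIV. if a = b then (if m + n = 0 then vscale R (?x a * ?y b * of_int m) (Z w) else 0) else 0)"
    unfolding sum.distrib[symmetric] by (intro sum.cong refl) (simp add: scale_right_distrib)
  also have "(\<Sum>a\<in>UNIV. \<Sum>b\<in>UNIV. if a = b then (if m + n = 0 then vscale R (?x a * ?y b * of_int m) (Z w) else 0) else 0)
      = (if m + n = 0 then vscale R (of_int m * form G x y) (Z w) else 0)"
    by (simp add: form_def sum_distrib_left scale_sum_left mult.commute)
  also have "(\<Sum>a\<in>UNIV. \<Sum>b\<in>UNIV. vscale R (?x a * ?y b) (rho (m + n) (brk G (basis G a) (basis G b)) w))
      = rho (m + n) (brk G x y) w"
  proof -
    have "brk G x y = (\<Sum>a\<in>UNIV. \<Sum>b\<in>UNIV. gscale G (?x a * ?y b) (brk G (basis G a) (basis G b)))"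
      by (subst (1) coord_expand[of x, symmetric], subst (1) coord_expand[of y, symmetric])
        (simp add: brk_sum_left brk_sum_right brk_scale_left brk_scale_right g.scale_sum_right,
          subst sum.swap, simp add: mult.commute)
    then show ?thesis
      by (simp add: rho_sum_left rho_scale_left)
  qed
  finally show ?thesis .
qed

lemma rho_rho: "w \<in> carr R \<Longrightarrow> rho m x (rho n y w) = rho n y (rho m x w)
    + rho (m + n) (brk G x y) w + (if m + n = 0 then vscale R (of_int m * form G x y) (Z w) else 0)"
  using rho_commutator[of w m x n y] by (simp add: algebra_simps)

lemma rho0_rho0: "w \<in> carr R \<Longrightarrow> rho 0 x (rho 0 y w) = rho 0 y (rho 0 x w) + rho 0 (brk G x y) w"
  by (simp add: rho_rho[of w 0 x 0 y])

lemma v0_carr [simp]: "v\<^sub>0 \<in> carr R" and v0_nonzero: "v\<^sub>0 \<noteq> 0" and lam_cartan: "lam \<in> cartan G"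
  and v0_weight: "h \<in> cartan G \<Longrightarrow> rho 0 h v\<^sub>0 = vscale R (form G lam h) v\<^sub>0"
  and v0_pos: "\<lbrakk>\<alpha> \<in> pos_roots G; x \<in> root_space G \<alpha>\<rbrakk> \<Longrightarrow> rho 0 x v\<^sub>0 = 0"
  using hw by (auto simp: highest_weight_vector_def zero_modes_def rho_def)

lemma irreducibleD: "\<lbrakk>invariant_subspace R W; w \<in> W; w \<noteq> 0\<rbrakk> \<Longrightarrow> W = carr R"
  using irreducible unfolding irreducible_rep_def by blast

lemma invariant_subspaceI:
  assumes "subspace W" "W \<subseteq> carr R" "\<And>n x w. w \<in> W \<Longrightarrow> rho n x w \<in> W" "\<And>w. w \<in> W \<Longrightarrow> Z w \<in> W"
  shows "invariant_subspace R W"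
  unfolding invariant_subspace_def
proof (intro conjI allI ballI assms(1,2))
  fix i w assume "w \<in> W"
  then show "act R i w \<in> W"
    using assms(3)[of w _ "basis G _"] assms(4) by (cases i) (simp_all add: rho_basis)
qed

subsection \<open>Singular vectors\<close>

definition U :: "'v set" where
  "U = {w \<in> carr R. \<forall>n x. n > 0 \<longrightarrow> rho n x w = 0}"

lemma U_carr: "w \<in> U \<Longrightarrow> w \<in> carr R"
  and U_raise: "\<lbrakk>w \<in> U; n > 0\<rbrakk> \<Longrightarrow> rho n x w = 0"
  by (simp_all add: U_def)

lemma subspace_U: "subspace U"
  by (rule subspaceI) (auto simp: U_def rho_simps)

lemma v0_U: "v\<^sub>0 \<in> U"
  by (simp add: U_def rho_def raise)

lemma Z_U: "w \<in> U \<Longrightarrow> Z w \<in> U"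
  by (simp add: U_def rho_simps act_simps flip: Z_rho)

lemma rho0_U: "w \<in> U \<Longrightarrow> rho 0 x w \<in> U"
  by (auto simp: U_def rho_rho[of w _ _ 0 x] rho_simps)

text \<open>
  Words of length at most \<open>r\<close> and energy \<open>k\<close>, applied to the vectors of \<open>A\<close>. The bound on the length
  is what makes commuting an annihilation operator to the right an induction.
\<close>

primrec fil :: "'v set \<Rightarrow> nat \<Rightarrow> int \<Rightarrow> 'v set" where
  "fil A 0 = (\<lambda>k. if k = 0 then A else {0})"
| "fil A (Suc r) = (\<lambda>k. span (fil A r k \<union> {rho n x w | n x w. w \<in> fil A r (k + n)}))"

lemmas [simp del] = fil.simps(2)

definition singular_module :: "'v set \<Rightarrow> bool" where
  "singular_module A \<longleftrightarrow> subspace A \<and> A \<subseteq> U \<and> (\<forall>w\<in>A. (\<forall>x. rho 0 x w \<in> A) \<and> Z w \<in> A)"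

lemma singular_moduleI:
  assumes "subspace A" "A \<subseteq> U" "\<And>x w. w \<in> A \<Longrightarrow> rho 0 x w \<in> A" "\<And>w. w \<in> A \<Longrightarrow> Z w \<in> A"
  shows "singular_module A"
  using assms by (simp add: singular_module_def)

lemma singular_module_U: "singular_module U"
  by (intro singular_moduleI subspace_U order_refl rho0_U Z_U)

context
  fixes A :: "'v set"
  assumes singular_module: "singular_module A"
begin

lemma singular_moduleD: "subspace A" "A \<subseteq> U" "w \<in> A \<Longrightarrow> rho 0 x w \<in> A" "w \<in> A \<Longrightarrow> Z w \<in> A"
  using singular_module by (simp_all add: singular_module_def)

lemma subspace_fil: "subspace (fil A r k)"
  by (cases r) (use singular_moduleD in \<open>auto simp: fil.simps(2)\<close>)

lemma fil_carr: "fil A r k \<subseteq> carr R"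
proof (induction r arbitrary: k)
  case 0
  then show ?case using singular_moduleD(2) U_carr by auto
next
  case (Suc r)
  have "rho n x w \<in> carr R" if "w \<in> fil A r (k + n)" for n x w
    using that Suc by (intro rho_carr) auto
  then show ?case
    unfolding fil.simps(2) using Suc by (intro span_subset_carr) auto
qed

lemma fil_carrD: "w \<in> fil A r k \<Longrightarrow> w \<in> carr R"
  using fil_carr by blast

lemma fil_Suc: "w \<in> fil A r k \<Longrightarrow> w \<in> fil A (Suc r) k"
  by (simp add: fil.simps(2) span_base)

lemma fil_rho: "w \<in> fil A r (k + n) \<Longrightarrow> rho n x w \<in> fil A (Suc r) k"
  unfolding fil.simps(2) by (auto intro: span_base)

lemma fil_induct [consumes 1, case_names old rho add scale]:
  assumes "w \<in> fil A (Suc r) k"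
    and "\<And>w. w \<in> fil A r k \<Longrightarrow> P w" "\<And>n x w. w \<in> fil A r (k + n) \<Longrightarrow> P (rho n x w)"
    and "\<And>w w'. \<lbrakk>w \<in> carr R; P w; w' \<in> carr R; P w'\<rbrakk> \<Longrightarrow> P (w + w')"
    and "\<And>c w. \<lbrakk>w \<in> carr R; P w\<rbrakk> \<Longrightarrow> P (vscale R c w)"
  shows "P w"
proof -
  have "w \<in> carr R \<and> P w"
    using assms(1) unfolding fil.simps(2)
  proof (induction rule: span_induct_alt)
    case base
    then show ?case
      using assms(2)[of 0] subspace_0[OF subspace_fil] by simp
  next
    case (step c x y)
    then have "x \<in> carr R" "P x"
      using assms(2,3) by (auto intro: rho_carr dest: fil_carrD)
    then show ?case
      using step.IH assms(4,5) by simp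
  qed
  then show ?thesis ..
qed

lemma fil_Z: "w \<in> fil A r k \<Longrightarrow> Z w \<in> fil A r k"
proof (induction r arbitrary: w k)
  case 0
  then show ?case using singular_moduleD(4) by (auto simp: act_simps split: if_splits)
next
  case (Suc r)
  from Suc.prems show ?case
  proof (induction rule: fil_induct)
    case (old w)
    then show ?case using Suc.IH by (intro fil_Suc)
  next
    case (rho n x w)
    then have "w \<in> carr R" using fil_carr by blast
    then show ?case using rho Suc.IH by (simp only: Z_rho fil_rho)
  next
    case (add w w')
    then show ?case by (simp only: act_simps subspace_add[OF subspace_fil])
  next
    case (scale c w)
    then show ?case by (simp only: act_simps subspace_scale[OF subspace_fil])
  qed
qed

text \<open>Passing a letter costs the bracket and a central term. Both act on a word that is
  shorter by one, so the length bound r is kept.\<close>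

lemma fil_raise: "\<lbrakk>w \<in> fil A r k; n > 0\<rbrakk> \<Longrightarrow> rho n x w \<in> fil A r (k - n)"
proof (induction r arbitrary: w k n x)
  case 0
  then have "rho n x w = 0"
    using singular_moduleD(2) U_raise by (auto simp: rho_simps split: if_splits)
  then show ?case
    by (simp only: subspace_0[OF subspace_fil])
next
  case (Suc r)
  from Suc.prems(1) show ?case
  proof (induction rule: fil_induct)
    case (old w)
    then show ?case using Suc by (intro fil_Suc)
  next
    case (rho m y w)
    then have w: "w \<in> carr R" using fil_carr by blast
    have "rho n x w \<in> fil A r (k - n + m)"
      using Suc.IH[OF rho Suc.prems(2), of x] by (simp add: algebra_simps)
    then have 1: "rho m y (rho n x w) \<in> fil A (Suc r) (k - n)"
      by (rule fil_rho)
    have 2: "rho (n + m) (brk G x y) w \<in> fil A (Suc r) (k - n)"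
      using rho by (intro fil_rho) (simp add: algebra_simps)
    have 3: "(if n + m = 0 then vscale R (of_int n * form G x y) (Z w) else 0) \<in> fil A (Suc r) (k - n)"
    proof (cases "n + m = 0")
      case True
      then have "m = - n" by simp
      then have "Z w \<in> fil A r (k - n)"
        using fil_Z[OF rho] by simp
      then show ?thesis
        using True by (simp add: subspace_scale[OF subspace_fil fil_Suc])
    next
      case False
      then show ?thesis
        by (simp add: subspace_0[OF subspace_fil])
    qed
    show ?case
      unfolding rho_rho[OF w, of n x m y] by (intro subspace_add[OF subspace_fil] 1 2 3)
  next
    case (add w w')
    then show ?case by (simp only: rho_simps subspace_add[OF subspace_fil])
  next
    case (scale c w)
    then show ?case by (simp only: rho_simps subspace_scale[OF subspace_fil])
  qed
qed

text \<open>
  Hence a module \<open>A\<close> of singular vectors is the energy 0 part of the representation that it generates.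
\<close>

lemma fil_energy:
  assumes "w \<in> fil A r k"
  shows "(k < 0 \<longrightarrow> w = 0) \<and> (k = 0 \<longrightarrow> w \<in> A) \<and> (k > 0 \<longrightarrow> (\<forall>u\<in>U. inn R u w = 0))"
  using assms
proof (induction r arbitrary: w k)
  case 0
  then show ?case using U_carr by (auto split: if_splits)
next
  case (Suc r)
  from Suc.prems show ?case
  proof (induction rule: fil_induct)
    case (old w)
    then show ?case by (rule Suc.IH)
  next
    case (rho n x w)
    then have w: "w \<in> carr R" using fil_carr by blast
    note IH = Suc.IH[OF rho]
    \<comment> \<open>For n > 0, \<open>fil_raise\<close> exhibits the vector as a combination of
      words of length at most r. For n = 0, A and U are stable. For n < 0, the adjoint is a positive
      mode and kills U, and if k \<le> 0 then w has negative energy and is zero.\<close>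
    consider "n > 0" | "n = 0" | "n < 0" by linarith
    then show ?case
    proof cases
      case 1
      then show ?thesis
        using Suc.IH[OF fil_raise[OF rho 1, of x]] by simp
    next
      case 2
      have "inn R u (rho 0 x w) = inn R (rho 0 (gstar G x) u) w" if "u \<in> U" for u
        using w U_carr[OF that] by (simp add: rho_adjoint_right)
      then show ?thesis
        using IH singular_moduleD(3) rho0_U by (auto simp: 2 rho_simps)
    next
      case 3
      have "inn R u (rho n x w) = 0" if "u \<in> U" for u
        using w U_carr[OF that] U_raise[OF that, of "- n"] 3 by (simp add: rho_adjoint_right)
      then show ?thesis
        using IH 3 subspace_0[OF singular_moduleD(1)] by (auto simp: rho_simps)
    qed
  next
    case (add w w')
    then show ?case using subspace_add[OF singular_moduleD(1)] U_carr by auto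
  next
    case (scale c w)
    then show ?case using subspace_scale[OF singular_moduleD(1)] U_carr by auto
  qed
qed

lemma span_fil:
  assumes "a \<in> A" "a \<noteq> 0"
  shows "span (\<Union>r k. fil A r k) = carr R"
proof -
  let ?F = "\<Union>r k. fil A r k"
  have sub: "?F \<subseteq> carr R" using fil_carr by blast
  have inv: "T w \<in> span ?F" if "w \<in> span ?F" "lin T" "\<And>w. w \<in> ?F \<Longrightarrow> T w \<in> ?F" for T w
  proof -
    have "w \<in> carr R \<and> T w \<in> span ?F"
      using that(1)
    proof (induction rule: span_induct_alt)
      case base
      then show ?case by (simp add: lin_zero[OF that(2)] span_zero)
    next
      case (step c x y)
      then have "x \<in> carr R" "T x \<in> span ?F"
        using sub that(3)[of x] by (auto intro: span_base)
      then show ?case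
        using step.IH by (simp add: lin_add[OF that(2)] lin_scale[OF that(2)] span_add span_scale)
    qed
    then show ?thesis ..
  qed
  have rho_F: "rho n x w \<in> ?F" if w: "w \<in> ?F" for n x w
  proof -
    obtain r k where "w \<in> fil A r k" using w by blast
    then have "rho n x w \<in> fil A (Suc r) (k - n)" by (intro fil_rho) simp
    then show ?thesis by blast
  qed
  have Z_F: "Z w \<in> ?F" if "w \<in> ?F" for w
    using that fil_Z by blast
  have "invariant_subspace R (span ?F)"
  proof (rule invariant_subspaceI)
    fix n x w assume "w \<in> span ?F"
    then show "rho n x w \<in> span ?F" by (rule inv[OF _ lin_rho]) (rule rho_F)
  next
    fix w assume "w \<in> span ?F"
    then show "Z w \<in> span ?F" by (rule inv[OF _ lin_act]) (rule Z_F)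
  qed (simp_all add: span_subset_carr[OF sub])
  moreover have "a \<in> fil A 0 0" using assms by simp
  then have "a \<in> span ?F" by (intro span_base) blast
  ultimately show ?thesis
    using irreducibleD assms(2) by blast
qed

text \<open>Keep the components of energy 0: all others are zero or orthogonal to U. This is the
  orthogonal projection onto U, with its values in A.\<close>

lemma fil_projection:
  assumes "a \<in> A" "a \<noteq> 0" "z \<in> carr R"
  obtains b where "b \<in> A" "\<And>u. u \<in> U \<Longrightarrow> inn R u z = inn R u b"
proof -
  have "z \<in> carr R \<and> (\<exists>b\<in>A. \<forall>u\<in>U. inn R u z = inn R u b)"
    using assms(3) unfolding span_fil[OF assms(1,2), symmetric]
  proof (induction rule: span_induct_alt)
    case base
    then show ?case
      using subspace_0[OF singular_moduleD(1)] span_zero by blast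
  next
    case (step c x y)
    then obtain r k where x: "x \<in> fil A r k" by blast
    have "\<exists>b\<in>A. \<forall>u\<in>U. inn R u x = inn R u b"
    proof (cases "k = 0")
      case True
      then show ?thesis using fil_energy[OF x] by blast
    next
      case False
      then have "\<forall>u\<in>U. inn R u x = inn R u 0"
        using fil_energy[OF x] U_carr by (cases "k < 0") auto
      then show ?thesis using subspace_0[OF singular_moduleD(1)] by blast
    qed
    then obtain b b' where b: "b \<in> A" "\<And>u. u \<in> U \<Longrightarrow> inn R u x = inn R u b"
        "b' \<in> A" "\<And>u. u \<in> U \<Longrightarrow> inn R u y = inn R u b'" and y: "y \<in> carr R"
      using step.IH unfolding span_fil[OF assms(1,2)] by blast
    have "b \<in> carr R" "b' \<in> carr R"
      using b singular_moduleD(2) U_carr by blast+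
    then have "\<forall>u\<in>U. inn R u (vscale R c x + y) = inn R u (vscale R c b + b')"
      using b fil_carrD[OF x] y U_carr by simp
    moreover have "vscale R c b + b' \<in> A"
      using b by (intro subspace_add subspace_scale singular_moduleD(1))
    ultimately show ?case
      using fil_carrD[OF x] y unfolding span_fil[OF assms(1,2)] by auto
  qed
  with that show thesis by blast
qed

lemma U_irreducible:
  assumes "a \<in> A" "a \<noteq> 0"
  shows "A = U"
proof
  show "U \<subseteq> A"
  proof
    fix w assume w: "w \<in> U"
    obtain b where b: "b \<in> A" "\<And>u. u \<in> U \<Longrightarrow> inn R u w = inn R u b"
      using fil_projection[OF assms U_carr[OF w]] by metis
    then have "w - b \<in> U"
      using w singular_moduleD(2) by (intro subspace_diff[OF subspace_U]) auto
    then have "inn R (w - b) (w - b) = 0"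
      using b w singular_moduleD(2) U_carr by (simp add: subset_iff)
    then show "w \<in> A"
      using b w singular_moduleD(2) U_carr inn_self_eq_0[of "w - b"] by (auto simp: subset_iff)
  qed
qed (rule singular_moduleD(2))

end

subsection \<open>The level is a scalar\<close>

text \<open>
  The level is central, but a priori it need not act by a scalar, not even on \<open>v\<^sub>0\<close>. Vectors of highest
  weight are therefore compared with polynomials in the level applied to \<open>v\<^sub>0\<close>.
\<close>

definition v_Z :: "'v set" where
  "v_Z = span (range (\<lambda>j. (Z ^^ j) v\<^sub>0))"

definition E :: "'v set" where
  "E = {w \<in> U. (\<forall>h\<in>cartan G. rho 0 h w = vscale R (form G lam h) w)
     \<and> (\<forall>\<alpha>\<in>pos_roots G. \<forall>x\<in>root_space G \<alpha>. rho 0 x w = 0)}"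

lemma E_U: "w \<in> E \<Longrightarrow> w \<in> U"
  by (simp add: E_def)

lemma E_carr: "w \<in> E \<Longrightarrow> w \<in> carr R"
  by (intro U_carr E_U)

lemma subspace_E: "subspace E"
  by (rule subspaceI)
    (auto simp: E_def U_carr rho_simps scale_right_distrib scale_left_commute subspace_0[OF subspace_U]
      subspace_add[OF subspace_U] subspace_scale[OF subspace_U])

lemma v0_E: "v\<^sub>0 \<in> E"
  by (simp add: E_def v0_U v0_weight v0_pos)

lemma Z_E: "w \<in> E \<Longrightarrow> Z w \<in> E"
  by (auto simp: E_def Z_U U_carr act_simps simp flip: Z_rho)

lemma v_Z_E: "v_Z \<subseteq> E"
  unfolding v_Z_def
proof (intro span_minimal subspace_E image_subsetI)
  fix j show "(Z ^^ j) v\<^sub>0 \<in> E"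
    by (induction j) (simp_all add: v0_E Z_E)
qed

lemma Z_v_Z: "w \<in> v_Z \<Longrightarrow> Z w \<in> v_Z"
proof -
  assume "w \<in> v_Z"
  then have "w \<in> carr R \<and> Z w \<in> v_Z"
    unfolding v_Z_def
  proof (induction rule: span_induct_alt)
    case base
    then show ?case by (simp add: act_simps span_zero)
  next
    case (step c x y)
    then obtain j where j: "x = (Z ^^ j) v\<^sub>0" by blast
    then have "Z x = (Z ^^ Suc j) v\<^sub>0" by simp
    then have "Z x \<in> span (range (\<lambda>j. (Z ^^ j) v\<^sub>0))"
      by (simp only:) (rule span_base, rule rangeI)
    moreover have "x \<in> v_Z" unfolding v_Z_def j by (intro span_base) blast
    then have "x \<in> carr R" using v_Z_E E_carr by blast
    ultimately show ?case
      using step.IH by (simp add: act_simps span_add span_scale)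
  qed
  then show ?thesis ..
qed

text \<open>Words of length at most \<open>r\<close> in the zero modes.\<close>

primrec gfil :: "nat \<Rightarrow> 'v set" where
  "gfil 0 = v_Z"
| "gfil (Suc r) = span (gfil r \<union> {rho 0 x w | x w. w \<in> gfil r})"

lemmas [simp del] = gfil.simps(2)

lemma subspace_gfil: "subspace (gfil r)"
  by (cases r) (simp_all add: v_Z_def gfil.simps(2))

lemma gfil_U: "gfil r \<subseteq> U"
proof (induction r)
  case 0
  then show ?case using v_Z_E E_U by auto
next
  case (Suc r)
  then show ?case
    unfolding gfil.simps(2) using rho0_U by (intro span_minimal subspace_U) auto
qed

lemma gfil_UD: "w \<in> gfil r \<Longrightarrow> w \<in> U"
  using gfil_U by blast

lemma gfil_Suc: "w \<in> gfil r \<Longrightarrow> w \<in> gfil (Suc r)"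
  by (simp add: gfil.simps(2) span_base)

lemma gfil_mono: "r \<le> s \<Longrightarrow> gfil r \<subseteq> gfil s"
  by (rule lift_Suc_mono_le[of gfil]) (use gfil_Suc in auto)

lemma gfil_rho: "w \<in> gfil r \<Longrightarrow> rho 0 x w \<in> gfil (Suc r)"
  unfolding gfil.simps(2) by (auto intro: span_base)

lemma gfil_induct [consumes 1, case_names old rho add scale]:
  assumes "w \<in> gfil (Suc r)"
    and "\<And>w. w \<in> gfil r \<Longrightarrow> P w" "\<And>x w. w \<in> gfil r \<Longrightarrow> P (rho 0 x w)"
    and "\<And>w w'. \<lbrakk>w \<in> U; P w; w' \<in> U; P w'\<rbrakk> \<Longrightarrow> P (w + w')"
    and "\<And>c w. \<lbrakk>w \<in> U; P w\<rbrakk> \<Longrightarrow> P (vscale R c w)"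
  shows "P w"
proof -
  have "w \<in> U \<and> P w"
    using assms(1) unfolding gfil.simps(2)
  proof (induction rule: span_induct_alt)
    case base
    then show ?case
      using assms(2)[of 0] subspace_0[OF subspace_gfil] subspace_0[OF subspace_U] by simp
  next
    case (step c x y)
    then have "x \<in> U" "P x"
      using assms(2,3) by (auto intro: rho0_U dest: gfil_UD)
    then show ?case
      using step.IH assms(4,5) by (simp add: subspace_add[OF subspace_U] subspace_scale[OF subspace_U])
  qed
  then show ?thesis ..
qed

lemma gfil_Z: "w \<in> gfil r \<Longrightarrow> Z w \<in> gfil r"
proof (induction r arbitrary: w)
  case 0
  then show ?case by (simp add: Z_v_Z)
next
  case (Suc r)
  from Suc.prems show ?case
  proof (induction rule: gfil_induct)
    case (old w)
    then show ?case using Suc.IH by (intro gfil_Suc)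
  next
    case (rho x w)
    then have "w \<in> carr R" using gfil_U U_carr by blast
    then show ?case using rho Suc.IH by (simp only: Z_rho gfil_rho)
  next
    case (add w w')
    then show ?case by (simp only: U_carr act_simps subspace_add[OF subspace_gfil])
  next
    case (scale c w)
    then show ?case by (simp only: U_carr act_simps subspace_scale[OF subspace_gfil])
  qed
qed

lemma v0_gfil: "v\<^sub>0 \<in> gfil r"
proof -
  have "(Z ^^ 0) v\<^sub>0 \<in> v_Z"
    unfolding v_Z_def by (intro span_base rangeI)
  then show ?thesis using gfil_mono[of 0 r] by auto
qed

lemma gfil_exhaust: "(\<Union>r. gfil r) = U"
proof (rule U_irreducible[OF singular_moduleI])
  show "subspace (\<Union>r. gfil r)"
  proof (rule subspaceI)
    fix x y assume "x \<in> (\<Union>r. gfil r)" "y \<in> (\<Union>r. gfil r)"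
    then obtain r s where "x \<in> gfil r" "y \<in> gfil s" by blast
    then have "x \<in> gfil (max r s)" "y \<in> gfil (max r s)"
      using gfil_mono[of r "max r s"] gfil_mono[of s "max r s"] by auto
    then show "x + y \<in> (\<Union>r. gfil r)"
      using subspace_add[OF subspace_gfil] by blast
  next
    show "0 \<in> (\<Union>r. gfil r)"
      using subspace_0[OF subspace_gfil] by blast
    fix c x assume "x \<in> (\<Union>r. gfil r)"
    then show "vscale R c x \<in> (\<Union>r. gfil r)"
      using subspace_scale[OF subspace_gfil] by blast
  qed
  show "(\<Union>r. gfil r) \<subseteq> U"
    using gfil_UD by blast
  fix w assume "w \<in> (\<Union>r. gfil r)"
  then obtain r where r: "w \<in> gfil r" by blast
  show "rho 0 x w \<in> (\<Union>r. gfil r)" for x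
    using gfil_rho[OF r] by blast
  show "Z w \<in> (\<Union>r. gfil r)"
    using gfil_Z[OF r] by blast
next
  show "v\<^sub>0 \<in> (\<Union>r. gfil r)"
    using v0_gfil by blast
qed (rule v0_nonzero)

lemma gfil_raise:
  assumes "\<alpha> \<in> pos_roots G" "x \<in> root_space G \<alpha>" "w \<in> gfil r"
  shows "rho 0 x w \<in> gfil r"
  using assms(3)
proof (induction r arbitrary: w)
  case 0
  then have "rho 0 x w = 0" using v_Z_E assms by (auto simp: E_def)
  then show ?case by (simp only: subspace_0[OF subspace_gfil])
next
  case (Suc r)
  from Suc.prems show ?case
  proof (induction rule: gfil_induct)
    case (old w)
    then show ?case using Suc.IH by (intro gfil_Suc)
  next
    case (rho y w)
    then have "w \<in> carr R" using gfil_U U_carr by blast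
    then show ?case
      using rho Suc.IH by (simp only: rho0_rho0[of w x y] gfil_rho subspace_add[OF subspace_gfil])
  next
    case (add w w')
    then show ?case by (simp only: U_carr rho_simps subspace_add[OF subspace_gfil])
  next
    case (scale c w)
    then show ?case by (simp only: U_carr rho_simps subspace_scale[OF subspace_gfil])
  qed
qed

definition projects :: "'v \<Rightarrow> bool" where
  "projects w \<longleftrightarrow> (\<exists>a\<in>v_Z. \<forall>u\<in>E. inn R u w = inn R u a)"

lemma subspace_v_Z: "subspace v_Z"
  by (simp add: v_Z_def)

lemma v_Z_carr: "a \<in> v_Z \<Longrightarrow> a \<in> carr R"
  using v_Z_E E_carr by blast

lemma projects_0: "(\<And>u. u \<in> E \<Longrightarrow> inn R u w = 0) \<Longrightarrow> projects w"
  unfolding projects_def using subspace_0[OF subspace_v_Z] E_carr by force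

lemma projects_add: "\<lbrakk>projects w; projects w'; w \<in> carr R; w' \<in> carr R\<rbrakk> \<Longrightarrow> projects (w + w')"
  unfolding projects_def
proof (elim bexE)
  fix a b assume "w \<in> carr R" "w' \<in> carr R" "a \<in> v_Z" "b \<in> v_Z"
    "\<forall>u\<in>E. inn R u w = inn R u a" "\<forall>u\<in>E. inn R u w' = inn R u b"
  then show "\<exists>a\<in>v_Z. \<forall>u\<in>E. inn R u (w + w') = inn R u a"
    by (intro bexI[of _ "a + b"]) (auto simp: E_carr v_Z_carr subspace_add[OF subspace_v_Z])
qed

lemma projects_scale: "\<lbrakk>projects w; w \<in> carr R\<rbrakk> \<Longrightarrow> projects (vscale R c w)"
  unfolding projects_def
proof (elim bexE)
  fix a assume "w \<in> carr R" "a \<in> v_Z" "\<forall>u\<in>E. inn R u w = inn R u a"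
  then show "\<exists>a\<in>v_Z. \<forall>u\<in>E. inn R u (vscale R c w) = inn R u a"
    by (intro bexI[of _ "vscale R c a"]) (auto simp: E_carr v_Z_carr subspace_scale[OF subspace_v_Z])
qed

text \<open>Look at the leftmost letter. Against E, a Cartan element acts as a scalar; a positive
  root vector leads back to shorter words by \<open>gfil_raise\<close>; the adjoint of a negative
  root vector is a positive one and kills E.\<close>

lemma gfil_projects: "w \<in> gfil r \<Longrightarrow> projects w"
proof (induction r arbitrary: w)
  case 0
  then show ?case by (auto simp: projects_def)
next
  case (Suc r)
  from Suc.prems show ?case
  proof (induction rule: gfil_induct)
    case (old w)
    then show ?case by (rule Suc.IH)
  next
    case (rho x w)
    then have w: "w \<in> carr R" using gfil_U U_carr by blast
    have "x \<in> g.span letters" using letters(4) by simp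
    then show ?case
    proof (induction rule: g.span_induct_alt)
      case base
      then show ?case by (rule projects_0) (simp add: rho_zero_left E_carr)
    next
      case (step c b y)
      have "projects (rho 0 b w)"
      proof (rule letter_cases[OF step.hyps])
        assume b: "b \<in> cartan G"
        \<comment> \<open>Comparing b with its adjoint on \<open>v\<^sub>0\<close> shows that the
          weight is compatible with the involution.\<close>
        have "form G lam b * inn R v\<^sub>0 v\<^sub>0 = cnj (form G lam (gstar G b)) * inn R v\<^sub>0 v\<^sub>0"
          using rho_adjoint_right[of "v\<^sub>0" "v\<^sub>0" 0 b] cartan_gstar[OF b] b
          by (simp add: v0_weight del: mult_cancel_right)
        then have real: "cnj (form G lam (gstar G b)) = form G lam b"
          using inn_self_eq_0[of "v\<^sub>0"] v0_nonzero by auto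
        have "inn R u (rho 0 b w) = form G lam b * inn R u w" if "u \<in> E" for u
          using w that E_carr[OF that] cartan_gstar[OF b] by (simp add: rho_adjoint_right E_def real)
        then have "projects (rho 0 b w) = projects (vscale R (form G lam b) w)"
          using w E_carr by (simp add: projects_def)
        then show ?thesis
          using projects_scale[OF Suc.IH[OF rho] w] by simp
      next
        fix \<alpha> assume \<alpha>: "\<alpha> \<in> roots G" "b \<in> root_space G \<alpha>"
        show ?thesis
        proof (cases "\<alpha> \<in> pos_roots G")
          case True
          then show ?thesis
            using gfil_raise[OF True \<alpha>(2) rho] by (rule_tac Suc.IH)
        next
          case False
          then have "- \<alpha> \<in> pos_roots G"
            using pos_roots(2)[OF \<alpha>(1)] by blast
          then have "rho 0 (gstar G b) u = 0" if "u \<in> E" for u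
            using that root_space_gstar[OF \<alpha>] by (auto simp: E_def)
          then show ?thesis
            using w E_carr by (intro projects_0) (simp add: rho_adjoint_right)
        qed
      qed
      then show ?case
        using step.IH w by (simp add: rho_add_left rho_scale_left projects_add projects_scale)
    qed
  next
    case (add w w')
    then show ?case by (intro projects_add U_carr)
  next
    case (scale c w)
    then show ?case by (intro projects_scale U_carr)
  qed
qed

lemma E_eq: "E = v_Z"
proof
  show "E \<subseteq> v_Z"
  proof
    fix w assume w: "w \<in> E"
    then have "projects w"
      using gfil_projects gfil_exhaust E_U by blast
    then obtain a where a: "a \<in> v_Z" "\<And>u. u \<in> E \<Longrightarrow> inn R u w = inn R u a"
      unfolding projects_def by blast
    have "w - a \<in> E"
      using a w v_Z_E by (intro subspace_diff[OF subspace_E]) auto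
    then have "inn R (w - a) (w - a) = 0"
      using a w v_Z_carr E_carr by simp
    then show "w \<in> v_Z"
      using a w v_Z_carr E_carr inn_self_eq_0[of "w - a"] by auto
  qed
qed (rule v_Z_E)

end

section \<open>Polynomials in the central element\<close>

context affine_hw
begin

definition ev :: "complex poly \<Rightarrow> 'v \<Rightarrow> 'v" where
  "ev q w = (\<Sum>i\<le>degree q. vscale R (coeff q i) ((Z ^^ i) w))"

lemma Z_pow_carr: "w \<in> carr R \<Longrightarrow> (Z ^^ i) w \<in> carr R"
  by (induction i) auto

lemma ev_altdef: "degree q \<le> n \<Longrightarrow> ev q w = (\<Sum>i\<le>n. vscale R (coeff q i) ((Z ^^ i) w))"
  unfolding ev_def by (rule sum.mono_neutral_left) (auto simp: coeff_eq_0)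

lemma ev_add: "ev (p + q) w = ev p w + ev q w"
proof -
  let ?n = "max (degree p) (degree q)"
  have "degree (p + q) \<le> ?n" by (rule degree_add_le_max)
  then show ?thesis
    by (simp add: ev_altdef[of _ ?n] scale_left_distrib sum.distrib)
qed

lemma ev_smult: "ev (smult c q) w = vscale R c (ev q w)"
  using ev_altdef[of "smult c q" "degree q" w] degree_smult_le[of c q]
  by (simp add: ev_def scale_sum_right)

lemma ev_monom: "ev (monom c j) w = vscale R c ((Z ^^ j) w)"
proof -
  have "ev (monom c j) w = (\<Sum>i\<le>j. if i = j then vscale R c ((Z ^^ j) w) else 0)"
    unfolding ev_altdef[OF degree_monom_le] by (intro sum.cong) auto
  then show ?thesis by simp
qed

lemma ev_pCons:
  assumes "w \<in> carr R"
  shows "ev (pCons a q) w = vscale R a w + Z (ev q w)"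
proof -
  have "ev (pCons a q) w = (\<Sum>i\<le>Suc (degree q). vscale R (coeff (pCons a q) i) ((Z ^^ i) w))"
    by (rule ev_altdef) (rule degree_pCons_le)
  also have "\<dots> = vscale R a w + (\<Sum>i\<le>degree q. vscale R (coeff q i) (Z ((Z ^^ i) w)))"
    by (subst sum.atMost_Suc_shift) simp
  also have "(\<Sum>i\<le>degree q. vscale R (coeff q i) (Z ((Z ^^ i) w))) = Z (ev q w)"
    using assms by (simp add: ev_def act_simps Z_pow_carr)
  finally show ?thesis .
qed

lemma ev_carr: "w \<in> carr R \<Longrightarrow> ev q w \<in> carr R"
  by (simp add: ev_def Z_pow_carr)

lemma v_Z_ev:
  assumes "w \<in> v_Z"
  obtains q where "w = ev q v\<^sub>0"
proof -
  have "\<exists>q. w = ev q v\<^sub>0"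
    using assms unfolding v_Z_def
  proof (induction rule: span_induct_alt)
    case base
    then show ?case by (intro exI[of _ 0]) (simp add: ev_def)
  next
    case (step c x y)
    then obtain j q where "x = (Z ^^ j) v\<^sub>0" "y = ev q v\<^sub>0" by blast
    then show ?case by (intro exI[of _ "monom c j + q"]) (simp add: ev_add ev_monom)
  qed
  with that show thesis by blast
qed

text \<open>An eigenspace of a central operator is invariant, so one eigenvector suffices for
  \<open>Z\<close> to be a scalar.\<close>

lemma kernel_Z:
  assumes "w \<in> carr R" "w \<noteq> 0" "Z w = vscale R c w" "u \<in> carr R"
  shows "Z u = vscale R c u"
proof -
  have "invariant_subspace R {u \<in> carr R. Z u = vscale R c u}"
  proof (rule invariant_subspaceI)
    show "subspace {u \<in> carr R. Z u = vscale R c u}"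
      by (rule subspace_lin_eq) (rule lin_act, rule lin_scaleI, rule lin_idI)
  qed (auto simp: Z_rho rho_simps act_simps)
  then have "{u \<in> carr R. Z u = vscale R c u} = carr R"
    by (rule irreducibleD[of _ w]) (use assms in auto)
  with assms(4) show ?thesis by blast
qed

text \<open>
  If \<open>Z\<close> is not zero, it is bijective, and \<open>v\<^sub>0 = Z x\<close> with \<open>x\<close> of highest weight, i.e. a polynomial in
  \<open>Z\<close> applied to \<open>v\<^sub>0\<close>.
\<close>

lemma level_algebraic:
  assumes "Z v\<^sub>0 \<noteq> 0"
  obtains q where "q \<noteq> 0" "ev q v\<^sub>0 = 0"
proof -
  have inj: "w = 0" if "w \<in> carr R" "Z w = 0" for w
    using kernel_Z[of w 0 "v\<^sub>0"] that assms by fastforce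
  have "invariant_subspace R (Z ` carr R)"
  proof (rule invariant_subspaceI)
    show "subspace (Z ` carr R)"
    proof (rule subspaceI)
      show "0 \<in> Z ` carr R" by (rule image_eqI[of _ _ 0]) (simp_all add: act_simps)
      fix x y assume "x \<in> Z ` carr R" "y \<in> Z ` carr R"
      then show "x + y \<in> Z ` carr R"
        by (auto simp: image_iff) (metis act_simps(1) carr_add)
    next
      fix c x assume "x \<in> Z ` carr R"
      then show "vscale R c x \<in> Z ` carr R"
        by (auto simp: image_iff) (metis act_simps(2) carr_scale)
    qed
    show "rho n x w \<in> Z ` carr R" if "w \<in> Z ` carr R" for n x w
      using that by (auto simp flip: Z_rho)
  qed auto
  then have "Z ` carr R = carr R"
    by (rule irreducibleD[of _ "Z v\<^sub>0"]) (use assms in auto)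
  then have "v\<^sub>0 \<in> Z ` carr R"
    using v0_carr by simp
  then obtain x where x: "x \<in> carr R" "Z x = v\<^sub>0"
    by (rule imageE) simp
  have "x \<in> E"
  proof -
    have "rho n y x = 0" if "n > 0" for n y
      by (rule inj) (use x U_raise[OF v0_U that, of y] in \<open>simp_all add: Z_rho\<close>)
    then have "x \<in> U"
      using x by (simp add: U_def)
    moreover have "rho 0 h x - vscale R (form G lam h) x = 0" if "h \<in> cartan G" for h
      by (rule inj) (use x v0_weight[OF that] in \<open>simp_all add: Z_rho act_simps\<close>)
    moreover have "rho 0 y x = 0" if "\<alpha> \<in> pos_roots G" "y \<in> root_space G \<alpha>" for \<alpha> y
      by (rule inj) (use x v0_pos[OF that] in \<open>simp_all add: Z_rho\<close>)
    ultimately show ?thesis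
      by (auto simp: E_def)
  qed
  then obtain q where q: "x = ev q v\<^sub>0"
    using E_eq v_Z_ev by blast
  \<comment> \<open>From \<open>v\<^sub>0 = Z x\<close> and x = q(Z) \<open>v\<^sub>0\<close> the
    polynomial t q(t) - 1 annihilates \<open>v\<^sub>0\<close>. Its constant coefficient makes it
    nonzero.\<close>
  have "ev (pCons (- 1) q) v\<^sub>0 = 0"
    using x q by (simp add: ev_pCons)
  moreover have "pCons (- 1) q \<noteq> 0" by simp
  ultimately show thesis by (rule that[rotated])
qed

text \<open>Split a root z off an annihilating polynomial of \<open>v\<^sub>0\<close> of least
  degree. The cofactor applied to \<open>v\<^sub>0\<close> is nonzero by minimality, and it is an
  eigenvector for z.\<close>

lemma level_scalar: "\<exists>c. \<forall>w\<in>carr R. Z w = vscale R c w"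
proof -
  have "\<exists>c w. w \<in> carr R \<and> w \<noteq> 0 \<and> Z w = vscale R c w"
  proof (cases "Z v\<^sub>0 = 0")
    case True
    then show ?thesis
      using v0_nonzero by (intro exI[of _ 0] exI[of _ "v\<^sub>0"]) simp
  next
    case False
    then obtain q\<^sub>0 where "q\<^sub>0 \<noteq> 0" "ev q\<^sub>0 v\<^sub>0 = 0"
      by (rule level_algebraic)
    then have "\<exists>q. (q \<noteq> 0 \<and> ev q v\<^sub>0 = 0) \<and> (\<forall>p. p \<noteq> 0 \<and> ev p v\<^sub>0 = 0 \<longrightarrow> degree q \<le> degree p)"
      by (intro ex_has_least_nat[of _ q\<^sub>0]) simp
    then obtain q where q: "q \<noteq> 0" "ev q v\<^sub>0 = 0"
      and min: "\<And>p. \<lbrakk>p \<noteq> 0; ev p v\<^sub>0 = 0\<rbrakk> \<Longrightarrow> degree q \<le> degree p"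
      by blast
    have "degree q \<noteq> 0"
    proof
      assume "degree q = 0"
      then have "q = [:coeff q 0:]" by (metis degree_0_id)
      then show False
        using q v0_nonzero ev_pCons[of "v\<^sub>0" "coeff q 0" 0] by (auto simp: ev_def act_simps)
    qed
    then obtain z where "poly q z = 0"
      using fundamental_theorem_of_algebra[of q] constant_degree[of q] by auto
    then obtain p where p: "q = [:- z, 1:] * p"
      using poly_eq_0_iff_dvd[of q z] by (auto simp: dvd_def)
    then have "p \<noteq> 0" using q(1) by auto
    have "degree q = Suc (degree p)"
      using \<open>p \<noteq> 0\<close> unfolding p by (subst degree_mult_eq) auto
    then have "ev p v\<^sub>0 \<noteq> 0"
      using min[of p] \<open>p \<noteq> 0\<close> by auto
    moreover have "Z (ev p v\<^sub>0) = vscale R z (ev p v\<^sub>0)"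
    proof -
      have "q = smult (- z) p + pCons 0 p"
        unfolding p by simp
      then have "ev q v\<^sub>0 = Z (ev p v\<^sub>0) - vscale R z (ev p v\<^sub>0)"
        by (simp add: ev_add ev_smult ev_pCons del: smult_minus_left)
      then show ?thesis using q(2) by simp
    qed
    ultimately show ?thesis
      using ev_carr[OF v0_carr] by blast
  qed
  then show ?thesis
    using kernel_Z by blast
qed

definition level :: complex where
  "level = (SOME c. \<forall>w\<in>carr R. Z w = vscale R c w)"

lemma Z_eq: "w \<in> carr R \<Longrightarrow> Z w = vscale R level w"
  using someI_ex[OF level_scalar] unfolding level_def by blast

lemma v_Z_eq: "v_Z = range (\<lambda>c. vscale R c v\<^sub>0)"
proof -
  have "(Z ^^ j) v\<^sub>0 = vscale R (level ^ j) v\<^sub>0" for j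
    by (induction j) (simp_all add: act_simps Z_eq mult.commute)
  then have "v_Z = span (range (\<lambda>j. vscale R (level ^ j) v\<^sub>0))"
    by (simp add: v_Z_def)
  also have "\<dots> = span {v\<^sub>0}"
  proof (rule span_unique[symmetric, THEN sym])
    show "range (\<lambda>j. vscale R (level ^ j) v\<^sub>0) \<subseteq> span {v\<^sub>0}"
      by (auto intro: span_scale span_base)
    fix W assume "range (\<lambda>j. vscale R (level ^ j) v\<^sub>0) \<subseteq> W" "subspace W"
    moreover have "v\<^sub>0 = vscale R (level ^ 0) v\<^sub>0" by simp
    ultimately have "v\<^sub>0 \<in> W" by blast
    then show "span {v\<^sub>0} \<subseteq> W"
      using \<open>subspace W\<close> by (intro span_minimal) auto
  qed auto
  finally show ?thesis
    by (simp add: span_singleton)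
qed

subsection \<open>Boundedness through the Casimir element\<close>

definition casimir :: "'v \<Rightarrow> 'v" where
  "casimir w = (\<Sum>a\<in>UNIV. rho 0 (basis G a) (rho 0 (basis G a) w))"

lemma lin_casimir: "lin casimir"
proof -
  have "lin (\<lambda>w. casimir w)"
    unfolding casimir_def by (rule lin_sumI, rule lin_compI) (rule lin_rho)+
  then show ?thesis .
qed

text \<open>The two terms of each commutator with a square cancel after summation, because
  \<open>Gam G a b c\<close> is antisymmetric in a and c.\<close>

lemma casimir_rho_basis:
  assumes w: "w \<in> carr R"
  shows "casimir (rho 0 (basis G b) w) = rho 0 (basis G b) (casimir w)"
proof -
  let ?r = "\<lambda>a. rho 0 (basis G a)"
  have comm: "rho 0 (brk G (basis G a) (basis G b)) u
      = vscale R \<i> (\<Sum>c\<in>UNIV. vscale R (complex_of_real (Gam G a b c)) (?r c u))" for a u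
    by (simp add: brk_basis rho_scale_left rho_sum_left)
  have swap: "?r a (?r a (?r b w)) = ?r b (?r a (?r a w))
      + (rho 0 (brk G (basis G a) (basis G b)) (?r a w) + ?r a (rho 0 (brk G (basis G a) (basis G b)) w))" for a
    using w by (simp add: rho0_rho0[of w "basis G a" "basis G b"] rho0_rho0[of "?r a w" "basis G a" "basis G b"]
        rho_simps add.assoc)
  have "(\<Sum>a\<in>UNIV. rho 0 (brk G (basis G a) (basis G b)) (?r a w))
      = vscale R \<i> (\<Sum>a\<in>UNIV. \<Sum>c\<in>UNIV. vscale R (complex_of_real (Gam G a b c)) (?r c (?r a w)))"
    by (simp add: comm scale_sum_right)
  also have "\<dots> = vscale R \<i> (\<Sum>a\<in>UNIV. \<Sum>c\<in>UNIV. - vscale R (complex_of_real (Gam G a b c)) (?r a (?r c w)))"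
  proof -
    have "vscale R (complex_of_real (Gam G c b a)) u = - vscale R (complex_of_real (Gam G a b c)) u" for a c u
      unfolding Gam_swap_outer[of c b a] by simp
    then show ?thesis
      by (subst sum.swap) (intro arg_cong[where f = "vscale R \<i>"] sum.cong refl)
  qed
  also have "\<dots> = - (\<Sum>a\<in>UNIV. ?r a (rho 0 (brk G (basis G a) (basis G b)) w))"
    using w by (simp add: comm rho_simps scale_sum_right sum_negf)
  finally have "(\<Sum>a\<in>UNIV. rho 0 (brk G (basis G a) (basis G b)) (?r a w)
      + ?r a (rho 0 (brk G (basis G a) (basis G b)) w)) = 0"
    by (simp add: sum.distrib)
  then show ?thesis
    using w by (simp add: casimir_def swap sum.distrib rho_simps)
qed

lemma casimir_rho:
  assumes w: "w \<in> carr R"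
  shows "casimir (rho 0 x w) = rho 0 x (casimir w)"
proof -
  have "rho 0 x u = (\<Sum>b\<in>UNIV. vscale R (coord G b x) (rho 0 (basis G b) u))" for u
    by (simp add: rho_def[of 0 x] rho_basis)
  then show ?thesis
    using w lin_casimir by (simp add: lin_sum lin_scale casimir_rho_basis)
qed

lemma casimir_U: "w \<in> U \<Longrightarrow> casimir w \<in> U"
  unfolding casimir_def by (intro subspace_sum[OF subspace_U] rho0_U)

text \<open>Commuting with the zero modes, \<open>casimir\<close> maps \<open>v\<^sub>0\<close> into
  E, which is by now a line. The eigenspace through \<open>v\<^sub>0\<close> is a module of singular
  vectors.\<close>

lemma casimir_scalar: "\<exists>c. \<forall>w\<in>U. casimir w = vscale R c w"
proof -
  have "casimir v\<^sub>0 \<in> E"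
    using casimir_U[OF v0_U] lin_casimir
    by (auto simp: E_def v0_weight v0_pos lin_scale lin_zero simp flip: casimir_rho)
  then obtain c where c: "casimir v\<^sub>0 = vscale R c v\<^sub>0"
    using E_eq v_Z_eq by auto
  have "{w \<in> U. casimir w = vscale R c w} = U"
  proof (rule U_irreducible[OF singular_moduleI])
    show "subspace {w \<in> U. casimir w = vscale R c w}"
      using lin_casimir by (intro subspaceI)
        (auto simp: U_carr lin_simps scale_right_distrib mult.commute subspace_0[OF subspace_U]
          subspace_add[OF subspace_U] subspace_scale[OF subspace_U])
    fix w assume "w \<in> {w \<in> U. casimir w = vscale R c w}"
    then show "rho 0 x w \<in> {w \<in> U. casimir w = vscale R c w}" for x
      by (auto simp: casimir_rho U_carr rho_simps rho0_U)
    show "Z w \<in> {w \<in> U. casimir w = vscale R c w}"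
      using \<open>w \<in> {w \<in> U. casimir w = vscale R c w}\<close> lin_casimir Z_U
      by (auto simp: Z_eq U_carr lin_scale mult.commute subspace_scale[OF subspace_U])
  next
    show "v\<^sub>0 \<in> {w \<in> U. casimir w = vscale R c w}"
      using c v0_U by simp
  qed (use v0_nonzero in auto)
  then show ?thesis by blast
qed

text \<open>Expand the sum over \<open>a\<close> of the squared norms of \<open>X_a w - r \<alpha>_a w\<close>.\<close>

lemma weight_bound:
  "\<exists>C. \<forall>\<alpha> w t r. gstar G \<alpha> = \<alpha> \<and> w \<in> U \<and> w \<noteq> 0 \<and> rho 0 \<alpha> w = vscale R t w
    \<longrightarrow> 0 \<le> C - 2 * r * Re t + r\<^sup>2 * Re (form G \<alpha> \<alpha>)"
proof -
  obtain c where c: "\<And>w. w \<in> U \<Longrightarrow> casimir w = vscale R c w"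
    using casimir_scalar by blast
  have "0 \<le> Re c - 2 * r * Re t + r\<^sup>2 * Re (form G \<alpha> \<alpha>)"
    if \<alpha>: "gstar G \<alpha> = \<alpha>" and w: "w \<in> U" "w \<noteq> 0" and t: "rho 0 \<alpha> w = vscale R t w" for \<alpha> w t r
  proof -
    have wc: "w \<in> carr R" using w by (intro U_carr)
    have real: "cnj (coord G a \<alpha>) = coord G a \<alpha>" for a
      using coord_gstar[of a \<alpha>] \<alpha> by simp
    have star: "gstar G (basis G a) = basis G a" for a
      by (rule coord_ext) (simp add: coord_gstar coord_basis)
    let ?r = "\<lambda>a. rho 0 (basis G a)" and ?r' = "complex_of_real r"
    let ?u = "\<lambda>a. ?r a w - vscale R (?r' * coord G a \<alpha>) w"
    have sq: "inn R (?u a) (?u a) = inn R w (?r a (?r a w)) - 2 * ?r' * (coord G a \<alpha> * inn R w (?r a w))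
        + ?r'\<^sup>2 * (coord G a \<alpha> * coord G a \<alpha>) * inn R w w" for a
      using wc rho_adjoint[of w "?r a w" 0 "basis G a"] rho_adjoint[of w w 0 "basis G a"]
      by (simp add: star real algebra_simps power2_eq_square)
    have "(\<Sum>a\<in>UNIV. inn R (?u a) (?u a)) = (\<Sum>a\<in>UNIV. inn R w (?r a (?r a w)))
        - 2 * ?r' * (\<Sum>a\<in>UNIV. coord G a \<alpha> * inn R w (?r a w)) + ?r'\<^sup>2 * form G \<alpha> \<alpha> * inn R w w"
      by (simp only: sq form_def sum.distrib sum_subtractf sum_distrib_left sum_distrib_right)
    also have "(\<Sum>a\<in>UNIV. inn R w (?r a (?r a w))) = c * inn R w w"
      using wc c[OF w(1)] by (simp add: casimir_def flip: inn_sum_right)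
    also have "(\<Sum>a\<in>UNIV. coord G a \<alpha> * inn R w (?r a w)) = t * inn R w w"
    proof -
      have "inn R w (rho 0 \<alpha> w) = (\<Sum>a\<in>UNIV. coord G a \<alpha> * inn R w (?r a w))"
        using wc by (simp add: rho_def[of 0 \<alpha>] rho_basis inn_sum_right)
      then show ?thesis using wc t by simp
    qed
    finally have "(\<Sum>a\<in>UNIV. inn R (?u a) (?u a)) = (c - 2 * ?r' * t + ?r'\<^sup>2 * form G \<alpha> \<alpha>) * inn R w w"
      by (simp only: algebra_simps)
    also have "\<dots> = (c - 2 * ?r' * t + ?r'\<^sup>2 * form G \<alpha> \<alpha>) * complex_of_real (Re (inn R w w))"
      using inn_self_real[OF wc] by simp
    finally have "(\<Sum>a\<in>UNIV. Re (inn R (?u a) (?u a)))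
        = (Re c - 2 * r * Re t + r\<^sup>2 * Re (form G \<alpha> \<alpha>)) * Re (inn R w w)"
      unfolding Re_sum[symmetric] by (simp only:) (simp add: power2_eq_square)
    moreover have "0 \<le> (\<Sum>a\<in>UNIV. Re (inn R (?u a) (?u a)))"
      using wc by (intro sum_nonneg inn_self_nonneg) simp
    ultimately have "0 \<le> (Re c - 2 * r * Re t + r\<^sup>2 * Re (form G \<alpha> \<alpha>)) * Re (inn R w w)"
      by simp
    then show ?thesis
      using inn_pos[OF wc w(2)] by (simp add: zero_le_mult_iff)
  qed
  then show ?thesis by blast
qed

text \<open>Powers of \<open>b\<close> would move the eigenvalue of \<open>\<alpha>\<close> out of the bounds given by the Casimir element.\<close>

lemma root_nilpotent:
  assumes \<alpha>: "\<alpha> \<in> roots G" and b: "b \<in> root_space G \<alpha>"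
  shows "\<exists>K. \<forall>w t. w \<in> U \<longrightarrow> rho 0 \<alpha> w = vscale R t w \<longrightarrow> (rho 0 b ^^ K) w = 0"
proof -
  obtain C where C: "\<And>w t r. \<lbrakk>w \<in> U; w \<noteq> 0; rho 0 \<alpha> w = vscale R t w\<rbrakk>
      \<Longrightarrow> 0 \<le> C - 2 * r * Re t + r\<^sup>2 * Re (form G \<alpha> \<alpha>)"
    using weight_bound root_gstar[OF \<alpha>] by metis
  have \<alpha>c: "\<alpha> \<in> cartan G" "\<alpha> \<noteq> 0"
    using \<alpha> by (auto simp: roots_def)
  let ?s = "Re (form G \<alpha> \<alpha>)"
  have real: "form G \<alpha> \<alpha> = complex_of_real ?s"
    using form_gstar_self[of \<alpha>] root_gstar[OF \<alpha>] by simp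
  have s: "?s > 0"
    using form_gstar_pos[OF \<alpha>c(2)] root_gstar[OF \<alpha>] by simp
  \<comment> \<open>Let s be the squared length of \<alpha>. The bound with r = -1 at w and with r =
    1 at the K-th power, whose eigenvalue is t + K s, add up to K s \<le> C + s. The eigenvalue t
    drops out, so K is uniform.\<close>
  obtain K where K: "real K > (C + ?s) / ?s"
    using reals_Archimedean2 by blast
  have "(rho 0 b ^^ K) w = 0" if w: "w \<in> U" and t: "rho 0 \<alpha> w = vscale R t w" for w t
  proof (rule ccontr)
    assume nz: "(rho 0 b ^^ K) w \<noteq> 0"
    have pow: "(rho 0 b ^^ k) w \<in> U \<and> rho 0 \<alpha> ((rho 0 b ^^ k) w) = vscale R (t + of_nat k * form G \<alpha> \<alpha>) ((rho 0 b ^^ k) w)" for k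
    proof (induction k)
      case 0
      then show ?case using w t by simp
    next
      case (Suc k)
      let ?u = "(rho 0 b ^^ k) w"
      have "brk G \<alpha> b = gscale G (form G \<alpha> \<alpha>) b"
        using b \<alpha>c by (simp add: root_space_def)
      then have "rho 0 \<alpha> (rho 0 b ?u) = rho 0 b (rho 0 \<alpha> ?u) + vscale R (form G \<alpha> \<alpha>) (rho 0 b ?u)"
        using Suc U_carr rho0_rho0[of ?u \<alpha> b] by (simp add: rho_scale_left)
      then show ?case
        using Suc U_carr by (simp add: rho0_U rho_simps algebra_simps flip: scale_left_distrib)
    qed
    have "w \<noteq> 0"
    proof
      assume "w = 0"
      then have "(rho 0 b ^^ k) w = 0" for k
        by (induction k) (simp_all add: rho_simps)
      with nz show False by blast
    qed
    have "0 \<le> C + 2 * Re t + ?s"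
      using C[OF w \<open>w \<noteq> 0\<close> t, of "- 1"] by simp
    moreover have "0 \<le> C - 2 * (Re t + real K * ?s) + ?s"
      using C[OF _ nz, of "t + of_nat K * form G \<alpha> \<alpha>" 1] pow[of K] by simp
    ultimately have "real K * ?s \<le> C + ?s"
      by simp
    with K s show False
      by (simp add: field_simps)
  qed
  then show ?thesis by blast
qed

subsection \<open>The singular vectors form a finite-dimensional space\<close>

definition word :: "'g list \<Rightarrow> 'v" where
  "word xs = foldr (rho 0) xs v\<^sub>0"

lemma word_simps [simp]: "word [] = v\<^sub>0" "word (x # xs) = rho 0 x (word xs)"
  by (simp_all add: word_def)

lemma word_gfil: "word xs \<in> gfil (length xs)"
proof (induction xs)
  case Nil
  then show ?case using v0_gfil[of 0] by simp
next
  case (Cons x xs)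
  then show ?case using gfil_rho[of "word xs" "length xs" x] by simp
qed

lemma word_U: "word xs \<in> U"
  using word_gfil gfil_UD by blast

lemma gfil_eq_span_words: "gfil r = span {word xs | xs. set xs \<subseteq> letters \<and> length xs \<le> r}"
proof (induction r)
  case 0
  have "{word xs | xs. set xs \<subseteq> letters \<and> length xs \<le> 0} = {v\<^sub>0}"
    by force
  then show ?case
    by (simp add: v_Z_eq span_singleton)
next
  case (Suc r)
  let ?S = "\<lambda>r. {word xs | xs. set xs \<subseteq> letters \<and> length xs \<le> r}"
  show ?case
  proof
    have "word xs \<in> gfil (Suc r)" if "length xs \<le> Suc r" for xs
      using word_gfil[of xs] gfil_mono[OF that] by blast
    then show "span (?S (Suc r)) \<subseteq> gfil (Suc r)"
      by (intro span_minimal subspace_gfil) auto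
    have "rho 0 x w \<in> span (?S (Suc r))" if w: "w \<in> gfil r" for x w
    proof -
      have "x \<in> g.span letters" using letters(4) by simp
      then show ?thesis
      proof (induction rule: g.span_induct_alt)
        case base
        then show ?case by (simp add: rho_zero_left span_zero)
      next
        case (step c b y)
        have "w \<in> carr R \<and> rho 0 b w \<in> span (?S (Suc r))"
          using w unfolding Suc
        proof (induction rule: span_induct_alt)
          case base
          then show ?case by (simp add: rho_simps span_zero)
        next
          case (step d u w)
          then obtain xs where xs: "u = word xs" "set xs \<subseteq> letters" "length xs \<le> r" by blast
          then have "rho 0 b u \<in> ?S (Suc r)"
            using \<open>b \<in> letters\<close> by (intro CollectI exI[of _ "b # xs"]) auto
          then show ?case
            using step.IH U_carr[OF word_U, of xs] xs(1)
            by (simp add: rho_simps span_add span_scale span_base del: word_simps)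
        qed
        then show ?case
          using step.IH by (simp add: rho_add_left rho_scale_left span_add span_scale)
      qed
    qed
    moreover have "gfil r \<subseteq> span (?S (Suc r))"
      unfolding Suc by (rule span_mono) force
    ultimately show "gfil (Suc r) \<subseteq> span (?S (Suc r))"
      unfolding gfil.simps(2) by (intro span_minimal) auto
  qed
qed

text \<open>
  Up to shorter words the letters commute, so a word with too many equal letters, i.e. any word that is
  too long, is a combination of shorter ones.
\<close>

lemma word_move_front: "word (xs @ a # ys) - word (a # xs @ ys) \<in> gfil (length xs + length ys)"
proof (induction xs)
  case Nil
  then show ?case using subspace_0[OF subspace_gfil] by simp
next
  case (Cons b xs)
  let ?w = "word (xs @ ys)"
  have U: "?w \<in> carr R" "word (xs @ a # ys) \<in> carr R"
    using word_U U_carr by blast+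
  have "rho 0 b (word (xs @ a # ys) - word (a # xs @ ys)) \<in> gfil (Suc (length xs + length ys))"
    using Cons.IH by (rule gfil_rho)
  moreover have "rho 0 (brk G b a) ?w \<in> gfil (Suc (length xs + length ys))"
    using word_gfil[of "xs @ ys"] by (intro gfil_rho) simp
  moreover have "word ((b # xs) @ a # ys) - word (a # (b # xs) @ ys)
      = rho 0 b (word (xs @ a # ys) - word (a # xs @ ys)) + rho 0 (brk G b a) ?w"
    using U by (simp add: rho_simps rho0_rho0[of ?w b a])
  ultimately show ?case
    using subspace_add[OF subspace_gfil] by simp
qed

text \<open>Modulo shorter words, K occurrences of b can be brought to the front one by one, where
  their joint effect is a power of \<open>rho 0 b\<close>.\<close>

lemma word_collect:
  "count_list xs b \<ge> K \<Longrightarrow> \<exists>ys. set ys \<subseteq> set xs \<and> length xs = K + length ys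
     \<and> word xs - (rho 0 b ^^ K) (word ys) \<in> gfil (length xs - 1)"
proof (induction K arbitrary: xs)
  case 0
  then show ?case using subspace_0[OF subspace_gfil] by (intro exI[of _ xs]) simp
next
  case (Suc K)
  then have "b \<in> set xs"
    by (metis count_notin not_less_eq_eq zero_le)
  then obtain us zs where xs: "xs = us @ b # zs"
    by (meson split_list)
  then obtain ys where ys: "set ys \<subseteq> set (us @ zs)" "length (us @ zs) = K + length ys"
      "word (us @ zs) - (rho 0 b ^^ K) (word ys) \<in> gfil (length (us @ zs) - 1)"
    using Suc.IH[of "us @ zs"] Suc.prems by auto
  have c: "word (us @ zs) \<in> carr R" "(rho 0 b ^^ K) (word ys) \<in> carr R"
  proof -
    show "word (us @ zs) \<in> carr R" using word_U U_carr by blast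
    show "(rho 0 b ^^ K) (word ys) \<in> carr R"
      by (induction K) (use word_U U_carr in auto)
  qed
  have 1: "rho 0 b (word (us @ zs) - (rho 0 b ^^ K) (word ys)) \<in> gfil (length xs - 1)"
  \<comment> \<open>The truncated subtraction matters: for a one-letter word \<open>gfil_rho\<close>
    would give length 1 instead of 0, but there the difference is zero.\<close>
  proof (cases "length (us @ zs)")
    case 0
    then have "K = 0" "ys = []" "us @ zs = []" using ys(2) by auto
    then show ?thesis using subspace_0[OF subspace_gfil] by (simp add: rho_simps)
  next
    case (Suc n)
    then show ?thesis
      using gfil_rho[OF ys(3), of b] by (simp add: xs)
  qed
  have 2: "word xs - word (b # us @ zs) \<in> gfil (length xs - 1)"
    using word_move_front[of us b zs] by (simp add: xs)
  have eq: "word xs - (rho 0 b ^^ Suc K) (word ys)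
      = (word xs - word (b # us @ zs)) + rho 0 b (word (us @ zs) - (rho 0 b ^^ K) (word ys))"
    using c by (simp add: rho_simps)
  have "word xs - (rho 0 b ^^ Suc K) (word ys) \<in> gfil (length xs - 1)"
    unfolding eq by (rule subspace_add[OF subspace_gfil 2 1])
  then show ?case
    using ys xs by (intro exI[of _ ys]) auto
qed

lemma word_weight:
  assumes "set xs \<subseteq> letters" and h: "h \<in> cartan G"
  shows "\<exists>t. rho 0 h (word xs) = vscale R t (word xs)"
  using assms(1)
proof (induction xs)
  case Nil
  then show ?case using v0_weight[OF h] by auto
next
  case (Cons b xs)
  then obtain t where t: "rho 0 h (word xs) = vscale R t (word xs)"
    by auto
  have "b \<in> eigen (cartan G)"
    using Cons.prems letters(1) by auto
  then obtain c where "brk G h b = gscale G c b"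
    using h unfolding eigen_def by blast
  then have "rho 0 h (word (b # xs)) = vscale R (t + c) (word (b # xs))"
    using t U_carr[OF word_U, of xs] by (simp add: rho0_rho0 rho_scale_left rho_simps scale_left_distrib)
  then show ?case by blast
qed

text \<open>Collect the copies of b in front of the remaining weight vector: a Cartan letter acts on
  it by a scalar, and a high power of a root vector kills it.\<close>

lemma letter_bound:
  assumes b: "b \<in> letters"
  shows "\<exists>K\<ge>1. \<forall>xs. set xs \<subseteq> letters \<longrightarrow> count_list xs b \<ge> K \<longrightarrow> word xs \<in> gfil (length xs - 1)"
proof (rule letter_cases[OF b])
  assume h: "b \<in> cartan G"
  have "word xs \<in> gfil (length xs - 1)" if xs: "set xs \<subseteq> letters" "count_list xs b \<ge> 1" for xs
  proof -
    obtain ys where ys: "set ys \<subseteq> set xs" "length xs = 1 + length ys"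
        "word xs - (rho 0 b ^^ 1) (word ys) \<in> gfil (length xs - 1)"
      using word_collect[OF xs(2)] by blast
    obtain t where "rho 0 b (word ys) = vscale R t (word ys)"
      using word_weight[OF _ h, of ys] ys(1) xs(1) by blast
    then have "(rho 0 b ^^ 1) (word ys) \<in> gfil (length xs - 1)"
      using word_gfil[of ys] ys(2) by (simp add: subspace_scale[OF subspace_gfil])
    from subspace_add[OF subspace_gfil ys(3) this] show ?thesis by simp
  qed
  then show ?thesis by blast
next
  fix \<alpha> assume \<alpha>: "\<alpha> \<in> roots G" "b \<in> root_space G \<alpha>"
  obtain K where K: "\<And>w t. \<lbrakk>w \<in> U; rho 0 \<alpha> w = vscale R t w\<rbrakk> \<Longrightarrow> (rho 0 b ^^ K) w = 0"
    using root_nilpotent[OF \<alpha>] by blast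
  have "word xs \<in> gfil (length xs - 1)" if xs: "set xs \<subseteq> letters" "count_list xs b \<ge> Suc K" for xs
  proof -
    obtain ys where ys: "set ys \<subseteq> set xs" "word xs - (rho 0 b ^^ K) (word ys) \<in> gfil (length xs - 1)"
      using word_collect[of K xs b] xs(2) by auto
    have "\<alpha> \<in> cartan G" using \<alpha> by (simp add: roots_def)
    then obtain t where "rho 0 \<alpha> (word ys) = vscale R t (word ys)"
      using word_weight[of ys \<alpha>] ys(1) xs(1) by blast
    then have "(rho 0 b ^^ K) (word ys) = 0"
      using K word_U by blast
    with ys(2) show ?thesis by simp
  qed
  then show ?thesis by (intro exI[of _ "Suc K"]) auto
qed

text \<open>Pigeonhole, with N the sum of the bounds K b: a longer word contains some letter b at
  least K b times and reduces to shorter words.\<close>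

lemma U_finite: "\<exists>B. finite B \<and> U = span B"
proof -
  obtain K where K: "\<And>b xs. \<lbrakk>b \<in> letters; set xs \<subseteq> letters; count_list xs b \<ge> K b\<rbrakk> \<Longrightarrow> word xs \<in> gfil (length xs - 1)"
    using letter_bound by metis
  define N where "N = sum K letters"
  have long: "word xs \<in> gfil (length xs - 1)" if xs: "set xs \<subseteq> letters" "length xs > N" for xs
  proof -
    have "sum K letters < sum (count_list xs) letters"
      using sum_count_set[OF xs(1) letters(2)] xs(2) by (simp add: N_def)
    then obtain b where "b \<in> letters" "K b \<le> count_list xs b"
      using sum_mono[of letters "count_list xs" K] by (metis linorder_not_le nle_le)
    then show ?thesis using K xs(1) by blast
  qed
  have "gfil r \<subseteq> gfil N" for r
  proof (induction r)
    case 0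
    then show ?case by (rule gfil_mono) simp
  next
    case (Suc r)
    have "word xs \<in> gfil N" if xs: "set xs \<subseteq> letters" "length xs \<le> Suc r" for xs
    proof (cases "length xs \<le> N")
      case True
      then show ?thesis using word_gfil[of xs] gfil_mono[OF True] by blast
    next
      case False
      then have "word xs \<in> gfil (length xs - 1)" using xs by (intro long) auto
      also have "gfil (length xs - 1) \<subseteq> gfil r" using xs(2) by (intro gfil_mono) auto
      also note Suc
      finally show ?thesis .
    qed
    then show ?case
      unfolding gfil_eq_span_words[of "Suc r"] by (intro span_minimal subspace_gfil) auto
  qed
  then have "U = gfil N"
    using gfil_exhaust by blast
  also have "\<dots> = span (word ` {xs. set xs \<subseteq> letters \<and> length xs \<le> N})"
    unfolding gfil_eq_span_words[of N] by (rule arg_cong[of _ _ span]) blast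
  finally show ?thesis
    using finite_lists_length_le[OF letters(2), of N] by blast
qed

end

context affine_hw
begin

subsection \<open>The energy operator\<close>

definition energy_space :: "int \<Rightarrow> 'v set" where
  "energy_space k = (\<Union>r. fil U r k)"

lemma energy_space_carr: "w \<in> energy_space k \<Longrightarrow> w \<in> carr R"
  unfolding energy_space_def using fil_carrD[OF singular_module_U] by blast

lemma energy_space_rho: "w \<in> energy_space (k + n) \<Longrightarrow> rho n x w \<in> energy_space k"
proof -
  assume "w \<in> energy_space (k + n)"
  then obtain r where "w \<in> fil U r (k + n)"
    by (auto simp: energy_space_def)
  then have "rho n x w \<in> fil U (Suc r) k"
    by (rule fil_rho[OF singular_module_U])
  then show ?thesis
    unfolding energy_space_def by blast
qed

lemma energy_space_neg: "\<lbrakk>w \<in> energy_space k; k < 0\<rbrakk> \<Longrightarrow> w = 0"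
  unfolding energy_space_def using fil_energy[OF singular_module_U] by blast

lemma energy_space_0: "energy_space 0 = U"
proof
  show "energy_space 0 \<subseteq> U"
    unfolding energy_space_def using fil_energy[OF singular_module_U] by blast
  have "U = fil U 0 0" by simp
  then show "U \<subseteq> energy_space 0"
    unfolding energy_space_def by blast
qed

lemma span_energy_space: "span (\<Union>k. energy_space k) = carr R"
proof -
  have "(\<Union>k. energy_space k) = (\<Union>r k. fil U r k)"
    unfolding energy_space_def by blast
  then show ?thesis
    using span_fil[OF singular_module_U v0_U v0_nonzero] by simp
qed

text \<open>Letters of w are moved as adjoints to w', which shifts both energies equally. When no
  letter is left, w is singular and \<open>fil_energy\<close> applies.\<close>

lemma energy_space_orthogonal:
  assumes "w \<in> energy_space k" "w' \<in> energy_space l" "k \<noteq> l"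
  shows "inn R w w' = 0"
proof -
  have "\<forall>l w'. w' \<in> energy_space l \<longrightarrow> k \<noteq> l \<longrightarrow> inn R w w' = 0" if "w \<in> fil U r k" for r w
    using that
  proof (induction r arbitrary: k w)
    case 0
    show ?case
    proof (intro allI impI)
      fix l w' assume w': "w' \<in> energy_space l" "k \<noteq> l"
      show "inn R w w' = 0"
      proof (cases "k = 0")
        case True
        then have w: "w \<in> U" using 0 by simp
        obtain r where "w' \<in> fil U r l"
          using w'(1) by (auto simp: energy_space_def)
        then show ?thesis
          using fil_energy[OF singular_module_U, of w' r l] w w'(2) True U_carr by (cases "l < 0") auto
      next
        case False
        then show ?thesis using 0 energy_space_carr[OF w'(1)] by simp
      qed
    qed
  next
    case (Suc r)
    from Suc.prems show ?case
    proof (induction rule: fil_induct[OF singular_module_U, consumes 1, case_names old rho add scale])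
      case (old w)
      then show ?case by (rule Suc.IH)
    next
      case (rho n x w)
      show ?case
      proof (intro allI impI)
        fix l w' assume w': "w' \<in> energy_space l" "k \<noteq> l"
        have "rho (- n) (gstar G x) w' \<in> energy_space (l + n)"
          using w'(1) by (intro energy_space_rho) simp
        then have "inn R w (rho (- n) (gstar G x) w') = 0"
          using Suc.IH[OF rho] w'(2) by simp
        then show "inn R (rho n x w) w' = 0"
          using fil_carrD[OF singular_module_U rho] energy_space_carr[OF w'(1)]
          by (simp add: rho_adjoint)
      qed
    next
      case (add w w')
      then show ?case using energy_space_carr by simp
    next
      case (scale c w)
      then show ?case using energy_space_carr by simp
    qed
  qed
  with assms show ?thesis
    unfolding energy_space_def by blast
qed

lemma energy_separates:
  assumes "z \<in> carr R" "\<And>k u. u \<in> energy_space k \<Longrightarrow> inn R u z = 0"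
  shows "z = 0"
proof -
  have "subspace {u \<in> carr R. inn R u z = 0}"
    using assms(1) by (intro subspaceI) auto
  then have "span (\<Union>k. energy_space k) \<subseteq> {u \<in> carr R. inn R u z = 0}"
    using assms(2) energy_space_carr by (intro span_minimal) auto
  then show ?thesis
    using assms(1) inn_self_eq_0 unfolding span_energy_space by blast
qed

text \<open>
  The energy components are mutually orthogonal, so the energy operator is determined by its matrix
  elements with homogeneous vectors.
\<close>

definition is_energy :: "'v \<Rightarrow> 'v \<Rightarrow> bool" where
  "is_energy w z \<longleftrightarrow> z \<in> carr R \<and> (\<forall>k. \<forall>u\<in>energy_space k. inn R u z = of_int k * inn R u w)"

definition D :: "'v \<Rightarrow> 'v" where
  "D w = (THE z. is_energy w z)"

lemma is_energy_unique: "\<lbrakk>is_energy w z; is_energy w z'\<rbrakk> \<Longrightarrow> z = z'"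
  using energy_separates[of "z - z'"] energy_space_carr by (simp add: is_energy_def)

lemma is_energy_add: "\<lbrakk>is_energy w z; is_energy w' z'; w \<in> carr R; w' \<in> carr R\<rbrakk> \<Longrightarrow> is_energy (w + w') (z + z')"
  using energy_space_carr by (simp add: is_energy_def algebra_simps)

lemma is_energy_scale: "\<lbrakk>is_energy w z; w \<in> carr R\<rbrakk> \<Longrightarrow> is_energy (vscale R c w) (vscale R c z)"
  using energy_space_carr by (simp add: is_energy_def)

lemma is_energy_eigen: "w \<in> energy_space k \<Longrightarrow> is_energy w (vscale R (of_int k) w)"
  unfolding is_energy_def using energy_space_carr energy_space_orthogonal[of _ _ w k]
  by (metis carr_scale inn_scale_right mult_zero_right)

lemma is_energy_D:
  assumes "w \<in> carr R"
  shows "is_energy w (D w)"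
proof -
  have "w \<in> carr R \<and> (\<exists>z. is_energy w z)"
    using assms unfolding span_energy_space[symmetric]
  proof (induction rule: span_induct_alt)
    case base
    have "is_energy 0 0" using energy_space_carr by (simp add: is_energy_def)
    then show ?case using span_zero by blast
  next
    case (step c x y)
    then obtain k where "x \<in> energy_space k" by blast
    then have "x \<in> carr R" "is_energy x (vscale R (of_int k) x)"
      by (auto intro: is_energy_eigen energy_space_carr)
    with step.IH show ?case
      unfolding span_energy_space by (blast intro: is_energy_add is_energy_scale carr_add carr_scale)
  qed
  then show ?thesis
    unfolding D_def using is_energy_unique by (metis theI)
qed

lemma D_eq: "\<lbrakk>is_energy w z; w \<in> carr R\<rbrakk> \<Longrightarrow> D w = z"
  using is_energy_unique is_energy_D by blast

lemma D_carr: "w \<in> carr R \<Longrightarrow> D w \<in> carr R"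
  and inn_D: "\<lbrakk>w \<in> carr R; u \<in> energy_space k\<rbrakk> \<Longrightarrow> inn R u (D w) = of_int k * inn R u w"
  using is_energy_D unfolding is_energy_def by blast+

lemma lin_D: "lin D"
  by (intro linI D_carr D_eq is_energy_add is_energy_scale is_energy_D carr_add carr_scale)

lemma D_rho:
  assumes w: "w \<in> carr R"
  shows "D (rho n x w) - rho n x (D w) = vscale R (- of_int n) (rho n x w)"
proof -
  have "inn R u (D (rho n x w) - rho n x (D w) - vscale R (- of_int n) (rho n x w)) = 0" if u: "u \<in> energy_space k" for k u
  proof -
    have uc: "u \<in> carr R" using u by (rule energy_space_carr)
    have "rho (- n) (gstar G x) u \<in> energy_space (k + n)"
      using u by (intro energy_space_rho) simp
    then have "inn R (rho (- n) (gstar G x) u) (D w) = of_int (k + n) * inn R (rho (- n) (gstar G x) u) w"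
      using w by (rule inn_D[rotated])
    then show ?thesis
      using uc w u by (simp add: D_carr inn_D rho_adjoint_right[of u _ n x] algebra_simps)
  qed
  then have "D (rho n x w) - rho n x (D w) - vscale R (- of_int n) (rho n x w) = 0"
    using w by (intro energy_separates) (simp_all add: D_carr)
  then show ?thesis by (simp only: right_minus_eq)
qed

text \<open>A vector killed by \<open>D\<close> is orthogonal to all homogeneous vectors of nonzero
  energy, so it equals its projection to U.\<close>

lemma D_zero_iff: "{w \<in> carr R. D w = 0} = U"
proof
  show "U \<subseteq> {w \<in> carr R. D w = 0}"
    using D_eq[OF is_energy_eigen[of _ 0]] energy_space_carr[of _ 0] by (auto simp: energy_space_0)
  show "{w \<in> carr R. D w = 0} \<subseteq> U"
  proof
    fix w assume "w \<in> {w \<in> carr R. D w = 0}"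
    then have w: "w \<in> carr R" "D w = 0" by auto
    obtain a where a: "a \<in> U" "\<And>u. u \<in> U \<Longrightarrow> inn R u w = inn R u a"
      using fil_projection[OF singular_module_U v0_U v0_nonzero w(1)] by metis
    have "inn R u (w - a) = 0" if u: "u \<in> energy_space k" for k u
    proof (cases "k = 0")
      case True
      then show ?thesis
        using u a w(1) U_carr by (simp add: energy_space_0)
    next
      case False
      then have "inn R u w = 0"
        using inn_D[OF w(1) u] w(2) energy_space_carr[OF u] by simp
      moreover have "inn R u a = 0"
        using energy_space_orthogonal[OF u, of a 0] a(1) False by (simp add: energy_space_0)
      ultimately show ?thesis
        using w(1) a(1) U_carr energy_space_carr[OF u] by simp
    qed
    then have "w - a = 0"
      using w(1) a(1) U_carr by (intro energy_separates) auto
    then show "w \<in> U" using a(1) by simp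
  qed
qed

lemma energy_operator_D: "energy_operator R D"
  unfolding energy_operator_def
proof (intro conjI allI ballI lin_D)
  show "D (act R (Xmode a n) w) - act R (Xmode a n) (D w) = vscale R (- of_int n) (act R (Xmode a n) w)"
    if "w \<in> carr R" for a n w
    using D_rho[OF that, of n "basis G a"] by (simp add: rho_basis)
  let ?S = "\<Union>k::nat. {w \<in> carr R. D w = vscale R (of_nat k) w}"
  show "span ?S = carr R"
  proof
    show "span ?S \<subseteq> carr R"
      by (rule span_subset_carr) auto
    have "w \<in> span ?S" if w: "w \<in> energy_space k" for k w
    proof (cases "k < 0")
      case True
      then show ?thesis using energy_space_neg[OF w] span_zero by simp
    next
      case False
      then have "D w = vscale R (of_nat (nat k)) w"
        using D_eq[OF is_energy_eigen[OF w] energy_space_carr[OF w]] by simp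
      then show ?thesis
        using energy_space_carr[OF w] by (intro span_base) blast
    qed
    then have "span (\<Union>k. energy_space k) \<subseteq> span ?S"
      by (intro span_minimal) auto
    then show "carr R \<subseteq> span ?S"
      by (simp add: span_energy_space)
  qed
  show "\<exists>w\<in>carr R. w \<noteq> 0 \<and> D w = 0"
    using v0_nonzero v0_U D_zero_iff by blast
qed

subsection \<open>Integrality of the level\<close>

text \<open>
  In rank one the hypotheses allow \<open>theta G\<close> to be a negative root; \<open>\<beta>\<close> is the positive one of
  \<open>\<plusminus>theta G\<close>. The two \<open>sl\<^sub>2\<close>-triples belong to \<open>\<beta>\<close> and to the affine root \<open>\<delta> - \<beta>\<close>.
\<close>

lemma level_weight_nat: "\<exists>lev::nat. level = of_nat lev \<and> Re (form G lam (theta G)) \<le> real lev"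
proof -
  obtain x where x: "x \<in> root_space G (theta G)" "x \<noteq> 0"
    using theta_highest(1) by (rule root_nonzero_vector)
  have \<theta>: "theta G \<in> cartan G"
    using theta_highest(1) by (simp add: roots_def)
  have "\<exists>\<beta> y. \<beta> \<in> pos_roots G \<and> y \<in> root_space G \<beta> \<and> y \<noteq> 0 \<and> (\<beta> = theta G \<or> \<beta> = - theta G)"
  proof (cases "theta G \<in> pos_roots G")
    case True
    with x show ?thesis by blast
  next
    case False
    then have "- theta G \<in> pos_roots G"
      using pos_roots(2)[OF theta_highest(1)] by blast
    moreover have "gstar G x \<noteq> 0"
      using x(2) by (metis gstar_gstar coord_gstar coord_zero complex_cnj_zero coord_ext)
    ultimately show ?thesis
      using root_vector(1)[OF \<theta> x] by blast
  qed
  then obtain \<beta> y where \<beta>: "\<beta> \<in> pos_roots G" "\<beta> = theta G \<or> \<beta> = - theta G"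
    and y: "y \<in> root_space G \<beta>" "y \<noteq> 0"
    by blast
  have \<beta>c: "\<beta> \<in> cartan G"
    using \<beta>(1) pos_roots(1) by (auto simp: roots_def)
  have \<beta>2: "form G \<beta> \<beta> = 2"
    using \<beta>(2) theta_norm by (auto simp: form_neg_left form_neg_right)
  let ?z = "gstar G y"
  \<comment> \<open>As y is not normalized, its triple differs from a standard one by the factor N.
    The squared length 2 of \<beta> gives the bracket of h and y as 2 N y.\<close>
  define N where "N = Re (form G y ?z)"
  have N: "N > 0" "form G y ?z = complex_of_real N"
    using form_gstar_pos[OF y(2)] form_gstar_self[of y] by (simp_all add: N_def)
  have h: "brk G y ?z = gscale G (complex_of_real N) \<beta>"
    using root_vector(3)[OF \<beta>c y] N by simp
  have hz: "brk G (brk G y ?z) ?z = gscale G (- 2 * complex_of_real N) ?z"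
    using root_vector(1)[OF \<beta>c y] \<beta>c \<beta>2 by (simp add: h root_space_def brk_scale_left form_neg_left)
  have hy: "brk G (brk G y ?z) y = gscale G (2 * complex_of_real N) y"
    using y(1) \<beta>c \<beta>2 by (simp add: h root_space_def brk_scale_left)
  have "\<exists>n::nat. form G lam \<beta> = of_nat n"
  proof (rule sl2_highest_weight_nat)
    show "lin (rho 0 y)" "lin (rho 0 ?z)" "lin (rho 0 (brk G y ?z))" by simp_all
    show "rho 0 y v\<^sub>0 = 0" using v0_pos[OF \<beta>(1) y(1)] .
    show "rho 0 (brk G y ?z) v\<^sub>0 = vscale R (complex_of_real N * form G lam \<beta>) v\<^sub>0"
      by (simp add: h rho_scale_left v0_weight[OF \<beta>c])
    show "rho 0 (brk G y ?z) (rho 0 ?z w) = rho 0 ?z (rho 0 (brk G y ?z) w) - vscale R (2 * complex_of_real N) (rho 0 ?z w)"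
      if "w \<in> carr R" for w
      using rho0_rho0[OF that, of "brk G y ?z" ?z] by (simp add: hz rho_scale_left rho_neg_left)
    show "rho 0 y (rho 0 ?z w) = rho 0 ?z (rho 0 y w) + rho 0 (brk G y ?z) w" if "w \<in> carr R" for w
      using that by (rule rho0_rho0)
  qed (simp_all add: v0_nonzero N(1) rho_adjoint)
  then obtain n :: nat where n: "form G lam \<beta> = of_nat n" by blast
  \<comment> \<open>The affine triple has e = \<open>rho 1 ?z\<close> and f =
    \<open>rho (- 1) y\<close>. Its bracket is N \<open>Z\<close> from the central term, minus the h
    of the finite triple.\<close>
  have "\<exists>m::nat. level - form G lam \<beta> = of_nat m"
  proof (rule sl2_highest_weight_nat)
    let ?h = "\<lambda>w. vscale R (complex_of_real N) (Z w) - rho 0 (brk G y ?z) w"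
    show "lin (rho 1 ?z)" "lin (rho (- 1) y)" by simp_all
    show "lin ?h" by (rule lin_diffI[OF lin_scaleI[OF lin_act] lin_rho])
    show "rho 1 ?z v\<^sub>0 = 0" using U_raise[OF v0_U] by simp
    show "?h v\<^sub>0 = vscale R (complex_of_real N * (level - form G lam \<beta>)) v\<^sub>0"
      by (simp add: h rho_scale_left v0_weight[OF \<beta>c] Z_eq algebra_simps)
    show "rho 1 ?z (rho (- 1) y w) = rho (- 1) y (rho 1 ?z w) + ?h w" if "w \<in> carr R" for w
      using rho_rho[OF that, of 1 ?z "- 1" y] N(2) brk_swap[of ?z y] form_commute[of ?z y]
      by (simp add: rho_neg_left)
    show "?h (rho (- 1) y w) = rho (- 1) y (?h w) - vscale R (2 * complex_of_real N) (rho (- 1) y w)"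
      if "w \<in> carr R" for w
      using rho_rho[OF that, of 0 "brk G y ?z" "- 1" y] that
      by (simp add: hy rho_scale_left Z_rho rho_simps algebra_simps)
  qed (simp_all add: v0_nonzero N(1) rho_adjoint)
  then obtain m :: nat where m: "level - form G lam \<beta> = of_nat m" by blast
  \<comment> \<open>If \<beta> = - \<open>theta G\<close>, the pairing with \<open>theta G\<close>
    is - n, which is below the level n + m as well.\<close>
  have "form G lam (theta G) = of_nat n \<or> form G lam (theta G) = - of_nat n"
    using \<beta>(2) n by (auto simp: form_neg_right minus_equation_iff)
  moreover have "level = of_nat (n + m)"
    using n m by (simp add: algebra_simps)
  ultimately show ?thesis
    by (intro exI[of _ "n + m"]) auto
qed

lemma is_L_lowest_energy:
  assumes R: "unitary_hw_affine_rep G R"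
  shows "\<exists>lev (V :: ('g, 'v) rep). irreducible_lie_rep G lam V \<and> Re (form G lam (theta G)) \<le> real lev \<and> is_L G V lev R"
proof -
  obtain lev :: nat where lev: "level = of_nat lev" "Re (form G lam (theta G)) \<le> real lev"
    using level_weight_nat by blast
  define V where "V = lowest_energy_rep G R D"
  have V [simp]: "carr V = U" "vscale V = vscale R" "act V = rho 0"
    by (simp_all add: V_def lowest_energy_rep_def zero_modes_def D_zero_iff rho_def[abs_def])
  have "linear_rep V"
    using vector_space_scale subspace_U
    by (simp add: linear_rep_def linear_map_between_def rho0_U U_carr rho_simps)
  then have "lie_rep G V"
    using U_carr rho_commutator[of _ 0 _ 0] by (simp add: lie_rep_def rho_add_left rho_scale_left)
  moreover have "irreducible_rep V"
    unfolding irreducible_rep_def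
  proof (intro conjI allI impI)
    show "carr V \<noteq> {0}" using v0_U v0_nonzero by auto
    fix W assume "invariant_subspace V W"
    then have W: "subspace W" "W \<subseteq> U" "\<And>x w. w \<in> W \<Longrightarrow> rho 0 x w \<in> W"
      by (auto simp: invariant_subspace_def)
    \<comment> \<open>As the level is a scalar, a submodule for the zero modes alone is a module in
      the sense of \<open>singular_module\<close>.\<close>
    have "Z w \<in> W" if "w \<in> W" for w
      using that W U_carr by (auto simp: Z_eq subset_iff subspace_scale)
    then have "W = U" if "w \<in> W" "w \<noteq> 0" for w
      using U_irreducible[OF singular_moduleI[OF W]] that by blast
    then show "W = {0} \<or> W = carr V"
      using subspace_0[OF W(1)] by auto
  qed
  moreover have "\<exists>B. finite B \<and> carr V = module.span (vscale V) B"
    using U_finite by simp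
  moreover have "highest_weight_vector G V lam v\<^sub>0"
    by (simp add: highest_weight_vector_def lam_cartan v0_U v0_nonzero v0_weight v0_pos)
  ultimately have "irreducible_lie_rep G lam V"
    unfolding irreducible_lie_rep_def by blast
  moreover have "equivalent_reps V (lowest_energy_rep G R D)"
    unfolding V_def equivalent_reps_def linear_map_between_def
    by (intro exI[of _ "\<lambda>w. w"]) (auto simp: bij_betw_def inj_on_def rho0_U V_def[symmetric])
  then have "is_L G V lev R"
    using R energy_operator_D lev(1) Z_eq unfolding is_L_def by auto
  ultimately show ?thesis
    using lev(2) by blast
qed

end

theorem proposition4p35:
  fixes G :: "('a::finite, 'g::ab_group_add) lie_data"
    and F :: "('a fermion, 'f::ab_group_add) prehilbert_rep"
  assumes "simple_lie_data G" and "is_fock_NS F"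
  shows
    "(\<forall>(lev::nat) (lam::'g) (V::('g, 'v::ab_group_add) rep) (R::('a affine, 'l::ab_group_add) prehilbert_rep).
        irreducible_lie_rep G lam V \<and> Re (form G lam (theta G)) \<le> real lev \<and> is_L G V lev R
          \<longrightarrow> unitary_hw_super_rep G (super_tensor G R F))
     \<and> (\<forall>H::('a super, 'h::ab_group_add) prehilbert_rep. unitary_hw_super_rep G H \<longrightarrow>
         (\<exists>(lev::nat) (lam::'g) (V::('g, 'h) rep) (R::('a affine, 'h) prehilbert_rep).
            irreducible_lie_rep G lam V \<and> Re (form G lam (theta G)) \<le> real lev \<and> is_L G V lev R
              \<and> unitarily_equivalent H (super_tensor G R F)))"
proof (intro conjI allI impI)
  obtain \<Omega> where fock: "fock F \<Omega>"
    using assms(2) by (rule is_fock_NS_fock)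
  then have fl: "fock_lie G F \<Omega>"
    using assms(1) by (intro fock_lie.intro fermi_lie.intro) (auto simp: fock_def)
  {
    fix lev lam V and R :: "('a affine, 'l) prehilbert_rep"
    assume "irreducible_lie_rep G lam V \<and> Re (form G lam (theta G)) \<le> real lev \<and> is_L G V lev R"
    then have R: "unitary_hw_affine_rep G R"
      by (simp add: is_L_def)
    then interpret boson_fock G F \<Omega> R
      by (intro boson_fock.intro fl star_rep.intro boson_fock_axioms.intro) (simp_all add: unitary_hw_affine_rep_def)
    show "unitary_hw_super_rep G (super_tensor G R F)"
      using R by (rule unitary_hw_super_tensor)
  next
    fix H :: "('a super, 'h) prehilbert_rep"
    assume H: "unitary_hw_super_rep G H"
    then obtain v lam where "cyclic_vector H v" "highest_weight_vector G (zero_modes G (restrict_rep Bos H)) lam v"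
        "\<forall>a n. n > 0 \<longrightarrow> act H (Bos (Xmode a n)) v = 0" "\<forall>a n. n \<ge> 0 \<longrightarrow> act H (Ferm (Psi a n)) v = 0"
      unfolding unitary_hw_super_rep_def by blast
    with H interpret S: super_rep G F \<Omega> H v lam
      by (intro super_rep.intro fl star_rep.intro super_rep_axioms.intro) (simp_all add: unitary_hw_super_rep_def)
    have "highest_weight_vector G (zero_modes G S.R) lam v" "\<And>a n. n > 0 \<Longrightarrow> act S.R (Xmode a n) v = 0"
      using S.R_highest by blast+
    then interpret A: affine_hw G S.R v lam
      using S.R_unitary S.R_affine S.R_irreducible
      by (intro affine_hw.intro assms(1) star_rep.intro affine_hw_axioms.intro)
    show "\<exists>lev lam V R. irreducible_lie_rep G lam (V :: ('g, 'h) rep) \<and> Re (form G lam (theta G)) \<le> real lev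
        \<and> is_L G V lev (R :: ('a affine, 'h) prehilbert_rep) \<and> unitarily_equivalent H (super_tensor G R F)"
      using A.is_L_lowest_energy[OF S.R_hw] S.H_equivalent by blast
  }
qed

end
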